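(* Let $q>6$ and let $u\in C^{6}(\mathbb{R}^{5})$, $u>0$, solve $\Delta^{3}u=u^{-q}$ in $\mathbb{R}^{5}$ with $\lim_{|x|\to+\infty}u(x)/|x|=\alpha\in[0,+\infty)$. Then there is a constant $\gamma$ such that $$u(x)=\frac{1}{64\pi^{2}}\int_{\mathbb{R}^{5}}|x-y|\,u^{-q}(y)\,dy+\gamma\qquad\forall x\in\mathbb{R}^{5},$$ and $\gamma<0$ if $6<q<11$, $\gamma=0$ if $q=11$, $\gamma>0$ if $q>11$. Furthermore, if $q=11$, then up to dilations and translations $u(x)=c(1+|x|^{2})^{1/2}$ for a constant $c>0$. *)

theory Defs
  imports "HOL-Analysis.Analysis"
begin

definition partial :: "'n::finite \<Rightarrow> (real^'n \<Rightarrow> real) \<Rightarrow> real^'n \<Rightarrow> real" where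
  "partial i f x = frechet_derivative f (at x) (axis i 1)"

fun Ck :: "nat \<Rightarrow> (real^'n::finite \<Rightarrow> real) \<Rightarrow> bool" where
  "Ck 0 f = continuous_on UNIV f"
| "Ck (Suc k) f = ((\<forall>x. f differentiable (at x)) \<and> continuous_on UNIV f \<and> (\<forall>i. Ck k (partial i f)))"

definition laplacian :: "(real^'n::finite \<Rightarrow> real) \<Rightarrow> real^'n \<Rightarrow> real" where
  "laplacian f x = (\<Sum>i\<in>UNIV. partial i (partial i f) x)"

end

theory Submission
  imports Defs
begin

text \<open>
  Write \<open>f = u\<^sup>-\<^sup>q\<close>. In dimension 5 the function \<open>|x|\<close> is a multiple of the fundamental solution of the
  triple Laplacian. Smoothing it near the origin by a Taylor polynomial at two scales \<open>e < R\<close> and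
  subtracting gives a compactly supported test function, and integration by parts expresses
  the integral of \<open>f\<close> against it by averages of \<open>u\<close> at the scales \<open>e\<close> and \<open>R\<close>.
  Linear growth of \<open>u\<close> first yields that \<open>f\<close> is integrable. Taking differences in the centre and
  letting \<open>e \<rightarrow> 0\<close>, \<open>R \<rightarrow> \<infinity>\<close> (the average at scale \<open>R\<close> of the leading term \<open>\<alpha>|x|\<close> cancels by symmetry) yields
  \<open>64 \<pi>\<^sup>2 (u x - u 0) = \<integral> (|x - y| - |y|) f y dy\<close>. Hence \<open>64 \<pi>\<^sup>2 \<alpha> = \<integral> f > 0\<close>, and the integral equation follows.

  Differentiating under the dilation \<open>x \<mapsto> (1 + h) x\<close> and symmetrising the double integral gives the
  Pohozaev identity \<open>(q - 1) \<gamma> \<integral> f = (q - 11) \<integral> u\<^sup>1\<^sup>-\<^sup>q\<close>, which determines the sign of \<open>\<gamma>\<close>.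

  For \<open>q = 11\<close> the integral equation is conformally invariant. The method of moving spheres shows that
  \<open>u\<close> is invariant under the Kelvin transform in a sphere around every centre \<open>x\<close>, of radius \<open>u x / \<alpha>\<close>.
  Comparing the expansions at infinity for different centres shows that
  \<open>u \<nabla>u - \<alpha>\<^sup>2 x\<close> is constant, so \<open>u\<^sup>2\<close> is a quadratic polynomial.
\<close>

subsection \<open>Integration by parts\<close>

text \<open>Averages at scale R grow like R, so no identity at a single centre survives R to
  infinity; only differences between two centres do. A sixth order operator offers no maximum
  principle, so the moving spheres run entirely on the integral equation: the Kelvin transform minus
  \<open>u\<close> is an integral against a kernel that is positive outside the sphere, and a lower
  bound of this kernel by a function of x times a function of z replaces both the strong maximum
  principle and the Hopf lemma. The constants: 64 pi^2 is the total mass of the averaging kernel,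
  the third Laplacian of the smoothed norm; 6 = 5 + 1 makes |y| f integrable; 11 = 1 + 2 * 5, where
  5 is the volume exponent of dilations and 2 comes from symmetrising a kernel homogeneous of degree
  one. The same 11 lets the Jacobian (l / |z|)^10 of an inversion and the power -11 leave exactly
  one factor |z| / l, the weight of a Kelvin transform.\<close>

lemma integral_lborel_affine:
  fixes F :: "'a::euclidean_space \<Rightarrow> real"
  assumes "c \<noteq> 0" and [measurable]: "F \<in> borel_measurable borel"
  shows "(LBINT x. F x) = \<bar>c\<bar> ^ DIM('a) * (LBINT x. F (t + c *\<^sub>R x))"
  using assms(1) by (subst lborel_affine[of c t]) (simp_all add: integral_density integral_distr)

lemma integrable_lborel_affine:
  fixes F :: "'a::euclidean_space \<Rightarrow> real"
  assumes "c \<noteq> 0" and F: "integrable lborel F"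
  shows "integrable lborel (\<lambda>x. F (t + c *\<^sub>R x))"
proof -
  have [measurable]: "F \<in> borel_measurable borel" using F by auto
  have "integrable (density (distr lborel borel (\<lambda>x. t + c *\<^sub>R x)) (\<lambda>_. ennreal (\<bar>c\<bar>^DIM('a)))) F"
    using F lborel_affine[OF assms(1), of t] by (simp add: ennreal_power)
  then show ?thesis
    using assms(1) by (subst (asm) integrable_density) (auto simp: integrable_distr_eq)
qed

lemma integral_lborel_translate:
  fixes F :: "'a::euclidean_space \<Rightarrow> real"
  assumes "F \<in> borel_measurable borel"
  shows "(LBINT x. F (t + x)) = (LBINT x. F x)"
  using integral_lborel_affine[of 1 F t] assms by simp

lemma integral_lborel_reflect:
  fixes F :: "'a::euclidean_space \<Rightarrow> real"
  assumes "F \<in> borel_measurable borel"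
  shows "(LBINT x. F (- x)) = (LBINT x. F x)"
  using integral_lborel_affine[of "-1" F 0] assms by simp

lemma integrable_continuous_compact_support:
  fixes F :: "'a::euclidean_space \<Rightarrow> real"
  assumes "continuous_on UNIV F" and "\<And>x. norm x > R \<Longrightarrow> F x = 0"
  shows "integrable lborel F"
proof -
  have "integrable lborel (\<lambda>x. indicator (cball 0 R) x *\<^sub>R F x)"
    using borel_integrable_compact[of "cball 0 R" F] continuous_on_subset[OF assms(1)]
    by (auto simp: set_integrable_def)
  also have "(\<lambda>x. indicator (cball 0 R) x *\<^sub>R F x) = F"
    using assms(2) by (auto simp: indicator_def fun_eq_iff not_le)
  finally show ?thesis .
qed

lemma partial_eqI: "(f has_derivative D) (at x) \<Longrightarrow> partial i f x = D (axis i 1)"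
  by (metis frechet_derivative_at partial_def)

lemma partial_has_derivative_along:
  assumes "f differentiable (at (x + t *\<^sub>R axis i 1))"
  shows "((\<lambda>t. f (x + t *\<^sub>R axis i 1)) has_real_derivative partial i f (x + t *\<^sub>R axis i 1)) (at t)"
proof -
  let ?y = "x + t *\<^sub>R axis i (1::real)"
  have D: "(f has_derivative frechet_derivative f (at ?y)) (at ?y)"
    using assms frechet_derivative_works by blast
  have "((\<lambda>t. f (x + t *\<^sub>R axis i 1)) has_derivative (\<lambda>h. frechet_derivative f (at ?y) (h *\<^sub>R axis i 1))) (at t)"
    by (rule has_derivative_compose[where f="\<lambda>t. x + t *\<^sub>R axis i 1" and g=f])
       (auto intro!: derivative_eq_intros D)
  moreover have "(\<lambda>h. frechet_derivative f (at ?y) (h *\<^sub>R axis i 1)) = (\<lambda>h. partial i f ?y * h)"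
    using linear_scale[OF has_derivative_linear[OF D]] by (simp add: partial_def fun_eq_iff)
  ultimately show ?thesis
    by (simp add: has_field_derivative_def)
qed

lemma continuous_on_differentiable:
  "(\<And>x. f differentiable (at x)) \<Longrightarrow> continuous_on UNIV f"
  by (simp add: continuous_at_imp_continuous_on differentiable_imp_continuous_within)

text \<open>The integral of a difference quotient vanishes by translation invariance.\<close>

lemma integral_partial_eq_0:
  fixes g :: "real^'n::finite \<Rightarrow> real"
  assumes dg: "\<And>x. g differentiable (at x)" and cont: "continuous_on UNIV (partial i g)"
    and supp: "\<And>x. norm x > R \<Longrightarrow> g x = 0"
  shows "(LBINT x. partial i g x) = 0"
proof -
  define e :: "real^'n" where "e = axis i 1"
  have ne: "norm e = 1" by (simp add: e_def)
  define h where "h n = 1 / (real n + 1)" for n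
  have h: "h n > 0" "h n \<le> 1" for n by (auto simp: h_def field_simps)
  have h0: "h \<longlonglongrightarrow> 0"
    using LIMSEQ_inverse_real_of_nat by (simp add: h_def[abs_def] inverse_eq_divide add.commute)
  have contg: "continuous_on UNIV g" by (rule continuous_on_differentiable) (rule dg)
  then have [measurable]: "g \<in> borel_measurable borel"
    by (simp add: borel_measurable_continuous_onI)
  have [measurable]: "partial i g \<in> borel_measurable borel"
    using cont by (simp add: borel_measurable_continuous_onI)
  have intg: "integrable lborel g"
    using integrable_continuous_compact_support[OF contg supp] .
  have "compact (partial i g ` cball 0 (R+2))"
    using continuous_on_subset[OF cont] by (intro compact_continuous_image) auto
  then obtain M where "\<forall>z \<in> partial i g ` cball 0 (R+2). norm z \<le> M"
    using compact_imp_bounded bounded_iff by blast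
  then have M: "\<And>x. norm x \<le> R+2 \<Longrightarrow> \<bar>partial i g x\<bar> \<le> M"
    by auto
  define M' where "M' = max M 0"
  have M': "norm x \<le> R+2 \<Longrightarrow> \<bar>partial i g x\<bar> \<le> M'" "M' \<ge> 0" for x using M[of x] by (auto simp: M'_def)
  define D where "D n x = (g (h n *\<^sub>R e + x) - g x) / h n" for n x
  have D0: "(LBINT x. D n x) = 0" for n
  proof -
    have "integrable lborel (\<lambda>x. g (h n *\<^sub>R e + x))"
      using integrable_lborel_affine[of 1 g "h n *\<^sub>R e"] intg by simp
    then show ?thesis
      using intg integral_lborel_translate[of g "h n *\<^sub>R e"] by (simp add: D_def)
  qed
  have along: "((\<lambda>t. g (x + t *\<^sub>R e)) has_real_derivative partial i g (x + t *\<^sub>R e)) (at t)" for x t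
    unfolding e_def by (rule partial_has_derivative_along[OF dg])
  have lim: "(\<lambda>n. D n x) \<longlonglongrightarrow> partial i g x" for x
  proof -
    have "((\<lambda>t. (g (x + t *\<^sub>R e) - g x) / t) \<longlongrightarrow> partial i g x) (at 0)"
      using along[of x 0] by (simp add: has_field_derivative_iff)
    moreover have "filterlim h (at 0) sequentially"
      using h0 h(1) by (auto simp: filterlim_at intro!: always_eventually) (metis less_irrefl)
    ultimately have "(\<lambda>n. (g (x + h n *\<^sub>R e) - g x) / h n) \<longlonglongrightarrow> partial i g x"
      by (rule filterlim_compose)
    then show ?thesis by (simp add: D_def add.commute)
  qed
  have bd: "norm (D n x) \<le> M' * indicator (cball 0 (R+1)) x" for n x
  proof (cases "norm x \<le> R + 1")
    case True
    obtain z where z: "0 < z" "z < h n" "g (x + h n *\<^sub>R e) - g (x + 0 *\<^sub>R e) = (h n - 0) * partial i g (x + z *\<^sub>R e)"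
      using MVT2[of 0 "h n" "\<lambda>t. g (x + t *\<^sub>R e)" "\<lambda>t. partial i g (x + t *\<^sub>R e)"] along h(1) by blast
    have "norm (x + z *\<^sub>R e) \<le> norm x + norm (z *\<^sub>R e)" by (rule norm_triangle_ineq)
    then have "norm (x + z *\<^sub>R e) \<le> R + 2" using True z h(2)[of n] ne by simp
    moreover have "D n x = partial i g (x + z *\<^sub>R e)"
      using z h(1)[of n] by (simp add: D_def add.commute)
    ultimately show ?thesis using M'(1) True by (simp add: indicator_def)
  next
    case False
    have "norm x - norm (h n *\<^sub>R e) \<le> norm (h n *\<^sub>R e + x)"
      using norm_diff_ineq[of x "h n *\<^sub>R e"] by (simp add: add.commute)
    then have "norm (h n *\<^sub>R e + x) > R" using False h[of n] ne by simp
    then show ?thesis using False by (simp add: D_def supp)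
  qed
  have "(\<lambda>n. LBINT x. D n x) \<longlonglongrightarrow> (LBINT x. partial i g x)"
  proof (rule integral_dominated_convergence[where w="\<lambda>x. M' * indicator (cball 0 (R+1)) x"])
    show "D n \<in> borel_measurable lborel" for n unfolding D_def[abs_def] by measurable
    show "integrable lborel (\<lambda>x::real^'n. M' * indicator (cball 0 (R+1)) x)"
      using emeasure_lborel_cball_finite[of "0::real^'n" "R+1"]
      by (intro integrable_mult_right integrable_real_indicator) auto
  qed (use lim bd in auto)
  then show ?thesis using D0 by (simp add: LIMSEQ_const_iff)
qed

section \<open>Calculus of \<open>Ck\<close> functions, Green's formula and radial
  Laplacians\<close>

lemma Ck_continuous: "Ck k f \<Longrightarrow> continuous_on UNIV f" by (cases k) auto

lemma Ck_Suc_imp_Ck: "Ck (Suc k) f \<Longrightarrow> Ck k f"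
proof (induction k arbitrary: f)
  case (Suc k)
  then show ?case using Ck.simps(2)[of "Suc k" f] Ck.simps(2)[of k f] by blast
qed simp

lemma partial_add:
  "f differentiable (at x) \<Longrightarrow> g differentiable (at x) \<Longrightarrow>
   partial i (\<lambda>x. f x + g x) x = partial i f x + partial i g x"
  by (subst partial_eqI[OF has_derivative_add, of f "frechet_derivative f (at x)" x g "frechet_derivative g (at x)"])
     (auto simp: partial_def frechet_derivative_works[symmetric])

lemma Ck_add: "Ck k f \<Longrightarrow> Ck k g \<Longrightarrow> Ck k (\<lambda>x. f x + g x)"
proof (induction k arbitrary: f g)
  case (Suc k)
  have "partial i (\<lambda>x. f x + g x) = (\<lambda>x. partial i f x + partial i g x)" for i
    using Suc.prems by (simp add: fun_eq_iff partial_add)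
  then show ?case using Suc by (simp add: continuous_on_add)
qed (simp add: continuous_on_add)

lemma Ck_const: "Ck k (\<lambda>x::real^'n::finite. c)"
proof (induction k arbitrary: c)
  case (Suc k)
  have "partial i (\<lambda>x::real^'n. c) = (\<lambda>x. 0)" for i
    by (simp add: fun_eq_iff partial_def)
  then show ?case using Suc by (auto simp: Ck.simps)
qed simp

lemma Ck_sum: "(\<And>i. i \<in> I \<Longrightarrow> Ck k (f i)) \<Longrightarrow> Ck k (\<lambda>x. \<Sum>i\<in>I. f i x)"
  by (induction I rule: infinite_finite_induct) (auto intro: Ck_add Ck_const)

lemma Ck_laplacian: "Ck (Suc (Suc k)) f \<Longrightarrow> Ck k (laplacian f)"
  unfolding laplacian_def[abs_def] by (rule Ck_sum) simp

lemma partial_eq_0_outside: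
  assumes "\<And>x. norm x > R \<Longrightarrow> f x = 0" "norm x > R"
  shows "partial i f x = 0"
proof -
  have "open {x::real^'a. norm x > R}" by (intro open_Collect_less continuous_intros)
  from has_derivative_transform_within_open[OF has_derivative_const this, of x 0 f]
  have "(f has_derivative (\<lambda>_. 0)) (at x)"
    using assms by simp
  then show ?thesis by (rule partial_eqI)
qed

text \<open>Each component \<open>w i\<close>, built from v d phi - phi d v, has compact support, so
  its i-th partial integrates to zero; the first order products cancel in that partial and only the
  two second partials remain.\<close>

lemma Green_compact_support:
  fixes v \<phi> :: "real^'n::finite \<Rightarrow> real"
  assumes v: "Ck 2 v" and \<phi>: "Ck 2 \<phi>" and supp: "\<And>x. norm x > R \<Longrightarrow> \<phi> x = 0"
  shows "(LBINT x. laplacian v x * \<phi> x) = (LBINT x. v x * laplacian \<phi> x)"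
proof -
  have C: "continuous_on UNIV f" "f differentiable (at x)" "partial i f differentiable (at x)"
      "continuous_on UNIV (partial i f)" "continuous_on UNIV (partial i (partial i f))"
    if "Ck 2 f" for f :: "real^'n \<Rightarrow> real" and i x
    using that by (auto simp: numeral_2_eq_2)
  define w where "w i x = v x * partial i \<phi> x - \<phi> x * partial i v x" for i x
  have dw: "w i differentiable (at x)" for i x
    unfolding w_def using C[OF v] C[OF \<phi>] by (intro differentiable_diff differentiable_mult) auto
  have pw: "partial i (w i) x = v x * partial i (partial i \<phi>) x - \<phi> x * partial i (partial i v) x" for i x
  proof -
    have D: "(f has_derivative frechet_derivative f (at x)) (at x)"
      "(partial i f has_derivative frechet_derivative (partial i f) (at x)) (at x)" if "Ck 2 f" for f :: "real^'n \<Rightarrow> real"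
      using C(2,3)[OF that] frechet_derivative_works by blast+
    show ?thesis
      unfolding w_def
      by (subst partial_eqI[OF has_derivative_diff[OF has_derivative_mult[OF D(1)[OF v] D(2)[OF \<phi>]]
            has_derivative_mult[OF D(1)[OF \<phi>] D(2)[OF v]]]])
         (simp add: partial_def algebra_simps)
  qed
  have s1: "norm x > R \<Longrightarrow> partial i \<phi> x = 0" for i x by (rule partial_eq_0_outside[OF supp])
  have s2: "norm x > R \<Longrightarrow> partial i (partial i \<phi>) x = 0" for i x by (rule partial_eq_0_outside[OF s1])
  have i1: "integrable lborel (\<lambda>x. v x * partial i (partial i \<phi>) x)" for i
    by (rule integrable_continuous_compact_support[of _ R]) (use C[OF v] C[OF \<phi>] s2 in \<open>auto intro!: continuous_intros\<close>)
  have i2: "integrable lborel (\<lambda>x. \<phi> x * partial i (partial i v) x)" for i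
    by (rule integrable_continuous_compact_support[of _ R]) (use C[OF v] C[OF \<phi>] supp in \<open>auto intro!: continuous_intros\<close>)
  have z: "(LBINT x. v x * partial i (partial i \<phi>) x) = (LBINT x. \<phi> x * partial i (partial i v) x)" for i
  proof -
    have "(LBINT x. partial i (w i) x) = 0"
    proof (rule integral_partial_eq_0[OF dw])
      show "continuous_on UNIV (partial i (w i))"
        unfolding pw[abs_def] using C[OF v] C[OF \<phi>] by (intro continuous_intros)
      show "norm x > R \<Longrightarrow> w i x = 0" for x by (simp add: w_def supp s1)
    qed
    then show ?thesis using i1 i2 by (simp add: pw)
  qed
  have "(LBINT x. laplacian v x * \<phi> x) = (LBINT x. (\<Sum>i\<in>UNIV. \<phi> x * partial i (partial i v) x))"
    by (simp add: laplacian_def sum_distrib_left sum_distrib_right mult.commute)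
  also have "\<dots> = (LBINT x. (\<Sum>i\<in>UNIV. v x * partial i (partial i \<phi>) x))"
    using i1 i2 z by simp
  also have "\<dots> = (LBINT x. v x * laplacian \<phi> x)"
    by (simp add: laplacian_def sum_distrib_left)
  finally show ?thesis .
qed

text \<open>Profiles are functions of the squared norm: it is a polynomial in y, so no singularity
  arises at the centre y = x and smoothness of \<open>F\<close> on the line is enough. The price is
  the form 4 s F'' + 2 n F' of the Laplacian.\<close>

lemma
  fixes x :: "real^'n::finite" and F F1 F2 :: "real \<Rightarrow> real"
  assumes F: "\<And>s. (F has_real_derivative F1 s) (at s)" and F1: "\<And>s. (F1 has_real_derivative F2 s) (at s)"
    and F2: "continuous_on UNIV F2"
  shows Ck_radial: "Ck 2 (\<lambda>y. F ((norm (y - x))\<^sup>2))"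
    and laplacian_radial: "laplacian (\<lambda>y. F ((norm (y - x))\<^sup>2)) y =
      4 * (norm (y - x))\<^sup>2 * F2 ((norm (y - x))\<^sup>2) + 2 * CARD('n) * F1 ((norm (y - x))\<^sup>2)"
proof -
  have sq: "((\<lambda>y. (norm (y - x))\<^sup>2) has_derivative (\<lambda>h. 2 * ((y - x) \<bullet> h))) (at y)" for y
    unfolding power2_norm_eq_inner
    by (auto intro!: derivative_eq_intros simp: inner_commute)
  have comp: "((\<lambda>y. H ((norm (y - x))\<^sup>2)) has_derivative (\<lambda>h. H' ((norm (y - x))\<^sup>2) * (2 * ((y - x) \<bullet> h)))) (at y)"
    if "\<And>s. (H has_real_derivative H' s) (at s)" for H H' y
    using has_derivative_compose[OF sq, of H "(*) (H' ((norm (y - x))\<^sup>2))"] that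
    by (simp add: has_field_derivative_def)
  have p1: "partial i (\<lambda>y. F ((norm (y - x))\<^sup>2)) = (\<lambda>y. F1 ((norm (y - x))\<^sup>2) * (2 * (y - x) $ i))" for i
    by (rule ext, subst partial_eqI[OF comp[OF F]]) (simp add: inner_axis)
  have c1: "((\<lambda>y. 2 * (y - x) $ i) has_derivative (\<lambda>h. 2 * h $ i)) (at y)" for i y
    by (auto intro!: derivative_eq_intros bounded_linear.has_derivative[OF bounded_linear_vec_nth])
  note d2 = has_derivative_mult[OF comp[OF F1] c1]
  have p2: "partial j (\<lambda>y. F1 ((norm (y - x))\<^sup>2) * (2 * (y - x) $ i)) =
      (\<lambda>y. F1 ((norm (y - x))\<^sup>2) * (2 * (axis j 1 :: real^'n) $ i) + F2 ((norm (y - x))\<^sup>2) * (2 * (y - x) $ j) * (2 * (y - x) $ i))" for i j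
    by (rule ext, subst partial_eqI[OF d2]) (simp add: inner_axis)
  have cF: "continuous_on UNIV F" "continuous_on UNIV F1"
    using F F1 by (auto intro!: continuous_at_imp_continuous_on DERIV_isCont)
  have cc: "continuous_on UNIV (\<lambda>y. H ((norm (y - x))\<^sup>2))" if "continuous_on UNIV H" for H :: "real \<Rightarrow> real"
    using that by (rule continuous_on_compose2) (auto intro!: continuous_intros)
  have "Ck (Suc (Suc 0)) (\<lambda>y. F ((norm (y - x))\<^sup>2))"
    unfolding Ck.simps p1 p2
    using comp[OF F] d2 cF F2
    by (intro conjI allI continuous_intros cc) (unfold differentiable_def, blast+)
  then show "Ck 2 (\<lambda>y. F ((norm (y - x))\<^sup>2))"
    by (simp add: numeral_2_eq_2[symmetric])
  have "laplacian (\<lambda>y. F ((norm (y - x))\<^sup>2)) y =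
      (\<Sum>i\<in>UNIV. 2 * F1 ((norm (y - x))\<^sup>2) + 4 * F2 ((norm (y - x))\<^sup>2) * ((y - x) $ i)\<^sup>2)"
    unfolding laplacian_def p1 p2 by (rule sum.cong) (simp_all add: power2_eq_square[of "_ $ _ - _"] algebra_simps)
  also have "\<dots> = 2 * CARD('n) * F1 ((norm (y - x))\<^sup>2) + 4 * F2 ((norm (y - x))\<^sup>2) * (\<Sum>i\<in>UNIV. ((y - x) $ i)\<^sup>2)"
    by (simp add: sum.distrib sum_distrib_left)
  also have "(\<Sum>i\<in>UNIV. ((y - x) $ i)\<^sup>2) = (norm (y - x))\<^sup>2"
    unfolding power2_norm_eq_inner by (simp add: inner_vec_def power2_eq_square)
  finally show "laplacian (\<lambda>y. F ((norm (y - x))\<^sup>2)) y =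
      4 * (norm (y - x))\<^sup>2 * F2 ((norm (y - x))\<^sup>2) + 2 * CARD('n) * F1 ((norm (y - x))\<^sup>2)" by simp
qed

subsection \<open>Radial test functions\<close>

text \<open>The inner piece also covers negative s, so outer pieces such as negative powers only
  have to be regular for s > 0, while the glued function is differentiable on the whole line, as
  \<open>laplacian_radial\<close> requires.\<close>

definition glue :: "(real \<Rightarrow> real) \<Rightarrow> (real \<Rightarrow> real) \<Rightarrow> real \<Rightarrow> real" where
  "glue p q s = (if s \<le> 1 then p s else q s)"

lemma glue_has_derivative:
  assumes p: "\<And>s. (p has_real_derivative p' s) (at s)"
    and q: "\<And>s. s > 0 \<Longrightarrow> (q has_real_derivative q' s) (at s)"
    and eq: "p 1 = q 1" "p' 1 = q' 1"
  shows "(glue p q has_real_derivative glue p' q' s) (at s)"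
proof (cases s "1::real" rule: linorder_cases)
  case less
  have "(glue p q has_real_derivative p' s) (at s)"
    by (rule has_field_derivative_transform_within_open[OF p, of "{..<1}"]) (use less in \<open>auto simp: glue_def\<close>)
  then show ?thesis using less by (simp add: glue_def)
next
  case greater
  have "(glue p q has_real_derivative q' s) (at s)"
    by (rule has_field_derivative_transform_within_open[OF q, of s "{1<..}"]) (use greater in \<open>auto simp: glue_def\<close>)
  then show ?thesis using greater by (simp add: glue_def)
next
  case equal
  \<comment> \<open>At the break point the two one-sided difference quotients have the same limit
    because values and first derivatives match there.\<close>
  have "((\<lambda>y. (glue p q y - glue p q 1) / (y - 1)) \<longlongrightarrow> p' 1) (at 1)"
  proof (rule filterlim_split_at)
    have "((\<lambda>y. (p y - p 1) / (y - 1)) \<longlongrightarrow> p' 1) (at_left 1)"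
      using p[of 1] unfolding has_field_derivative_iff by (rule filterlim_mono) (auto simp: at_le)
    then show "((\<lambda>y. (glue p q y - glue p q 1) / (y - 1)) \<longlongrightarrow> p' 1) (at_left 1)"
      by (rule tendsto_cong[THEN iffD1, rotated])
         (auto simp: glue_def eventually_at_filter intro!: always_eventually)
    have "((\<lambda>y. (q y - q 1) / (y - 1)) \<longlongrightarrow> p' 1) (at_right 1)"
      using q[of 1] unfolding has_field_derivative_iff eq by (auto elim!: filterlim_mono simp: at_le)
    then show "((\<lambda>y. (glue p q y - glue p q 1) / (y - 1)) \<longlongrightarrow> p' 1) (at_right 1)"
      by (rule tendsto_cong[THEN iffD1, rotated])
         (auto simp: glue_def eq eventually_at_filter intro!: always_eventually)
  qed
  then show ?thesis using equal by (simp add: has_field_derivative_iff glue_def)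
qed

lemma continuous_on_glue:
  assumes "continuous_on UNIV p" "continuous_on {1..} q" "p 1 = q 1"
  shows "continuous_on UNIV (glue p q)"
proof -
  have "continuous_on UNIV (\<lambda>s. if s \<le> 1 then p s else q s)"
    using assms by (intro continuous_on_cases_le) (auto simp: atLeast_def intro: continuous_on_subset)
  then show ?thesis by (simp add: glue_def[abs_def])
qed

text \<open>\<open>radial_laplacian F H\<close> says that \<open>H(|x|\<^sup>2)\<close> is the Laplacian of \<open>F(|x|\<^sup>2)\<close> in dimension 5.\<close>

definition radial_laplacian :: "(real \<Rightarrow> real) \<Rightarrow> (real \<Rightarrow> real) \<Rightarrow> bool" where
  "radial_laplacian F H \<longleftrightarrow> (\<exists>F1 F2. (\<forall>s. (F has_real_derivative F1 s) (at s)) \<and>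
     (\<forall>s. (F1 has_real_derivative F2 s) (at s)) \<and> continuous_on UNIV F2 \<and>
     (\<forall>s. H s = 4 * s * F2 s + 10 * F1 s))"

text \<open>The radial Laplacian lowers the degree in s by one, so replacing s by k s costs one
  factor k. With k = 1 / a^2, three steps turn the prefactor a into a^(-1), a^(-3), a^(-5).\<close>

lemma radial_laplacian_scale:
  assumes "radial_laplacian F H"
  shows "radial_laplacian (\<lambda>s. c * F (k * s)) (\<lambda>s. c * k * H (k * s))"
proof -
  obtain F1 F2 where F: "\<And>s. (F has_real_derivative F1 s) (at s)" "\<And>s. (F1 has_real_derivative F2 s) (at s)"
    "continuous_on UNIV F2" "\<And>s. H s = 4 * s * F2 s + 10 * F1 s"
    using assms unfolding radial_laplacian_def by blast
  have D: "((\<lambda>s. K (k * s)) has_real_derivative K' (k * s) * k) (at s)"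
    if "\<And>s. (K has_real_derivative K' s) (at s)" for K K' s
    by (rule DERIV_chain'[of "\<lambda>s. k * s", OF _ that]) (auto intro!: derivative_eq_intros)
  show ?thesis
    unfolding radial_laplacian_def
  proof (rule exI[of _ "\<lambda>s. c * (F1 (k * s) * k)"], rule exI[of _ "\<lambda>s. c * (F2 (k * s) * k * k)"], intro conjI allI)
    show "((\<lambda>s. c * F (k * s)) has_real_derivative c * (F1 (k * s) * k)) (at s)" for s
      by (intro DERIV_cmult D F)
    show "((\<lambda>s. c * (F1 (k * s) * k)) has_real_derivative c * (F2 (k * s) * k * k)) (at s)" for s
      by (intro DERIV_cmult DERIV_cmult_right D F)
    show "continuous_on UNIV (\<lambda>s. c * (F2 (k * s) * k * k))"
      by (intro continuous_intros continuous_on_compose2[OF F(3)]) auto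
    show "c * k * H (k * s) = 4 * s * (c * (F2 (k * s) * k * k)) + 10 * (c * (F1 (k * s) * k))" for s
      by (simp add: F(4) algebra_simps)
  qed
qed

lemma radial_laplacian_diff:
  assumes "radial_laplacian F H" "radial_laplacian F' H'"
  shows "radial_laplacian (\<lambda>s. F s - F' s) (\<lambda>s. H s - H' s)"
proof -
  obtain F1 F2 where F: "\<And>s. (F has_real_derivative F1 s) (at s)" "\<And>s. (F1 has_real_derivative F2 s) (at s)"
    "continuous_on UNIV F2" "\<And>s. H s = 4 * s * F2 s + 10 * F1 s"
    using assms unfolding radial_laplacian_def by blast
  obtain G1 G2 where G: "\<And>s. (F' has_real_derivative G1 s) (at s)" "\<And>s. (G1 has_real_derivative G2 s) (at s)"
    "continuous_on UNIV G2" "\<And>s. H' s = 4 * s * G2 s + 10 * G1 s"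
    using assms unfolding radial_laplacian_def by blast
  show ?thesis unfolding radial_laplacian_def
    by (rule exI[of _ "\<lambda>s. F1 s - G1 s"], rule exI[of _ "\<lambda>s. F2 s - G2 s"])
       (use F G in \<open>auto intro!: DERIV_diff continuous_intros simp: algebra_simps\<close>)
qed

lemma Green_radial:
  fixes v :: "real^5 \<Rightarrow> real"
  assumes v: "Ck 2 v" and F: "radial_laplacian F H" and supp: "\<And>s. s \<ge> R\<^sup>2 \<Longrightarrow> F s = 0" and R: "R \<ge> 0"
  shows "(LBINT y. laplacian v y * F ((norm (y - x))\<^sup>2)) = (LBINT y. v y * H ((norm (y - x))\<^sup>2))"
proof -
  obtain F1 F2 where F: "\<And>s. (F has_real_derivative F1 s) (at s)" "\<And>s. (F1 has_real_derivative F2 s) (at s)"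
    "continuous_on UNIV F2" "\<And>s. H s = 4 * s * F2 s + 10 * F1 s"
    using F unfolding radial_laplacian_def by blast
  have "F ((norm (y - x))\<^sup>2) = 0" if "norm y > R + norm x" for y :: "real^5"
  proof -
    have "norm (y - x) \<ge> R" using that norm_triangle_ineq2[of y x] by simp
    then show ?thesis using R by (intro supp power_mono)
  qed
  then show ?thesis
    using Green_compact_support[OF v Ck_radial[OF F(1-3)], of "R + norm x" x]
    by (simp add: laplacian_radial[OF F(1-3)] F(4))
qed

text \<open>The polynomial pieces below are the degree 6 Taylor polynomial of the square root at 1
  and its iterated radial Laplacians. Hence \<open>a * prof0 (|x|\<^sup>2/a\<^sup>2)\<close> is a \<open>C\<^sup>6\<close> function which agrees
  with the multiple \<open>|x|\<close> of the fundamental solution of the triple Laplacian off a ball of radius \<open>a\<close>.\<close>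

definition prof0 :: "real \<Rightarrow> real" where
  "prof0 = glue (\<lambda>s. (231 + 1386 * s - 1155 * s^2 + 924 * s^3 - 495 * s^4 + 154 * s^5 - 21 * s^6) / 1024)
     (\<lambda>s. s powr (1/2))"

definition prof1 :: "real \<Rightarrow> real" where
  "prof1 = glue (\<lambda>s. (3465 - 8085 * s + 12474 * s^2 - 10890 * s^3 + 5005 * s^4 - 945 * s^5) / 256)
     (\<lambda>s. 4 * s powr (-1/2))"

definition prof2 :: "real \<Rightarrow> real" where
  "prof2 = glue (\<lambda>s. (- 40425 + 174636 * s - 294030 * s^2 + 220220 * s^3 - 61425 * s^4) / 128)
     (\<lambda>s. - 8 * s powr (-3/2))"

definition prof3 :: "real \<Rightarrow> real" where
  "prof3 = glue (\<lambda>s. (218295 - 1029105 * s + 1486485 * s^2 - 675675 * s^3) / 16) (\<lambda>s. 0)"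

text \<open>Each Laplacian consumes two orders of agreement at s = 1. Starting from agreement up to
  order 6, three applications leave order 0, which is continuity of \<open>prof3\<close>.\<close>

lemma radial_laplacian_glue:
  assumes p: "\<And>s. (p has_real_derivative p1 s) (at s)" "\<And>s. (p1 has_real_derivative p2 s) (at s)"
    and q: "\<And>s. s > 0 \<Longrightarrow> (q has_real_derivative q1 s) (at s)"
      "\<And>s. s > 0 \<Longrightarrow> (q1 has_real_derivative q2 s) (at s)"
    and c: "continuous_on UNIV p2" "continuous_on {1..} q2"
    and eq: "p 1 = q 1" "p1 1 = q1 1" "p2 1 = q2 1"
    and H: "\<And>s. h s = 4 * s * p2 s + 10 * p1 s" "\<And>s. s > 0 \<Longrightarrow> k s = 4 * s * q2 s + 10 * q1 s"
  shows "radial_laplacian (glue p q) (glue h k)"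
  unfolding radial_laplacian_def
proof (rule exI[of _ "glue p1 q1"], rule exI[of _ "glue p2 q2"], intro conjI allI)
  show "(glue p q has_real_derivative glue p1 q1 s) (at s)" for s
    using p q eq by (intro glue_has_derivative)
  show "(glue p1 q1 has_real_derivative glue p2 q2 s) (at s)" for s
    using p q eq by (intro glue_has_derivative)
  show "continuous_on UNIV (glue p2 q2)" using c eq by (intro continuous_on_glue)
  show "glue h k s = 4 * s * glue p2 q2 s + 10 * glue p1 q1 s" for s
    by (simp add: glue_def H)
qed

text \<open>Outer pieces of this and the next two lemmas: in dimension 5 the Laplacian maps |x| to 4
  / |x|, this to -8 / |x|^3, and |x|^(-3) is harmonic away from the origin.\<close>

lemma radial_laplacian_prof0: "radial_laplacian prof0 prof1"
  unfolding prof0_def prof1_def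
proof (rule radial_laplacian_glue)
  show "((\<lambda>s. (231 + 1386 * s - 1155 * s^2 + 924 * s^3 - 495 * s^4 + 154 * s^5 - 21 * s^6) / 1024)
     has_real_derivative (1386 - 2310 * s + 2772 * s^2 - 1980 * s^3 + 770 * s^4 - 126 * s^5) / 1024) (at s)" for s :: real
    by (auto intro!: derivative_eq_intros simp: field_simps)
  show "((\<lambda>s. (1386 - 2310 * s + 2772 * s^2 - 1980 * s^3 + 770 * s^4 - 126 * s^5) / 1024)
     has_real_derivative (- 2310 + 5544 * s - 5940 * s^2 + 3080 * s^3 - 630 * s^4) / 1024) (at s)" for s :: real
    by (auto intro!: derivative_eq_intros simp: field_simps)
  show "((\<lambda>s. s powr (1/2)) has_real_derivative 1/2 * s powr (-1/2)) (at s)" if "s > 0" for s :: real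
    using that by (auto intro!: derivative_eq_intros simp: field_simps)
  show "((\<lambda>s. 1/2 * s powr (-1/2)) has_real_derivative - 1/4 * s powr (-3/2)) (at s)" if "s > 0" for s :: real
    using that by (auto intro!: derivative_eq_intros simp: field_simps)
  show "4 * s powr (-1/2) = 4 * s * (- 1/4 * s powr (-3/2)) + 10 * (1/2 * s powr (-1/2))" if "s > 0" for s :: real
    using that powr_mult_base[of s "-3/2"] by simp
qed (auto intro!: continuous_intros simp: field_simps eval_nat_numeral)

lemma radial_laplacian_prof1: "radial_laplacian prof1 prof2"
  unfolding prof1_def prof2_def
proof (rule radial_laplacian_glue)
  show "((\<lambda>s. (3465 - 8085 * s + 12474 * s^2 - 10890 * s^3 + 5005 * s^4 - 945 * s^5) / 256)
     has_real_derivative (- 8085 + 24948 * s - 32670 * s^2 + 20020 * s^3 - 4725 * s^4) / 256) (at s)" for s :: real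
    by (auto intro!: derivative_eq_intros simp: field_simps)
  show "((\<lambda>s. (- 8085 + 24948 * s - 32670 * s^2 + 20020 * s^3 - 4725 * s^4) / 256)
     has_real_derivative (24948 - 65340 * s + 60060 * s^2 - 18900 * s^3) / 256) (at s)" for s :: real
    by (auto intro!: derivative_eq_intros simp: field_simps)
  show "((\<lambda>s. 4 * s powr (-1/2)) has_real_derivative - 2 * s powr (-3/2)) (at s)" if "s > 0" for s :: real
    using that by (auto intro!: derivative_eq_intros simp: field_simps)
  show "((\<lambda>s. - 2 * s powr (-3/2)) has_real_derivative 3 * s powr (-5/2)) (at s)" if "s > 0" for s :: real
    using that by (auto intro!: derivative_eq_intros simp: field_simps)
  show "- 8 * s powr (-3/2) = 4 * s * (3 * s powr (-5/2)) + 10 * (- 2 * s powr (-3/2))" if "s > 0" for s :: real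
    using that powr_mult_base[of s "-5/2"] by simp
qed (auto intro!: continuous_intros simp: field_simps eval_nat_numeral)

lemma radial_laplacian_prof2: "radial_laplacian prof2 prof3"
  unfolding prof2_def prof3_def
proof (rule radial_laplacian_glue)
  show "((\<lambda>s. (- 40425 + 174636 * s - 294030 * s^2 + 220220 * s^3 - 61425 * s^4) / 128)
     has_real_derivative (174636 - 588060 * s + 660660 * s^2 - 245700 * s^3) / 128) (at s)" for s :: real
    by (auto intro!: derivative_eq_intros simp: field_simps)
  show "((\<lambda>s. (174636 - 588060 * s + 660660 * s^2 - 245700 * s^3) / 128)
     has_real_derivative (- 588060 + 1321320 * s - 737100 * s^2) / 128) (at s)" for s :: real
    by (auto intro!: derivative_eq_intros simp: field_simps)
  show "((\<lambda>s. - 8 * s powr (-3/2)) has_real_derivative 12 * s powr (-5/2)) (at s)" if "s > 0" for s :: real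
    using that by (auto intro!: derivative_eq_intros simp: field_simps)
  show "((\<lambda>s. 12 * s powr (-5/2)) has_real_derivative - 30 * s powr (-7/2)) (at s)" if "s > 0" for s :: real
    using that by (auto intro!: derivative_eq_intros simp: field_simps)
  show "0 = 4 * s * (- 30 * s powr (-7/2)) + 10 * (12 * s powr (-5/2))" if "s > 0" for s :: real
    using that powr_mult_base[of s "-7/2"] by simp
qed (auto intro!: continuous_intros simp: field_simps eval_nat_numeral)

text \<open>With s = r^2 the Taylor polynomial minus r vanishes to order 7 at r = 1, and the
  cofactor of (1 - r)^7 has only positive coefficients.\<close>

lemma prof0_ge_sqrt:
  assumes "s \<ge> 0" shows "sqrt s \<le> prof0 s"
proof (cases "s \<le> 1")
  case True
  define r where "r = sqrt s"
  have r: "0 \<le> r" "r \<le> 1" "s = r^2" using True assms by (auto simp: r_def)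
  have "(231 + 1386 * s - 1155 * s^2 + 924 * s^3 - 495 * s^4 + 154 * s^5 - 21 * s^6) / 1024 - r
      = (1 - r)^7 * (231 + 593 * r + 686 * r^2 + 434 * r^3 + 147 * r^4 + 21 * r^5) / 1024"
    unfolding r(3) by (simp add: field_simps) algebra
  also have "\<dots> \<ge> 0" using r by simp
  finally show ?thesis using True by (simp add: prof0_def glue_def r_def)
qed (use assms in \<open>auto simp: prof0_def glue_def powr_half_sqrt\<close>)

text \<open>The number 231 / 1024 is \<open>prof0 0\<close>. After scaling it gives a positive lower
  bound proportional to the scale, which is what makes \<open>f\<close> integrable later.\<close>

lemma
  assumes "s \<ge> 0"
  shows prof0_lower: "prof0 s \<ge> 231 / 1024" and prof0_upper: "prof0 s \<le> max 1 (sqrt s)"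
proof -
  have "prof0 s \<ge> 231 / 1024 \<and> prof0 s \<le> max 1 (sqrt s)"
  proof (cases "s \<le> 1")
    case True
    define t where "t = 1 - s"
    \<comment> \<open>Each negative term is absorbed by the preceding odd power, since 1155 <= 1386,
      495 <= 924 and 21 <= 154.\<close>
    have "s^2 \<le> s" "s^4 \<le> s^3" "s^6 \<le> s^5" using True assms by (auto intro: power_decreasing[of 1 2 s, simplified] power_decreasing)
    then have "231 \<le> 231 + 1386 * s - 1155 * s^2 + 924 * s^3 - 495 * s^4 + 154 * s^5 - 21 * s^6"
      using assms zero_le_power[of s 3] zero_le_power[of s 5] by linarith
    \<comment> \<open>In t = 1 - s this is the truncated binomial series of sqrt (1 - t), all of
      whose nonconstant coefficients are negative.\<close>
    moreover have "231 + 1386 * s - 1155 * s^2 + 924 * s^3 - 495 * s^4 + 154 * s^5 - 21 * s^6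
      = 1024 - t * (512 + 128 * t + 64 * t^2 + 40 * t^3 + 28 * t^4 + 21 * t^5)"
      unfolding t_def by algebra
    moreover have "t * (512 + 128 * t + 64 * t^2 + 40 * t^3 + 28 * t^4 + 21 * t^5) \<ge> 0"
      using True by (simp add: t_def)
    ultimately show ?thesis using True by (simp add: prof0_def glue_def)
  next
    case False
    then have "sqrt s \<ge> 1" by simp
    moreover have "prof0 s = sqrt s" using False by (simp add: prof0_def glue_def powr_half_sqrt)
    ultimately show ?thesis by linarith
  qed
  then show "prof0 s \<ge> 231 / 1024" "prof0 s \<le> max 1 (sqrt s)" by auto
qed

lemma prof0_eq_sqrt: "s \<ge> 1 \<Longrightarrow> prof0 s = sqrt s"
  by (cases "s = 1") (auto simp: prof0_def glue_def powr_half_sqrt)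

lemma prof0_le_sqrt_add_1: "s \<ge> 0 \<Longrightarrow> prof0 s \<le> sqrt s + 1"
  using prof0_upper[of s] real_sqrt_ge_zero[of s] by linarith

text \<open>Beyond its scale a smoothed profile no longer depends on a, so the difference of two
  scales at most R vanishes for s >= R^2. This is where the test functions get their compact
  support.\<close>

lemma prof_eq_scaled:
  assumes "s \<ge> R\<^sup>2" "R \<ge> a" "a > 0"
  shows "a * prof0 (inverse (a\<^sup>2) * s) = sqrt s"
    "inverse a * prof1 (inverse (a\<^sup>2) * s) = 4 * s powr (-1/2)"
    "inverse (a^3) * prof2 (inverse (a\<^sup>2) * s) = - 8 * s powr (-3/2)"
proof -
  have "s \<ge> a\<^sup>2" using assms power_mono[of a R 2] by linarith
  then have s: "inverse (a\<^sup>2) * s \<ge> 1" "s > 0" using assms(3)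
    by (auto simp: field_simps intro: less_le_trans[of 0 "a\<^sup>2"])
  have a: "inverse (a\<^sup>2) > 0" using assms by simp
  have pw: "(inverse (a\<^sup>2)) powr (1/2) = inverse a" "(inverse (a\<^sup>2)) powr (-1/2) = a" "(inverse (a\<^sup>2)) powr (-3/2) = a^3"
    using assms(3) by (simp_all add: powr_minus inverse_powr powr_powr flip: powr_numeral)
  have p1: "t \<ge> 1 \<Longrightarrow> prof1 t = 4 * t powr (-1/2)" "t \<ge> 1 \<Longrightarrow> prof2 t = - 8 * t powr (-3/2)" for t
    by (cases "t = 1"; simp add: prof1_def prof2_def glue_def)+
  show "a * prof0 (inverse (a\<^sup>2) * s) = sqrt s"
    using s assms(3) by (simp add: prof0_eq_sqrt real_sqrt_mult real_sqrt_inverse)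
  show "inverse a * prof1 (inverse (a\<^sup>2) * s) = 4 * s powr (-1/2)"
    "inverse (a^3) * prof2 (inverse (a\<^sup>2) * s) = - 8 * s powr (-3/2)"
    using s assms(3) by (simp_all only: p1[OF s(1)] powr_mult[of "inverse (a\<^sup>2)" s] pw) simp_all
qed

text \<open>Green's formula moves the three Laplacians one at a time; each intermediate difference
  of profiles again vanishes beyond R.\<close>

lemma triharmonic_identity_unscaled:
  fixes u :: "real^5 \<Rightarrow> real"
  assumes u: "Ck 6 u" and e: "0 < e" "e \<le> R"
  shows "(LBINT y. (laplacian ^^ 3) u y * (e * prof0 (inverse (e\<^sup>2) * (norm (y - x))\<^sup>2) - R * prof0 (inverse (R\<^sup>2) * (norm (y - x))\<^sup>2)))
       = (LBINT y. u y * (inverse (e^5) * prof3 (inverse (e\<^sup>2) * (norm (y - x))\<^sup>2) - inverse (R^5) * prof3 (inverse (R\<^sup>2) * (norm (y - x))\<^sup>2)))"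
proof -
  have u6: "Ck (Suc (Suc (Suc (Suc (Suc (Suc 0)))))) u" using u by (simp add: eval_nat_numeral)
  have u4: "Ck (Suc (Suc (Suc (Suc 0)))) (laplacian u)" using Ck_laplacian u6 by blast
  have u2: "Ck (Suc (Suc 0)) (laplacian (laplacian u))" using Ck_laplacian u4 by blast
  have two: "Ck 2 f = Ck (Suc (Suc 0)) f" for f :: "real^5 \<Rightarrow> real" by (simp add: numeral_2_eq_2)
  have c0: "Ck 2 u" "Ck 2 (laplacian u)" "Ck 2 (laplacian (laplacian u))"
    unfolding two using u6 u4 u2 Ck_Suc_imp_Ck by blast+
  have R: "R > 0" using e by linarith
  have l: "radial_laplacian (\<lambda>s. e * prof0 (inverse (e\<^sup>2) * s) - R * prof0 (inverse (R\<^sup>2) * s))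
    (\<lambda>s. inverse e * prof1 (inverse (e\<^sup>2) * s) - inverse R * prof1 (inverse (R\<^sup>2) * s))"
    "radial_laplacian (\<lambda>s. inverse e * prof1 (inverse (e\<^sup>2) * s) - inverse R * prof1 (inverse (R\<^sup>2) * s))
    (\<lambda>s. inverse (e^3) * prof2 (inverse (e\<^sup>2) * s) - inverse (R^3) * prof2 (inverse (R\<^sup>2) * s))"
    "radial_laplacian (\<lambda>s. inverse (e^3) * prof2 (inverse (e\<^sup>2) * s) - inverse (R^3) * prof2 (inverse (R\<^sup>2) * s))
    (\<lambda>s. inverse (e^5) * prof3 (inverse (e\<^sup>2) * s) - inverse (R^5) * prof3 (inverse (R\<^sup>2) * s))"
    using radial_laplacian_diff[OF radial_laplacian_scale[OF radial_laplacian_prof0, of e "inverse (e\<^sup>2)"] radial_laplacian_scale[OF radial_laplacian_prof0, of R "inverse (R\<^sup>2)"]]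
     radial_laplacian_diff[OF radial_laplacian_scale[OF radial_laplacian_prof1, of "inverse e" "inverse (e\<^sup>2)"] radial_laplacian_scale[OF radial_laplacian_prof1, of "inverse R" "inverse (R\<^sup>2)"]]
     radial_laplacian_diff[OF radial_laplacian_scale[OF radial_laplacian_prof2, of "inverse (e^3)" "inverse (e\<^sup>2)"] radial_laplacian_scale[OF radial_laplacian_prof2, of "inverse (R^3)" "inverse (R\<^sup>2)"]]
     e R by (simp_all add: power_eq_if field_simps)
  have z: "s \<ge> R\<^sup>2 \<Longrightarrow> e * prof0 (inverse (e\<^sup>2) * s) - R * prof0 (inverse (R\<^sup>2) * s) = 0"
     "s \<ge> R\<^sup>2 \<Longrightarrow> inverse e * prof1 (inverse (e\<^sup>2) * s) - inverse R * prof1 (inverse (R\<^sup>2) * s) = 0"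
     "s \<ge> R\<^sup>2 \<Longrightarrow> inverse (e^3) * prof2 (inverse (e\<^sup>2) * s) - inverse (R^3) * prof2 (inverse (R\<^sup>2) * s) = 0" for s
    using prof_eq_scaled[of R s e] prof_eq_scaled[of R s R] e R by (simp_all only:)
  have "(laplacian ^^ 3) u = laplacian (laplacian (laplacian u))" by (simp add: numeral_3_eq_3)
  then show ?thesis
    using Green_radial[OF c0(3) l(1) z(1), where x=x] Green_radial[OF c0(2) l(2) z(2), where x=x] Green_radial[OF c0(1) l(3) z(3), where x=x] R
    by simp
qed

subsection \<open>Radial integrals\<close>

text \<open>The measures are compared on half-lines, which are stable under intersection and
  generate the Borel sets: one side is the volume of a ball, the other the integral of its
  derivative in the radius.\<close>

lemma distr_norm_lborel:
  "distr (lborel :: 'a::euclidean_space measure) borel norm =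
   density lborel (\<lambda>r. ennreal (unit_ball_vol DIM('a) * (DIM('a) * r ^ (DIM('a) - 1)) * indicator {0..} r))"
  (is "?M = ?N")
proof (rule measure_eqI_generator_eq[where E="range (\<lambda>a::real. {..a})" and \<Omega>=UNIV and A="\<lambda>n::nat. {..real n}"])
  let ?V = "unit_ball_vol DIM('a)"
  have M: "emeasure ?M {..a} = (if a \<ge> 0 then ennreal (?V * a ^ DIM('a)) else 0)" for a
  proof -
    have "emeasure ?M {..a} = emeasure lborel (cball (0::'a) a)"
      by (subst emeasure_distr) (auto intro!: arg_cong[of _ _ "emeasure lborel"])
    then show ?thesis by (simp add: emeasure_cball)
  qed
  have N: "emeasure ?N {..a} = (if a \<ge> 0 then ennreal (?V * a ^ DIM('a)) else 0)" for a
  proof -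
    have "emeasure ?N {..a} = (\<integral>\<^sup>+r. ennreal (?V * (DIM('a) * r ^ (DIM('a) - 1))) * indicator {0..a} r \<partial>lborel)"
      by (subst emeasure_density) (auto intro!: nn_integral_cong simp: indicator_def)
    also have "\<dots> = (if a \<ge> 0 then ennreal (?V * a ^ DIM('a)) else 0)"
    proof (cases "a \<ge> 0")
      case True
      have "(\<integral>\<^sup>+r. ennreal (?V * (DIM('a) * r ^ (DIM('a) - 1))) * indicator {0..a} r \<partial>lborel) =
        ennreal (?V * a ^ DIM('a) - ?V * 0 ^ DIM('a))"
        by (rule nn_integral_FTC_Icc) (auto intro!: derivative_eq_intros True)
      then show ?thesis using True by simp
    qed simp
    finally show ?thesis .
  qed
  show "emeasure ?M X = emeasure ?N X" if "X \<in> range (\<lambda>a. {..a})" for X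
    using that M N by auto
  show "Int_stable (range (\<lambda>a::real. {..a}))" by (auto simp: Int_stable_def)
  show "sets ?M = sigma_sets UNIV (range (\<lambda>a::real. {..a}))"
    unfolding sets_distr by (subst borel_eq_atMost) simp
  show "sets ?N = sigma_sets UNIV (range (\<lambda>a::real. {..a}))"
    unfolding sets_density sets_lborel by (subst borel_eq_atMost) simp
  show "(\<Union>i. {..real i}) = UNIV" by (auto intro: real_arch_simple)
  show "emeasure ?M {..real i} \<noteq> \<infinity>" for i by (simp add: M)
qed auto

lemma nn_integral_radial:
  fixes F :: "real \<Rightarrow> ennreal"
  assumes [measurable]: "F \<in> borel_measurable borel"
  shows "(\<integral>\<^sup>+x. F (norm (x::real^5)) \<partial>lborel) = (\<integral>\<^sup>+r. ennreal (8 / 3 * pi\<^sup>2 * r^4 * indicator {0..} r) * F r \<partial>lborel)"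
proof -
  have "(\<integral>\<^sup>+x. F (norm (x::real^5)) \<partial>lborel) = (\<integral>\<^sup>+r. F r \<partial>(distr (lborel :: (real^5) measure) borel norm))"
    by (simp add: nn_integral_distr)
  also have "\<dots> = (\<integral>\<^sup>+r. ennreal (8 / 3 * pi\<^sup>2 * r^4 * indicator {0..} r) * F r \<partial>lborel)"
    unfolding distr_norm_lborel by (subst nn_integral_density) (auto simp: unit_ball_vol_5 mult.assoc)
  finally show ?thesis .
qed

lemma integral_radial:
  fixes F :: "real \<Rightarrow> real"
  assumes [measurable]: "F \<in> borel_measurable borel"
  shows "(LBINT x. F (norm (x::real^5))) = (LBINT r. 8 / 3 * pi\<^sup>2 * r^4 * indicator {0..} r * F r)"
proof -
  have "(LBINT x. F (norm (x::real^5))) = (\<integral>r. F r \<partial>(distr (lborel :: (real^5) measure) borel norm))"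
    by (simp add: integral_distr)
  also have "\<dots> = (LBINT r. 8 / 3 * pi\<^sup>2 * r^4 * indicator {0..} r * F r)"
    unfolding distr_norm_lborel by (subst integral_density) (auto simp: unit_ball_vol_5 mult.assoc indicator_def)
  finally show ?thesis .
qed

text \<open>Replacing r^4 by (1 + r)^4 makes the radial integrand a pure power with an explicit
  antiderivative, which vanishes at infinity because p > 5.\<close>

lemma integrable_one_plus_norm_powr:
  assumes "p > 5"
  shows "integrable lborel (\<lambda>x::real^5. (1 + norm x) powr (-p))"
proof (rule integrableI_nonneg)
  have "(\<integral>\<^sup>+x. ennreal ((1 + norm (x::real^5)) powr (-p)) \<partial>lborel)
    = (\<integral>\<^sup>+r. ennreal (8 / 3 * pi\<^sup>2 * r^4 * indicator {0..} r) * ennreal ((1 + r) powr (-p)) \<partial>lborel)"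
    by (rule nn_integral_radial) measurable
  also have "\<dots> \<le> (\<integral>\<^sup>+r. ennreal (8 / 3 * pi\<^sup>2 * (1 + r) powr (4 - p)) * indicator {0..} r \<partial>lborel)"
  proof (rule nn_integral_mono, goal_cases)
    case (1 r)
    show ?case
    proof (cases "r \<ge> 0")
      case True
      have "r^4 * (1 + r) powr (-p) \<le> (1 + r)^4 * (1 + r) powr (-p)"
        using True by (intro mult_right_mono power_mono) auto
      also have "\<dots> = (1 + r) powr (4 - p)"
        using True by (simp add: powr_diff powr_minus divide_inverse flip: powr_numeral)
      finally show ?thesis using True by (auto simp: ennreal_mult'[symmetric] mult.assoc intro!: ennreal_leI mult_left_mono)
    qed simp
  qed
  also have "\<dots> = ennreal (0 - 8 / 3 * pi\<^sup>2 * (1 + 0) powr (5 - p) / (5 - p))"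
  proof (rule nn_integral_FTC_atLeast)
    show "((\<lambda>r. 8 / 3 * pi\<^sup>2 * (1 + r) powr (5 - p) / (5 - p)) \<longlongrightarrow> 0) at_top"
    proof -
      have "((\<lambda>r. (1 + r) powr (5 - p)) \<longlongrightarrow> 0) at_top"
        using assms by (intro tendsto_neg_powr filterlim_tendsto_add_at_top[OF tendsto_const filterlim_ident]) auto
      from tendsto_mult[OF tendsto_const[of "8 / 3 * pi\<^sup>2 / (5 - p)"] this] show ?thesis by simp
    qed
    show "((\<lambda>r. 8 / 3 * pi\<^sup>2 * (1 + r) powr (5 - p) / (5 - p)) has_real_derivative
        8 / 3 * pi\<^sup>2 * (1 + x) powr (4 - p)) (at x)" if "0 \<le> x" for x
    proof -
      have "((\<lambda>r. (1 + r) powr (5 - p)) has_real_derivative (5 - p) * (1 + x) powr (4 - p)) (at x)"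
        using that by (auto intro!: derivative_eq_intros)
      from DERIV_cdivide[OF DERIV_cmult[OF this, of "8 / 3 * pi\<^sup>2"], of "5 - p"]
      show ?thesis by (rule DERIV_cong) (use assms in \<open>simp add: field_simps\<close>)
    qed
  qed auto
  also have "\<dots> < \<infinity>" by simp
  finally show "(\<integral>\<^sup>+x. ennreal ((1 + norm (x::real^5)) powr (-p)) \<partial>lborel) < \<infinity>" .
qed auto

subsection \<open>Smoothing the norm\<close>

lemma lipschitz_unit_interval:
  fixes g g' :: "real \<Rightarrow> real"
  assumes "\<And>r. (g has_real_derivative g' r) (at r)" "continuous_on UNIV g'"
  obtains L where "L \<ge> 0" "\<And>a b. a \<in> {0..1} \<Longrightarrow> b \<in> {0..1} \<Longrightarrow> \<bar>g a - g b\<bar> \<le> L * \<bar>a - b\<bar>"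
proof -
  have "compact (g' ` {0..1})"
    using continuous_on_subset[OF assms(2)] by (intro compact_continuous_image) auto
  then obtain M where M: "\<forall>z \<in> g' ` {0..1}. norm z \<le> M"
    using compact_imp_bounded bounded_iff by blast
  show ?thesis
  proof
    show "\<bar>M\<bar> \<ge> 0" by simp
    show "\<bar>g a - g b\<bar> \<le> \<bar>M\<bar> * \<bar>a - b\<bar>" if "a \<in> {0..1}" "b \<in> {0..1}" for a b
    proof -
      have "norm (g' r) \<le> \<bar>M\<bar>" if "r \<in> {0..1}" for r using M that by force
      then show ?thesis
        using field_differentiable_bound[of "{0..1}" g g' "\<bar>M\<bar>" a b] that
          has_field_derivative_at_within[OF assms(1)] by simp
    qed
  qed
qed

lemma tendsto_inverse_Suc: "(\<lambda>n. 1 / (real n + 1)) \<longlonglongrightarrow> 0"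
  using LIMSEQ_inverse_real_of_nat by (simp add: inverse_eq_divide add.commute)

lemma filterlim_real_add_1: "filterlim (\<lambda>n. real n + 1) at_top sequentially"
  using filterlim_tendsto_add_at_top[OF tendsto_const[of 1] filterlim_real_sequentially] by (simp add: add.commute)

text \<open>The third Laplacian of the smoothed norm at scale 1: even, supported in the unit ball,
  and of both signs, so bounds below use its absolute value. Up to its total mass it acts as an
  approximate identity.\<close>

definition kern :: "real^5 \<Rightarrow> real" where "kern z = prof3 ((norm z)\<^sup>2)"

lemma continuous_on_kern: "continuous_on UNIV kern"
proof -
  have "continuous_on UNIV prof3"
    unfolding prof3_def by (intro continuous_on_glue) (auto intro!: continuous_intros)
  then show ?thesis unfolding kern_def[abs_def]
    by (rule continuous_on_compose2) (auto intro!: continuous_intros)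
qed

lemma kern_measurable [measurable]: "kern \<in> borel_measurable borel"
  using continuous_on_kern by (simp add: borel_measurable_continuous_onI)

lemma kern_support:
  assumes "norm z \<ge> 1" shows "kern z = 0"
proof -
  have "(norm z)\<^sup>2 = 1 \<or> (norm z)\<^sup>2 > 1" using power_mono[OF assms, of 2] by auto
  moreover have "s = 1 \<or> s > 1 \<Longrightarrow> prof3 s = 0" for s by (auto simp: prof3_def glue_def)
  ultimately show ?thesis by (simp add: kern_def)
qed

lemma kern_minus: "kern (- z) = kern z" by (simp add: kern_def)

text \<open>On the unit ball \<open>kern\<close> is a polynomial in |z| that vanishes at |z| = 1;
  hence everywhere it is that polynomial composed with the 1-Lipschitz map min 1 |z|.\<close>

lemma kern_lipschitz:
  obtains L where "L \<ge> 0" "\<And>z w. \<bar>kern z - kern w\<bar> \<le> L * norm (z - w)"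
proof -
  define g :: "real \<Rightarrow> real" where "g r = (218295 - 1029105 * r^2 + 1486485 * r^4 - 675675 * r^6) / 16" for r
  have "(g has_real_derivative (- 2058210 * r + 5945940 * r^3 - 4054050 * r^5) / 16) (at r)" for r
    unfolding g_def[abs_def] by (auto intro!: derivative_eq_intros simp: field_simps)
  then obtain L where L: "L \<ge> 0" "\<And>a b. a \<in> {0..1} \<Longrightarrow> b \<in> {0..1} \<Longrightarrow> \<bar>g a - g b\<bar> \<le> L * \<bar>a - b\<bar>"
    by (rule lipschitz_unit_interval) (auto intro!: continuous_intros)
  have k: "kern z = g (min 1 (norm z))" for z
  proof (cases "norm z \<le> 1")
    case True
    then have "(norm z)\<^sup>2 \<le> 1" by (simp add: abs_square_le_1)
    then show ?thesis using True by (simp add: kern_def prof3_def glue_def g_def min_def power_mult[symmetric])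
  next
    case False
    then show ?thesis using kern_support[of z] by (simp add: g_def min_def)
  qed
  show ?thesis
  proof (rule that[OF L(1)])
    fix z w :: "real^5"
    have "\<bar>kern z - kern w\<bar> \<le> L * \<bar>min 1 (norm z) - min 1 (norm w)\<bar>"
      unfolding k by (rule L(2)) auto
    also have "\<bar>min 1 (norm z) - min 1 (norm w)\<bar> \<le> norm (z - w)"
      using norm_triangle_ineq3[of z w] by (auto simp: min_def)
    finally show "\<bar>kern z - kern w\<bar> \<le> L * norm (z - w)" using L(1) by (simp add: mult_left_mono)
  qed
qed

lemma integrable_mult_kern:
  assumes "continuous_on UNIV h" shows "integrable lborel (\<lambda>z. h z * kern z)"
  by (rule integrable_continuous_compact_support[where R=1])
     (use assms continuous_on_kern kern_support in \<open>auto intro!: continuous_intros\<close>)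

lemma integrable_kern: "integrable lborel kern"
  using integrable_mult_kern[of "\<lambda>_. 1"] by simp

text \<open>The origin of 64 pi^2: the sphere of radius r in dimension 5 has area 8/3 pi^2 r^4, and
  the antiderivative at 1 is 384 pi^2 / 6.\<close>

lemma integral_kern: "(LBINT z. kern z) = 64 * pi\<^sup>2"
proof -
  have [measurable]: "prof3 \<in> borel_measurable borel"
    unfolding prof3_def glue_def[abs_def] by measurable
  have "(LBINT z. kern z) = (LBINT r. 8 / 3 * pi\<^sup>2 * r^4 * indicator {0..} r * prof3 (r\<^sup>2))"
    unfolding kern_def by (rule integral_radial) measurable
  also have "\<dots> = (LBINT r. (pi\<^sup>2 / 6 * (218295 * r^4 - 1029105 * r^6 + 1486485 * r^8 - 675675 * r^10)) * indicator {0..1} r)"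
  proof (rule Bochner_Integration.integral_cong)
    show "8 / 3 * pi\<^sup>2 * r^4 * indicator {0..} r * prof3 (r\<^sup>2) =
      (pi\<^sup>2 / 6 * (218295 * r^4 - 1029105 * r^6 + 1486485 * r^8 - 675675 * r^10)) * indicator {0..1} r" for r :: real
      using abs_square_le_1[of r]
      by (auto simp: prof3_def glue_def indicator_def power_mult[symmetric] field_simps power_add[symmetric])
  qed simp
  also have "\<dots> = (\<lambda>r. pi\<^sup>2 / 6 * (43659 * r^5 - 147015 * r^7 + 165165 * r^9 - 61425 * r^11)) 1
      - (\<lambda>r. pi\<^sup>2 / 6 * (43659 * r^5 - 147015 * r^7 + 165165 * r^9 - 61425 * r^11)) 0"
    by (rule integral_FTC_Icc_real) (auto intro!: derivative_eq_intros simp: field_simps)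
  also have "\<dots> = 64 * pi\<^sup>2" by simp
  finally show ?thesis .
qed

text \<open>Not normalised: on constants it multiplies by 64 pi^2.\<close>

definition avg :: "(real^5 \<Rightarrow> real) \<Rightarrow> real \<Rightarrow> real^5 \<Rightarrow> real" where
  "avg u a x = (LBINT z. u (x + a *\<^sub>R z) * kern z)"

definition smooth_norm :: "real \<Rightarrow> real^5 \<Rightarrow> real" where
  "smooth_norm a y = a * prof0 (inverse (a\<^sup>2) * (norm y)\<^sup>2)"

lemma continuous_on_affine:
  fixes u :: "real^5 \<Rightarrow> real"
  assumes "continuous_on UNIV u" shows "continuous_on UNIV (\<lambda>z. u (x + a *\<^sub>R z))"
  using assms by (rule continuous_on_compose2) (auto intro!: continuous_intros)

lemma avg_eq:
  assumes "a > 0" "continuous_on UNIV u"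
  shows "(LBINT y. u y * (inverse (a^5) * prof3 (inverse (a\<^sup>2) * (norm (y - x))\<^sup>2))) = avg u a x"
    and "integrable lborel (\<lambda>y. u y * (inverse (a^5) * prof3 (inverse (a\<^sup>2) * (norm (y - x))\<^sup>2)))"
proof -
  let ?F = "\<lambda>y. u y * (inverse (a^5) * prof3 (inverse (a\<^sup>2) * (norm (y - x))\<^sup>2))"
  have F: "?F y = u y * (inverse (a^5) * kern (inverse a *\<^sub>R (y - x)))" for y
    using assms(1) by (simp add: kern_def power_mult_distrib power_inverse)
  have [measurable]: "u \<in> borel_measurable borel"
    using assms by (simp add: borel_measurable_continuous_onI)
  have "(LBINT y. ?F y) = \<bar>a\<bar>^DIM(real^5) * (LBINT z. ?F (x + a *\<^sub>R z))"
    unfolding F by (rule integral_lborel_affine) (use assms in auto)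
  also have "\<dots> = (LBINT z. u (x + a *\<^sub>R z) * kern z)"
    unfolding F using assms(1) by (simp add: mult.left_commute[of _ "inverse (a^5)"])
  finally show "(LBINT y. ?F y) = avg u a x" by (simp add: avg_def)
  show "integrable lborel ?F"
    unfolding F
  proof (rule integrable_continuous_compact_support[where R="norm x + a"])
    show "continuous_on UNIV (\<lambda>y. u y * (inverse (a^5) * kern (inverse a *\<^sub>R (y - x))))"
      by (intro continuous_intros assms continuous_on_compose2[OF continuous_on_kern]) auto
    show "u y * (inverse (a^5) * kern (inverse a *\<^sub>R (y - x))) = 0" if "norm y > norm x + a" for y
    proof -
      have "norm (y - x) \<ge> a" using that norm_triangle_ineq2[of y x] by simp
      then have "norm (inverse a *\<^sub>R (y - x)) \<ge> 1"
        unfolding norm_scaleR using assms(1) by (simp add: field_simps)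
      then show ?thesis by (simp add: kern_support)
    qed
  qed
qed

lemma triharmonic_identity:
  fixes u :: "real^5 \<Rightarrow> real"
  assumes u: "Ck 6 u" and e: "0 < e" "e \<le> R"
  shows "(LBINT y. (laplacian ^^ 3) u y * (smooth_norm e (y - x) - smooth_norm R (y - x))) = avg u e x - avg u R x"
proof -
  have c: "continuous_on UNIV u" using u by (rule Ck_continuous)
  have R: "R > 0" using e by simp
  show ?thesis
    using triharmonic_identity_unscaled[OF assms, of x] avg_eq[OF e(1) c, of x] avg_eq[OF R c, of x]
    by (simp add: smooth_norm_def right_diff_distrib[of "u _"])
qed

lemma smooth_norm_bounds:
  assumes "a > 0"
  shows "norm y \<le> smooth_norm a y" "smooth_norm a y \<le> norm y + a"
    "231 / 1024 * a \<le> smooth_norm a y" "smooth_norm a y \<le> max a (norm y)"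
    "norm y \<ge> a \<Longrightarrow> smooth_norm a y = norm y"
proof -
  define s where "s = inverse (a\<^sup>2) * (norm y)\<^sup>2"
  have s: "s \<ge> 0" "sqrt s = norm y / a"
    using assms by (auto simp: s_def real_sqrt_mult real_sqrt_inverse divide_inverse mult.commute)
  have [simp]: "smooth_norm a y = a * prof0 s" by (simp add: smooth_norm_def s_def)
  show "norm y \<le> smooth_norm a y"
    using prof0_ge_sqrt[OF s(1)] assms s(2) by (simp add: field_simps)
  show "smooth_norm a y \<le> norm y + a"
    using mult_left_mono[OF prof0_le_sqrt_add_1[OF s(1)], of a] assms s(2) by (simp add: distrib_left)
  show "231 / 1024 * a \<le> smooth_norm a y"
    using mult_left_mono[OF prof0_lower[OF s(1)], of a] assms by simp
  show "smooth_norm a y \<le> max a (norm y)"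
    using mult_left_mono[OF prof0_upper[OF s(1)], of a] assms s(2) by (simp add: max_mult_distrib_left)
  show "smooth_norm a y = norm y" if "norm y \<ge> a"
  proof -
    have "sqrt s \<ge> 1" using that assms s by simp
    then have "s \<ge> 1" by simp
    then show ?thesis using prof0_eq_sqrt[of s] s assms by simp
  qed
qed

lemma smooth_norm_continuous: "a > 0 \<Longrightarrow> continuous_on UNIV (\<lambda>y. smooth_norm a (y - x))"
proof -
  have "continuous_on UNIV prof0"
    unfolding prof0_def by (intro continuous_on_glue) (auto intro!: continuous_intros)
  then show ?thesis unfolding smooth_norm_def[abs_def]
    by (intro continuous_intros) (auto intro!: continuous_intros continuous_on_compose2[of UNIV prof0])
qed

text \<open>The constant must not depend on the scale, because it supplies the dominating function
  while the scales tend to 0 and to infinity. Scaling reduces the estimate to a = 1.\<close>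

lemma smooth_norm_lipschitz:
  obtains L where "L \<ge> 0" "\<And>a y z. a > 0 \<Longrightarrow> \<bar>smooth_norm a y - smooth_norm a z\<bar> \<le> L * norm (y - z)"
proof -
  define g :: "real \<Rightarrow> real" where
    "g r = (231 + 1386 * r^2 - 1155 * r^4 + 924 * r^6 - 495 * r^8 + 154 * r^10 - 21 * r^12) / 1024" for r
  have "(g has_real_derivative (2772 * r - 4620 * r^3 + 5544 * r^5 - 3960 * r^7 + 1540 * r^9 - 252 * r^11) / 1024) (at r)" for r
    unfolding g_def[abs_def] by (auto intro!: derivative_eq_intros simp: field_simps)
  then obtain L where L: "L \<ge> 0" "\<And>a b. a \<in> {0..1} \<Longrightarrow> b \<in> {0..1} \<Longrightarrow> \<bar>g a - g b\<bar> \<le> L * \<bar>a - b\<bar>"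
    by (rule lipschitz_unit_interval) (auto intro!: continuous_intros)
  \<comment> \<open>A polynomial of the clamped radius plus a linear tail; the two parts fit because
    the polynomial equals 1 at r = 1.\<close>
  have k: "prof0 (r\<^sup>2) = g (min 1 r) + max 0 (r - 1)" if "r \<ge> 0" for r
  proof (cases "r \<le> 1")
    case True
    then have "r\<^sup>2 \<le> 1" using that by (simp add: abs_square_le_1)
    then show ?thesis using True by (simp add: prof0_def glue_def g_def min_def max_def power_mult[symmetric])
  next
    case False
    then show ?thesis using prof0_eq_sqrt[of "r\<^sup>2"] that by (simp add: g_def min_def max_def)
  qed
  have k1: "\<bar>prof0 (r\<^sup>2) - prof0 (t\<^sup>2)\<bar> \<le> (L + 1) * \<bar>r - t\<bar>" if "r \<ge> 0" "t \<ge> 0" for r t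
  proof -
    have "\<bar>prof0 (r\<^sup>2) - prof0 (t\<^sup>2)\<bar> \<le> \<bar>g (min 1 r) - g (min 1 t)\<bar> + \<bar>max 0 (r - 1) - max 0 (t - 1)\<bar>"
      unfolding k[OF that(1)] k[OF that(2)] by linarith
    also have "\<bar>g (min 1 r) - g (min 1 t)\<bar> \<le> L * \<bar>min 1 r - min 1 t\<bar>"
      using that by (intro L) auto
    also have "L * \<bar>min 1 r - min 1 t\<bar> \<le> L * \<bar>r - t\<bar>"
      using L(1) by (intro mult_left_mono) auto
    also have "\<bar>max 0 (r - 1) - max 0 (t - 1)\<bar> \<le> \<bar>r - t\<bar>" by linarith
    finally show ?thesis by (simp add: algebra_simps)
  qed
  show ?thesis
  proof (rule that[of "L + 1"])
    fix a :: real and y z :: "real^5" assume a: "a > 0"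
    have sn: "smooth_norm a y = a * prof0 ((norm y / a)\<^sup>2)" for y
      by (simp add: smooth_norm_def power_divide field_simps)
    have "\<bar>smooth_norm a y - smooth_norm a z\<bar> = a * \<bar>prof0 ((norm y / a)\<^sup>2) - prof0 ((norm z / a)\<^sup>2)\<bar>"
      using a by (simp add: sn abs_mult right_diff_distrib[symmetric])
    also have "\<dots> \<le> a * ((L + 1) * \<bar>norm y / a - norm z / a\<bar>)"
      using a by (intro mult_left_mono k1) auto
    also have "\<dots> = (L + 1) * \<bar>norm y - norm z\<bar>"
      using a by (simp add: diff_divide_distrib[symmetric] abs_divide)
    also have "\<dots> \<le> (L + 1) * norm (y - z)"
      using L(1) norm_triangle_ineq3[of y z] by (intro mult_left_mono) auto
    finally show "\<bar>smooth_norm a y - smooth_norm a z\<bar> \<le> (L + 1) * norm (y - z)" .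
  qed (use L in simp)
qed

text \<open>Once the scale a exceeds |y| and |z|, both values are a times a polynomial in the
  squared norm over a^2, so their difference is of order 1 / a.\<close>

lemma smooth_norm_diff_tendsto_0:
  "(\<lambda>n. smooth_norm (real n + 1) y - smooth_norm (real n + 1) z) \<longlonglongrightarrow> 0"
proof -
  define p :: "real \<Rightarrow> real" where "p s = (231 + 1386 * s - 1155 * s^2 + 924 * s^3 - 495 * s^4 + 154 * s^5 - 21 * s^6) / 1024" for s
  have "(p has_real_derivative (1386 - 2310 * s + 2772 * s^2 - 1980 * s^3 + 770 * s^4 - 126 * s^5) / 1024) (at s)" for s
    unfolding p_def[abs_def] by (auto intro!: derivative_eq_intros simp: field_simps)
  then obtain L where L: "L \<ge> 0" "\<And>a b. a \<in> {0..1} \<Longrightarrow> b \<in> {0..1} \<Longrightarrow> \<bar>p a - p b\<bar> \<le> L * \<bar>a - b\<bar>"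
    by (rule lipschitz_unit_interval) (auto intro!: continuous_intros)
  have ev: "\<forall>\<^sub>F n in sequentially. norm (smooth_norm (real n + 1) y - smooth_norm (real n + 1) z)
      \<le> L * \<bar>(norm y)\<^sup>2 - (norm z)\<^sup>2\<bar> * (1 / (real n + 1))"
  proof -
    have "\<forall>\<^sub>F n in sequentially. real n + 1 \<ge> max (norm y) (norm z)"
      using filterlim_real_add_1 unfolding filterlim_at_top by blast
    then show ?thesis
    proof eventually_elim
      case (elim n)
      define a where "a = real n + 1"
      have a: "a > 0" "norm y \<le> a" "norm z \<le> a" using elim by (auto simp: a_def)
      have in01: "inverse (a\<^sup>2) * (norm w)\<^sup>2 \<in> {0..1}" if "norm w \<le> a" for w :: "real^5"
        using power_mono[OF that, of 2] a(1) by (auto simp: field_simps)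
      have sn: "smooth_norm a w = a * p (inverse (a\<^sup>2) * (norm w)\<^sup>2)" if "norm w \<le> a" for w
        using in01[OF that] by (simp add: smooth_norm_def prof0_def glue_def p_def)
      have "\<bar>smooth_norm a y - smooth_norm a z\<bar> = a * \<bar>p (inverse (a\<^sup>2) * (norm y)\<^sup>2) - p (inverse (a\<^sup>2) * (norm z)\<^sup>2)\<bar>"
        using a by (simp add: sn abs_mult right_diff_distrib[symmetric])
      also have "\<dots> \<le> a * (L * \<bar>inverse (a\<^sup>2) * (norm y)\<^sup>2 - inverse (a\<^sup>2) * (norm z)\<^sup>2\<bar>)"
        using a by (intro mult_left_mono L in01) auto
      also have "\<bar>inverse (a\<^sup>2) * (norm y)\<^sup>2 - inverse (a\<^sup>2) * (norm z)\<^sup>2\<bar> = inverse (a\<^sup>2) * \<bar>(norm y)\<^sup>2 - (norm z)\<^sup>2\<bar>"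
        by (simp add: right_diff_distrib[symmetric] abs_mult)
      also have "a * (L * (inverse (a\<^sup>2) * \<bar>(norm y)\<^sup>2 - (norm z)\<^sup>2\<bar>)) = L * \<bar>(norm y)\<^sup>2 - (norm z)\<^sup>2\<bar> * (1 / a)"
        using a by (simp add: field_simps power2_eq_square[of a])
      finally show ?case by (simp add: a_def)
    qed
  qed
  have "(\<lambda>n. L * \<bar>(norm y)\<^sup>2 - (norm z)\<^sup>2\<bar> * (1 / (real n + 1))) \<longlonglongrightarrow> 0"
    using tendsto_mult_right_zero[OF tendsto_inverse_Suc] .
  then show ?thesis using ev by (rule Lim_null_comparison[rotated])
qed

lemma smooth_norm_tendsto_norm: "(\<lambda>n. smooth_norm (1 / (real n + 1)) y) \<longlonglongrightarrow> norm y"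
proof (rule tendsto_sandwich[OF _ _ tendsto_const])
  show "\<forall>\<^sub>F n in sequentially. norm y \<le> smooth_norm (1 / (real n + 1)) y"
    by (intro always_eventually allI smooth_norm_bounds(1)) auto
  show "\<forall>\<^sub>F n in sequentially. smooth_norm (1 / (real n + 1)) y \<le> norm y + 1 / (real n + 1)"
    by (intro always_eventually allI smooth_norm_bounds(2)) auto
  show "(\<lambda>n. norm y + 1 / (real n + 1)) \<longlonglongrightarrow> norm y"
    using tendsto_add[OF tendsto_const tendsto_inverse_Suc] by simp
qed

subsection \<open>Averages over small and large balls\<close>

lemma continuous_linear_growth:
  fixes u :: "'a::euclidean_space \<Rightarrow> real"
  assumes c: "continuous_on UNIV u" and lim: "((\<lambda>x. u x / norm x) \<longlongrightarrow> \<alpha>) at_infinity"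
  obtains A where "A \<ge> 0" "\<And>x. \<bar>u x\<bar> \<le> A * (1 + norm x)"
proof -
  have "\<forall>\<^sub>F x in at_infinity. dist (u x / norm x) \<alpha> < 1" using lim by (rule tendstoD) simp
  then obtain b where b: "\<And>x. norm x \<ge> b \<Longrightarrow> dist (u x / norm x) \<alpha> < 1"
    by (auto simp: eventually_at_infinity)
  have "compact (u ` cball 0 \<bar>b\<bar>)"
    using continuous_on_subset[OF c] by (intro compact_continuous_image) auto
  then obtain M where M: "\<forall>z \<in> u ` cball 0 \<bar>b\<bar>. norm z \<le> M"
    using compact_imp_bounded bounded_iff by blast
  show ?thesis
  proof
    show "\<bar>M\<bar> + \<bar>\<alpha>\<bar> + 1 \<ge> 0" by simp
    fix x :: 'a
    show "\<bar>u x\<bar> \<le> (\<bar>M\<bar> + \<bar>\<alpha>\<bar> + 1) * (1 + norm x)"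
    proof (cases "norm x \<le> \<bar>b\<bar>")
      case True
      then have "\<bar>u x\<bar> \<le> M" using M by force
      also have "\<dots> \<le> (\<bar>M\<bar> + \<bar>\<alpha>\<bar> + 1) * 1" by simp
      also have "\<dots> \<le> (\<bar>M\<bar> + \<bar>\<alpha>\<bar> + 1) * (1 + norm x)" by (intro mult_left_mono) auto
      finally show ?thesis .
    next
      case False
      then have "x \<noteq> 0" by auto
      have "\<bar>u x / norm x\<bar> \<le> \<bar>\<alpha>\<bar> + 1" using b[of x] False unfolding dist_real_def by linarith
      then have "\<bar>u x\<bar> \<le> (\<bar>\<alpha>\<bar> + 1) * norm x" using \<open>x \<noteq> 0\<close> by (simp add: abs_divide pos_divide_le_eq)
      also have "\<dots> \<le> (\<bar>M\<bar> + \<bar>\<alpha>\<bar> + 1) * (1 + norm x)" by (intro mult_mono) auto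
      finally show ?thesis .
    qed
  qed
qed

lemma tendsto_avg_0:
  assumes c: "continuous_on UNIV u"
  shows "(\<lambda>n. avg u (1 / (real n + 1)) x) \<longlonglongrightarrow> 64 * pi\<^sup>2 * u x"
proof -
  have [measurable]: "u \<in> borel_measurable borel"
    using c by (simp add: borel_measurable_continuous_onI)
  have "compact (u ` cball x 1)"
    using continuous_on_subset[OF c] by (intro compact_continuous_image) auto
  then obtain M where M: "\<forall>z \<in> u ` cball x 1. norm z \<le> M"
    using compact_imp_bounded bounded_iff by blast
  have "(\<lambda>n. avg u (1 / (real n + 1)) x) \<longlonglongrightarrow> (LBINT z. u x * kern z)"
    unfolding avg_def
  proof (rule integral_dominated_convergence[where w="\<lambda>z. M * \<bar>kern z\<bar>"])
    show "integrable lborel (\<lambda>z. M * \<bar>kern z\<bar>)" using integrable_kern by auto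
    show "AE z in lborel. (\<lambda>n. u (x + (1 / (real n + 1)) *\<^sub>R z) * kern z) \<longlonglongrightarrow> u x * kern z"
    proof (intro AE_I2 tendsto_mult tendsto_const)
      fix z
      have "(\<lambda>n. x + (1 / (real n + 1)) *\<^sub>R z) \<longlonglongrightarrow> x + 0 *\<^sub>R z"
        by (intro tendsto_intros tendsto_inverse_Suc)
      then show "(\<lambda>n. u (x + (1 / (real n + 1)) *\<^sub>R z)) \<longlonglongrightarrow> u x"
        using c by (auto simp: continuous_on_eq_continuous_at intro: isCont_tendsto_compose)
    qed
    show "AE z in lborel. norm (u (x + (1 / (real n + 1)) *\<^sub>R z) * kern z) \<le> M * \<bar>kern z\<bar>" for n
    proof (intro AE_I2)
      fix z
      show "norm (u (x + (1 / (real n + 1)) *\<^sub>R z) * kern z) \<le> M * \<bar>kern z\<bar>"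
      proof (cases "norm z \<ge> 1")
        case False
        have "norm ((1 / (real n + 1)) *\<^sub>R z) \<le> 1 * norm z"
          unfolding norm_scaleR by (intro mult_right_mono) auto
        then have "x + (1 / (real n + 1)) *\<^sub>R z \<in> cball x 1"
          using False by (simp add: dist_norm)
        then have "\<bar>u (x + (1 / (real n + 1)) *\<^sub>R z)\<bar> \<le> M" using M by force
        then show ?thesis by (simp add: abs_mult mult_right_mono)
      qed (simp add: kern_support)
    qed
  qed measurable
  then show ?thesis by (simp add: integral_kern mult.commute)
qed

text \<open>The last bound is the parallelogram law: the square of the sum of the two norms is at
  most 4 (|x|^2 + |w|^2), which is at most (2 |w| + |x|^2 / |w|)^2.\<close>

lemma norm_second_difference:
  fixes x w :: "'a::euclidean_space"
  shows "0 \<le> norm (x + w) + norm (x - w) - 2 * norm w"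
    and "norm (x + w) + norm (x - w) - 2 * norm w \<le> 2 * norm x"
    and "w \<noteq> 0 \<Longrightarrow> norm (x + w) + norm (x - w) - 2 * norm w \<le> (norm x)\<^sup>2 / norm w"
proof -
  have "norm (2 *\<^sub>R w) = norm ((x + w) - (x - w))" by (simp add: scaleR_2)
  also have "\<dots> \<le> norm (x + w) + norm (x - w)" by (rule norm_triangle_ineq4)
  finally show "0 \<le> norm (x + w) + norm (x - w) - 2 * norm w" by simp
  show "norm (x + w) + norm (x - w) - 2 * norm w \<le> 2 * norm x"
    using norm_triangle_ineq[of x w] norm_triangle_ineq4[of x w] by simp
  assume w: "w \<noteq> 0"
  have "(norm (x + w) + norm (x - w))\<^sup>2 \<le> 2 * ((norm (x + w))\<^sup>2 + (norm (x - w))\<^sup>2)"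
    using zero_le_power2[of "norm (x + w) - norm (x - w)"] by (simp add: power2_eq_square algebra_simps)
  also have "\<dots> = 4 * ((norm x)\<^sup>2 + (norm w)\<^sup>2)"
    unfolding power2_norm_eq_inner by (simp add: inner_add_left inner_add_right inner_diff_left inner_diff_right inner_commute)
  also have "\<dots> \<le> (2 * norm w + (norm x)\<^sup>2 / norm w)\<^sup>2"
    using w by (simp add: power2_sum power_divide)
  finally have "norm (x + w) + norm (x - w) \<le> 2 * norm w + (norm x)\<^sup>2 / norm w"
    by (rule power2_le_imp_le) simp
  then show "norm (x + w) + norm (x - w) - 2 * norm w \<le> (norm x)\<^sup>2 / norm w" by simp
qed

text \<open>The first order term in \<open>x\<close> drops out because the kernel is even.\<close>

lemma tendsto_avg_norm_diff: "(\<lambda>n. avg norm (real n + 1) x - avg norm (real n + 1) 0) \<longlonglongrightarrow> 0"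
proof -
  let ?D = "\<lambda>n z. norm (x + (real n + 1) *\<^sub>R z) + norm (x - (real n + 1) *\<^sub>R z) - 2 * norm ((real n + 1) *\<^sub>R z)"
  have i: "integrable lborel (\<lambda>z. norm (y + b *\<^sub>R z) * kern z)" for y b
    by (intro integrable_mult_kern continuous_intros)
  have rfl: "avg norm (real n + 1) x = (LBINT z. norm (x - (real n + 1) *\<^sub>R z) * kern z)" for n
  proof -
    have "avg norm (real n + 1) x = (LBINT z. norm (x + (real n + 1) *\<^sub>R (- z)) * kern (- z))"
      unfolding avg_def by (rule integral_lborel_reflect[symmetric]) measurable
    then show ?thesis by (simp add: kern_minus)
  qed
  have eq: "2 * (avg norm (real n + 1) x - avg norm (real n + 1) 0) = (LBINT z. ?D n z * kern z)" for n
  proof -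
    have "(LBINT z. ?D n z * kern z) = (LBINT z. norm (x + (real n + 1) *\<^sub>R z) * kern z + norm (x + (- (real n + 1)) *\<^sub>R z) * kern z - 2 * (norm (0 + (real n + 1) *\<^sub>R z) * kern z))"
      by (intro Bochner_Integration.integral_cong refl) (simp_all add: algebra_simps)
    also have "\<dots> = avg norm (real n + 1) x + (LBINT z. norm (x + (- (real n + 1)) *\<^sub>R z) * kern z) - 2 * avg norm (real n + 1) 0"
      unfolding avg_def using i[of x "real n + 1"] i[of x "- (real n + 1)"] i[of 0 "real n + 1"]
      by (simp del: scaleR_minus_left)
    also have "(LBINT z. norm (x + (- (real n + 1)) *\<^sub>R z) * kern z) = avg norm (real n + 1) x"
      unfolding rfl scaleR_minus_left by simp
    finally show ?thesis by simp
  qed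
  have "(\<lambda>n. LBINT z. ?D n z * kern z) \<longlonglongrightarrow> (\<integral>z. 0 \<partial>(lborel :: (real^5) measure))"
  proof (rule integral_dominated_convergence[where w="\<lambda>z. 2 * norm x * \<bar>kern z\<bar>"])
    show "integrable lborel (\<lambda>z. 2 * norm x * \<bar>kern z\<bar>)" using integrable_kern by auto
    show "AE z in lborel. norm (?D n z * kern z) \<le> 2 * norm x * \<bar>kern z\<bar>" for n
      using norm_second_difference(1,2)[of x "(real n + 1) *\<^sub>R _"]
      by (intro AE_I2) (simp add: abs_mult mult_right_mono)
    have "AE z in lborel. z \<noteq> (0::real^5)" by (rule AE_lborel_singleton)
    then show "AE z in lborel. (\<lambda>n. ?D n z * kern z) \<longlonglongrightarrow> 0"
    proof eventually_elim
      case (elim z)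
      have "(\<lambda>n. ?D n z) \<longlonglongrightarrow> 0"
      proof (rule tendsto_sandwich[OF _ _ tendsto_const])
        show "\<forall>\<^sub>F n in sequentially. 0 \<le> ?D n z"
          by (intro always_eventually allI norm_second_difference)
        have "?D n z \<le> (norm x)\<^sup>2 / norm z * (1 / (real n + 1))" for n
        proof -
          have "norm ((real n + 1) *\<^sub>R z) = (real n + 1) * norm z" by (simp add: abs_of_nonneg)
          moreover have "(real n + 1) *\<^sub>R z \<noteq> 0" using elim by (simp add: add_nonneg_eq_0_iff)
          ultimately show ?thesis
            using norm_second_difference(3)[of "(real n + 1) *\<^sub>R z" x] by (simp add: mult.commute)
        qed
        then show "\<forall>\<^sub>F n in sequentially. ?D n z \<le> (norm x)\<^sup>2 / norm z * (1 / (real n + 1))"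
          by (intro always_eventually allI)
        show "(\<lambda>n. (norm x)\<^sup>2 / norm z * (1 / (real n + 1))) \<longlonglongrightarrow> 0"
          by (rule tendsto_mult_right_zero[OF tendsto_inverse_Suc])
      qed
      then show ?case by (rule tendsto_mult_left_zero)
    qed
  qed measurable
  then have "(\<lambda>n. 2 * (avg norm (real n + 1) x - avg norm (real n + 1) 0)) \<longlonglongrightarrow> 0"
    unfolding eq by simp
  from tendsto_mult[OF tendsto_const[of "1/2"] this] show ?thesis by (simp del: right_diff_distrib_numeral)
qed

text \<open>The average of \<open>e\<close> at scale N is only o(N). Moving the shift by x from
  \<open>e\<close> onto \<open>kern\<close> gains a factor 1 / N from the Lipschitz bound of the
  kernel, which brings the difference down to o(1).\<close>

lemma tendsto_avg_sublinear_diff: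
  assumes c: "continuous_on UNIV e" and lim: "((\<lambda>x. e x / norm x) \<longlongrightarrow> 0) at_infinity"
  shows "(\<lambda>n. avg e (real n + 1) x - avg e (real n + 1) 0) \<longlonglongrightarrow> 0"
proof -
  obtain A where A: "A \<ge> 0" "\<And>x. \<bar>e x\<bar> \<le> A * (1 + norm x)"
    using continuous_linear_growth[OF c lim] by blast
  obtain L where L: "L \<ge> 0" "\<And>z w. \<bar>kern z - kern w\<bar> \<le> L * norm (z - w)" using kern_lipschitz by blast
  have [measurable]: "e \<in> borel_measurable borel"
    using c by (simp add: borel_measurable_continuous_onI)
  define N where "N n = real n + 1" for n
  have N: "N n \<ge> 1" for n by (simp add: N_def)
  let ?I = "\<lambda>n z. e (N n *\<^sub>R z) * (kern (z - (1 / N n) *\<^sub>R x) - kern z)"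
  have i2: "integrable lborel (\<lambda>z. e (N n *\<^sub>R z) * kern (z - (1 / N n) *\<^sub>R x))" for n
    using integrable_lborel_affine[of 1 "\<lambda>z. e (x + N n *\<^sub>R z) * kern z" "- (1 / N n) *\<^sub>R x"]
      integrable_mult_kern[OF continuous_on_affine[OF c], of x "N n"] N[of n]
    by (simp add: algebra_simps)
  have eq: "avg e (N n) x - avg e (N n) 0 = (LBINT z. ?I n z)" for n
  proof -
    have "avg e (N n) x = (LBINT z. e (x + N n *\<^sub>R (- (1 / N n) *\<^sub>R x + z)) * kern (- (1 / N n) *\<^sub>R x + z))"
      unfolding avg_def by (rule integral_lborel_translate[symmetric]) measurable
    also have "\<dots> = (LBINT z. e (N n *\<^sub>R z) * kern (z - (1 / N n) *\<^sub>R x))"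
      using N[of n] by (simp add: algebra_simps)
    finally show ?thesis
      using i2[of n] integrable_mult_kern[OF continuous_on_affine[OF c], of 0 "N n"]
      by (simp add: avg_def right_diff_distrib)
  qed
  have kb: "\<bar>kern (z - (1 / N n) *\<^sub>R x) - kern z\<bar> \<le> L * norm x * (1 / N n) * indicator (cball 0 (1 + norm x)) z" for z n
  proof (cases "norm z \<le> 1 + norm x")
    case True
    then show ?thesis using L(2)[of "z - (1 / N n) *\<^sub>R x" z] N[of n] by simp
  next
    case False
    have "norm ((1 / N n) *\<^sub>R x) \<le> 1 * norm x"
      unfolding norm_scaleR using N[of n] by (intro mult_right_mono) auto
    then have "norm (z - (1 / N n) *\<^sub>R x) \<ge> 1"
      using False norm_triangle_ineq2[of z "(1 / N n) *\<^sub>R x"] by linarith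
    moreover have "norm z \<ge> 1" using False norm_ge_zero[of x] by linarith
    ultimately show ?thesis using False by (simp add: kern_support)
  qed
  have Ib: "\<bar>?I n z\<bar> \<le> \<bar>e (N n *\<^sub>R z) / N n\<bar> * (L * norm x * indicator (cball 0 (1 + norm x)) z)" for n z
    using mult_left_mono[OF kb[of z n], of "\<bar>e (N n *\<^sub>R z)\<bar>"] N[of n] by (simp add: abs_mult abs_divide mult_ac)
  have "(\<lambda>n. LBINT z. ?I n z) \<longlonglongrightarrow> (\<integral>z. 0 \<partial>(lborel :: (real^5) measure))"
  proof (rule integral_dominated_convergence[where w="\<lambda>z. A * (2 + norm x) * (L * norm x) * indicator (cball 0 (1 + norm x)) z"])
    show "integrable lborel (\<lambda>z::real^5. A * (2 + norm x) * (L * norm x) * indicator (cball 0 (1 + norm x)) z)"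
      using emeasure_lborel_cball_finite[of "0::real^5" "1 + norm x"]
      by (intro integrable_mult_right integrable_real_indicator) auto
    show "AE z in lborel. norm (?I n z) \<le> A * (2 + norm x) * (L * norm x) * indicator (cball 0 (1 + norm x)) z" for n
    proof (intro AE_I2)
      fix z :: "real^5"
      show "norm (?I n z) \<le> A * (2 + norm x) * (L * norm x) * indicator (cball 0 (1 + norm x)) z"
      proof (cases "norm z \<le> 1 + norm x")
        case True
        have "\<bar>e (N n *\<^sub>R z)\<bar> \<le> A * (1 + N n * norm z)" using A(2)[of "N n *\<^sub>R z"] N[of n] by simp
        also have "\<dots> \<le> A * (N n * (2 + norm x))"
        proof (rule mult_left_mono[OF _ A(1)])
          have "N n * norm z \<le> N n * (1 + norm x)" using True N[of n] by (intro mult_left_mono) auto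
          then show "1 + N n * norm z \<le> N n * (2 + norm x)" using N[of n] by (simp add: algebra_simps)
        qed
        finally have "\<bar>e (N n *\<^sub>R z) / N n\<bar> \<le> A * (2 + norm x)"
          using N[of n] by (simp add: abs_divide field_simps)
        from mult_right_mono[OF this, of "L * norm x"] Ib[of n z] True L(1) show ?thesis by simp
      qed (use Ib[of n z] in simp)
    qed
    show "AE z in lborel. (\<lambda>n. ?I n z) \<longlonglongrightarrow> 0"
    proof (intro AE_I2)
      fix z :: "real^5"
      have l: "(\<lambda>n. e (N n *\<^sub>R z) / N n) \<longlonglongrightarrow> 0"
      proof (cases "z = 0")
        case True
        then show ?thesis using tendsto_mult_right_zero[OF tendsto_inverse_Suc, of "e 0"] by (simp add: N_def[abs_def])
      next
        case False
        have "filterlim (\<lambda>n. N n *\<^sub>R z) at_infinity sequentially"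
        proof (rule filterlim_at_infinity_conv_norm_at_top[THEN iffD2])
          have "filterlim (\<lambda>n. norm z * N n) at_top sequentially"
            using False unfolding N_def by (intro filterlim_tendsto_pos_mult_at_top[OF tendsto_const _ filterlim_real_add_1]) auto
          then show "filterlim (\<lambda>n. norm (N n *\<^sub>R z)) at_top sequentially"
            using N by (simp add: mult.commute N_def)
        qed
        from filterlim_compose[OF lim this] have "(\<lambda>n. e (N n *\<^sub>R z) / norm (N n *\<^sub>R z)) \<longlonglongrightarrow> 0" .
        from tendsto_mult_right_zero[OF this, of "norm z"] show ?thesis
          using False N by (simp add: N_def abs_of_nonneg)
      qed
      have "(\<lambda>n. \<bar>e (N n *\<^sub>R z) / N n\<bar> * (L * norm x * indicator (cball 0 (1 + norm x)) z)) \<longlonglongrightarrow> 0"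
        using tendsto_rabs_zero[OF l] by (rule tendsto_mult_left_zero)
      then show "(\<lambda>n. ?I n z) \<longlonglongrightarrow> 0"
        by (rule Lim_null_comparison[rotated]) (use Ib in auto)
    qed
  qed measurable
  then show ?thesis using eq by (simp add: N_def)
qed

lemma avg_add_cmult:
  assumes "continuous_on UNIV u" "continuous_on UNIV v"
  shows "avg (\<lambda>y. u y + k * v y) a x = avg u a x + k * avg v a x"
  using integrable_mult_kern[OF continuous_on_affine[OF assms(1)], of x a]
    integrable_mult_kern[OF continuous_on_affine[OF assms(2)], of x a]
  by (simp add: avg_def distrib_right mult.assoc)

lemma tendsto_avg_diff:
  assumes c: "continuous_on UNIV u" and lim: "((\<lambda>x. u x / norm x) \<longlongrightarrow> \<alpha>) at_infinity"
  shows "(\<lambda>n. avg u (real n + 1) x - avg u (real n + 1) 0) \<longlonglongrightarrow> 0"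
proof -
  define e where "e y = u y - \<alpha> * norm y" for y
  have ce: "continuous_on UNIV e" unfolding e_def[abs_def] by (intro continuous_intros c)
  have cn: "continuous_on UNIV (norm :: real^5 \<Rightarrow> real)" by (intro continuous_intros)
  have "((\<lambda>x. u x / norm x - \<alpha>) \<longlongrightarrow> 0) at_infinity"
    using tendsto_diff[OF lim tendsto_const[of \<alpha>]] by simp
  moreover have "\<forall>\<^sub>F x in at_infinity. u x / norm x - \<alpha> = e x / norm x"
    unfolding eventually_at_infinity e_def by (rule exI[of _ 1]) (auto simp: diff_divide_distrib)
  ultimately have le: "((\<lambda>x. e x / norm x) \<longlongrightarrow> 0) at_infinity"
    by (rule tendsto_cong[THEN iffD1, rotated])
  have "u = (\<lambda>y. e y + \<alpha> * norm y)" by (auto simp: e_def)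
  then have "avg u a y = avg e a y + \<alpha> * avg norm a y" for a y
    using avg_add_cmult[OF ce cn, of \<alpha> a y] by simp
  then show ?thesis
    using tendsto_add[OF tendsto_avg_sublinear_diff[OF ce le, of x] tendsto_mult_right_zero[OF tendsto_avg_norm_diff[of x], of \<alpha>]]
    by (simp add: algebra_simps)
qed

subsection \<open>The difference formula\<close>

text \<open>Tested at centre 0 with scales 1 and R, the identity bounds the integral of
  \<open>f\<close> against a nonnegative function, at least R / 8 on a ball, by averages of
  \<open>u\<close> that are O(R) by linear growth. Dividing by R gives a bound independent of the
  ball.\<close>

lemma integrable_triharmonic:
  fixes u :: "real^5 \<Rightarrow> real"
  assumes u: "Ck 6 u" and lim: "((\<lambda>x. u x / norm x) \<longlongrightarrow> \<alpha>) at_infinity"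
    and pos: "\<And>x. (laplacian ^^ 3) u x \<ge> 0" and cf: "continuous_on UNIV ((laplacian ^^ 3) u)"
  shows "integrable lborel ((laplacian ^^ 3) u)"
proof -
  define f where "f = (laplacian ^^ 3) u"
  have c: "continuous_on UNIV u" using u by (rule Ck_continuous)
  have cf: "continuous_on UNIV f" and f0: "\<And>x. f x \<ge> 0" using pos cf by (auto simp: f_def)
  have [measurable]: "f \<in> borel_measurable borel"
    using cf by (simp add: borel_measurable_continuous_onI)
  obtain A where A: "A \<ge> 0" "\<And>x. \<bar>u x\<bar> \<le> A * (1 + norm x)"
    using continuous_linear_growth[OF c lim] by blast
  define K where "K = (LBINT z. \<bar>kern z\<bar>)"
  have K: "K \<ge> 0" unfolding K_def by simp
  have av: "\<bar>avg u a 0\<bar> \<le> A * (1 + a) * K" if "a > 0" for a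
  proof -
    have "\<bar>avg u a 0\<bar> \<le> (LBINT z. A * (1 + a) * \<bar>kern z\<bar>)"
      unfolding avg_def
    proof (rule integral_abs_bound[THEN order_trans], rule integral_mono)
      show "integrable lborel (\<lambda>z. \<bar>u (0 + a *\<^sub>R z) * kern z\<bar>)"
        using integrable_mult_kern[OF continuous_on_affine[OF c], of 0 a] by (rule integrable_abs)
      show "integrable lborel (\<lambda>z. A * (1 + a) * \<bar>kern z\<bar>)" using integrable_kern by auto
      show "\<bar>u (0 + a *\<^sub>R z) * kern z\<bar> \<le> A * (1 + a) * \<bar>kern z\<bar>" for z
      proof (cases "norm z \<ge> 1")
        case False
        have "\<bar>u (0 + a *\<^sub>R z)\<bar> \<le> A * (1 + norm (0 + a *\<^sub>R z))" by (rule A(2))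
        also have "\<dots> \<le> A * (1 + a)"
          using False that A(1) mult_left_mono[of "norm z" 1 a] by (intro mult_left_mono) auto
        finally show ?thesis by (simp add: abs_mult mult_right_mono)
      qed (simp add: kern_support)
    qed
    then show ?thesis by (simp add: K_def)
  qed
  define B where "B = 36 * A * K"
  have bd: "(LBINT y. f y * indicator (cball 0 (real n + 1)) y) \<le> B" for n
  proof -
    \<comment> \<open>For this R the number 231 / 1024 * R exceeds 3.6 (n + 1); subtracting
      \<open>smooth_norm 1\<close>, which is at most n + 1 on the ball, leaves more than R / 8 = 2
      (n + 1).\<close>
    define R where "R = 16 * (real n + 1)"
    have R: "R \<ge> 16" by (simp add: R_def)
    define P where "P y = smooth_norm R (y - 0) - smooth_norm 1 (y - 0)" for y
    have P0: "P y \<ge> 0" for y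
    proof (cases "norm y \<ge> 1")
      case True
      then show ?thesis using smooth_norm_bounds(1)[of R y] smooth_norm_bounds(5)[of 1 y] R by (simp add: P_def)
    next
      case False
      then show ?thesis using smooth_norm_bounds(3)[of R y] smooth_norm_bounds(4)[of 1 y] R by (simp add: P_def)
    qed
    have P1: "P y \<ge> R / 8" if "norm y \<le> real n + 1" for y
      using smooth_norm_bounds(3)[of R y] smooth_norm_bounds(4)[of 1 y] that by (simp add: P_def R_def)
    have cP: "continuous_on UNIV P"
      unfolding P_def using R by (intro continuous_on_diff smooth_norm_continuous) auto
    have i1: "integrable lborel (\<lambda>y. f y * P y)"
    proof (rule integrable_continuous_compact_support[where R=R])
      show "f y * P y = 0" if "norm y > R" for y
        using that R smooth_norm_bounds(5)[of R y] smooth_norm_bounds(5)[of 1 y] by (simp add: P_def)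
    qed (intro continuous_on_mult cf cP)
    have i2: "integrable lborel (\<lambda>y. R / 8 * (f y * indicator (cball 0 (real n + 1)) y))"
      using borel_integrable_compact[of "cball 0 (real n + 1)" f] continuous_on_subset[OF cf]
      by (intro integrable_mult_right) (auto simp: set_integrable_def mult.commute)
    have "(LBINT y. R / 8 * (f y * indicator (cball 0 (real n + 1)) y)) \<le> (LBINT y. f y * P y)"
    proof (rule integral_mono[OF i2 i1])
      show "R / 8 * (f y * indicator (cball 0 (real n + 1)) y) \<le> f y * P y" for y
        using mult_left_mono[OF P1[of y] f0[of y]] f0[of y] P0[of y]
        by (auto simp: indicator_def mult.commute)
    qed
    also have "(LBINT y. f y * P y) = - (avg u 1 0 - avg u R 0)"
    proof -
      have "(LBINT y. f y * P y) = (LBINT y. - (f y * (smooth_norm 1 (y - 0) - smooth_norm R (y - 0))))"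
        by (intro Bochner_Integration.integral_cong refl) (simp add: P_def algebra_simps)
      then show ?thesis
        using triharmonic_identity[OF u, of 1 R 0] R by (simp add: f_def)
    qed
    also have "\<dots> \<le> A * (1 + 1) * K + A * (1 + R) * K"
      using av[of 1] av[of R] R by simp
    also have "\<dots> = A * K * (3 + R)" by (simp add: algebra_simps)
    also have "\<dots> \<le> A * K * (2 * R)" using A(1) K R by (intro mult_left_mono) auto
    finally have "R / 8 * (LBINT y. f y * indicator (cball 0 (real n + 1)) y) \<le> R / 8 * (16 * A * K)"
      by (simp add: mult_ac)
    then have "(LBINT y. f y * indicator (cball 0 (real n + 1)) y) \<le> 16 * A * K"
      using R by (subst (asm) mult_le_cancel_left_pos) auto
    also have "\<dots> \<le> B" using mult_nonneg_nonneg[OF A(1) K] by (simp add: B_def)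
    finally show ?thesis .
  qed
  have "integrable lborel f"
  proof (rule integrableI_nonneg)
    have "(\<integral>\<^sup>+y. ennreal (f y) \<partial>lborel) = (\<integral>\<^sup>+y. (SUP n. ennreal (f y * indicator (cball 0 (real n + 1)) y)) \<partial>lborel)"
    proof (rule nn_integral_cong)
      fix y :: "real^5"
      obtain m :: nat where m: "norm y \<le> real m + 1" using real_arch_simple[of "norm y - 1"] by (auto simp: diff_le_eq)
      show "ennreal (f y) = (SUP n. ennreal (f y * indicator (cball 0 (real n + 1)) y))"
      proof (rule antisym)
        show "ennreal (f y) \<le> (SUP n. ennreal (f y * indicator (cball 0 (real n + 1)) y))"
          by (rule SUP_upper2[of m]) (use m in auto)
        show "(SUP n. ennreal (f y * indicator (cball 0 (real n + 1)) y)) \<le> ennreal (f y)"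
          by (rule SUP_least) (auto simp: indicator_def)
      qed
    qed
    also have "\<dots> = (SUP n. \<integral>\<^sup>+y. ennreal (f y * indicator (cball 0 (real n + 1)) y) \<partial>lborel)"
    proof (rule nn_integral_monotone_convergence_SUP)
      show "incseq (\<lambda>n y. ennreal (f y * indicator (cball 0 (real n + 1)) y))"
        using f0 by (auto simp: incseq_def le_fun_def indicator_def)
    qed (auto intro!: measurable_compose[OF _ measurable_ennreal] borel_measurable_times borel_measurable_indicator)
    also have "\<dots> \<le> ennreal B"
    proof (rule SUP_least)
      fix n :: nat
      have "integrable lborel (\<lambda>y. f y * indicator (cball 0 (real n + 1)) y)"
        using borel_integrable_compact[of "cball 0 (real n + 1)" f] continuous_on_subset[OF cf]
        by (auto simp: set_integrable_def mult.commute)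
      then show "(\<integral>\<^sup>+y. ennreal (f y * indicator (cball 0 (real n + 1)) y) \<partial>lborel) \<le> ennreal B"
        using f0 bd[of n] by (subst nn_integral_eq_integral) (auto intro: ennreal_leI)
    qed
    finally show "(\<integral>\<^sup>+y. ennreal (f y) \<partial>lborel) < \<infinity>"
      by (rule le_less_trans) simp
  qed (use f0 in auto)
  then show ?thesis by (simp add: f_def)
qed

text \<open>The identities at x and at 0 are subtracted before the limit: then the integrand is
  dominated by 2 L |x| |f| uniformly in the scales, whereas each identity alone involves terms of
  size R.\<close>

lemma triharmonic_difference_formula:
  fixes u :: "real^5 \<Rightarrow> real"
  assumes u: "Ck 6 u" and lim: "((\<lambda>x. u x / norm x) \<longlongrightarrow> \<alpha>) at_infinity"
    and intf: "integrable lborel ((laplacian ^^ 3) u)"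
  shows "64 * pi\<^sup>2 * (u x - u 0) = (LBINT y. (norm (x - y) - norm y) * (laplacian ^^ 3) u y)"
proof -
  define f where "f = (laplacian ^^ 3) u"
  have c: "continuous_on UNIV u" using u by (rule Ck_continuous)
  have intf: "integrable lborel f" using intf by (simp add: f_def)
  then have fm [measurable]: "f \<in> borel_measurable borel" by auto
  obtain L where L: "L \<ge> 0" "\<And>a y z. a > 0 \<Longrightarrow> \<bar>smooth_norm a y - smooth_norm a z\<bar> \<le> L * norm (y - z)"
    using smooth_norm_lipschitz by blast
  define e where "e n = 1 / (real n + 1)" for n
  define R where "R n = real n + 1" for n
  have eR: "e n > 0" "e n \<le> R n" "R n > 0" for n by (auto simp: e_def R_def field_simps)
  have sm [measurable]: "(\<lambda>y. smooth_norm a (y - x)) \<in> borel_measurable borel" if "a > 0" for a x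
    using smooth_norm_continuous[OF that, of x] by (simp add: borel_measurable_continuous_onI)
  let ?D = "\<lambda>n y. (smooth_norm (e n) (y - x) - smooth_norm (e n) (y - 0)) - (smooth_norm (R n) (y - x) - smooth_norm (R n) (y - 0))"
  have ip: "integrable lborel (\<lambda>y. f y * (smooth_norm (e n) (y - z) - smooth_norm (R n) (y - z)))" for n z
  proof (rule Bochner_Integration.integrable_bound[of _ "\<lambda>y. f y * (2 * R n)"])
    show "integrable lborel (\<lambda>y. f y * (2 * R n))" using intf by simp
    show "(\<lambda>y. f y * (smooth_norm (e n) (y - z) - smooth_norm (R n) (y - z))) \<in> borel_measurable lborel"
      using sm eR by measurable
    have "\<bar>smooth_norm (e n) w - smooth_norm (R n) w\<bar> \<le> 2 * R n" for w
      using smooth_norm_bounds(1,2)[OF eR(1)[of n], of w] smooth_norm_bounds(1,2)[OF eR(3)[of n], of w] eR[of n] by linarith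
    then show "AE y in lborel. norm (f y * (smooth_norm (e n) (y - z) - smooth_norm (R n) (y - z))) \<le> norm (f y * (2 * R n))"
      using eR(3)[of n] by (intro AE_I2) (auto simp: abs_mult intro!: mult_left_mono)
  qed
  have eq: "(avg u (e n) x - avg u (e n) 0) - (avg u (R n) x - avg u (R n) 0) = (LBINT y. f y * ?D n y)" for n
  proof -
    have "(LBINT y. f y * ?D n y) = (LBINT y. f y * (smooth_norm (e n) (y - x) - smooth_norm (R n) (y - x))
        - f y * (smooth_norm (e n) (y - 0) - smooth_norm (R n) (y - 0)))"
      by (intro Bochner_Integration.integral_cong refl) (simp add: algebra_simps)
    also have "\<dots> = (avg u (e n) x - avg u (R n) x) - (avg u (e n) 0 - avg u (R n) 0)"
      using ip[of n x] ip[of n 0] triharmonic_identity[OF u eR(1,2), of n x] triharmonic_identity[OF u eR(1,2), of n 0]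
      by (simp add: f_def)
    finally show ?thesis by simp
  qed
  have "(\<lambda>n. LBINT y. f y * ?D n y) \<longlonglongrightarrow> (LBINT y. f y * (norm (x - y) - norm y))"
  proof (rule integral_dominated_convergence[where w="\<lambda>y. 2 * L * norm x * \<bar>f y\<bar>"])
    show "integrable lborel (\<lambda>y. 2 * L * norm x * \<bar>f y\<bar>)" using intf by auto
    show "(\<lambda>y. f y * ?D n y) \<in> borel_measurable lborel" for n
      using sm eR by measurable
    show "AE y in lborel. norm (f y * ?D n y) \<le> 2 * L * norm x * \<bar>f y\<bar>" for n
    proof (intro AE_I2)
      fix y
      have "\<bar>?D n y\<bar> \<le> L * norm x + L * norm x"
        using L(2)[OF eR(1)[of n], of "y - x" "y - 0"] L(2)[OF eR(3)[of n], of "y - x" "y - 0"] by simp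
      from mult_left_mono[OF this, of "\<bar>f y\<bar>"] show "norm (f y * ?D n y) \<le> 2 * L * norm x * \<bar>f y\<bar>"
        unfolding real_norm_def abs_mult by (simp add: mult_ac)
    qed
    show "AE y in lborel. (\<lambda>n. f y * ?D n y) \<longlonglongrightarrow> f y * (norm (x - y) - norm y)"
    proof (intro AE_I2 tendsto_mult tendsto_const)
      fix y
      have "(\<lambda>n. ?D n y) \<longlonglongrightarrow> (norm (y - x) - norm (y - 0)) - 0"
        unfolding e_def R_def
        by (intro tendsto_diff[of "\<lambda>n. smooth_norm (1 / (real n + 1)) (y - x) - _ n"] tendsto_diff[of "\<lambda>n. smooth_norm (1 / (real n + 1)) (y - x)"]
            smooth_norm_tendsto_norm smooth_norm_diff_tendsto_0)
      then show "(\<lambda>n. ?D n y) \<longlonglongrightarrow> norm (x - y) - norm y" by (simp add: norm_minus_commute)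
    qed
  qed measurable
  moreover have "(\<lambda>n. (avg u (e n) x - avg u (e n) 0) - (avg u (R n) x - avg u (R n) 0)) \<longlonglongrightarrow>
      (64 * pi\<^sup>2 * u x - 64 * pi\<^sup>2 * u 0) - 0"
    unfolding e_def R_def
    by (intro tendsto_diff[OF tendsto_diff[OF tendsto_avg_0[OF c] tendsto_avg_0[OF c]] tendsto_avg_diff[OF c lim]])
  ultimately have "64 * pi\<^sup>2 * u x - 64 * pi\<^sup>2 * u 0 = (LBINT y. f y * (norm (x - y) - norm y))"
    unfolding eq using LIMSEQ_unique by fastforce
  then show ?thesis unfolding right_diff_distrib[of "64 * pi\<^sup>2"] by (simp add: f_def mult.commute)
qed

subsection \<open>The integral equation\<close>

lemma abs_norm_diff_le: "\<bar>norm (x - y) - norm y\<bar> \<le> norm (x::'a::real_normed_vector)"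
  using norm_triangle_ineq3[of "x - y" "- y"] by simp

lemma integral_pos_lborel:
  fixes f :: "'a::euclidean_space \<Rightarrow> real"
  assumes "integrable lborel f" "\<And>x. f x > 0"
  shows "(LBINT x. f x) > 0"
proof -
  have "(LBINT x. f x) \<noteq> 0"
  proof
    assume "(LBINT x. f x) = 0"
    then have "AE x in lborel. f x = 0"
      using integral_nonneg_eq_0_iff_AE[OF assms(1)] assms(2) by (simp add: less_imp_le)
    then have "AE x in (lborel::'a measure). False" by eventually_elim (use assms(2) less_irrefl in metis)
    then have "emeasure lborel (UNIV::'a set) = 0" by (auto dest: AE_E2)
    then show False by (simp add: emeasure_lborel_UNIV)
  qed
  moreover have "(LBINT x. f x) \<ge> 0" using assms(2) by (simp add: less_imp_le)
  ultimately show ?thesis by simp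
qed

text \<open>The quotients (|N e - y| - |y|) / N tend to 1 and are bounded by 1, so dominated
  convergence leaves the mass of \<open>f\<close>.\<close>

lemma tendsto_ray_slope:
  fixes u f :: "real^5 \<Rightarrow> real"
  assumes e: "norm e = 1" and f: "integrable lborel f"
    and rep: "\<And>x. u x - u 0 = c * (LBINT y. (norm (x - y) - norm y) * f y)"
  shows "(\<lambda>n. u ((real n + 1) *\<^sub>R e) / (real n + 1)) \<longlonglongrightarrow> c * (LBINT y. f y)"
proof -
  have [measurable]: "f \<in> borel_measurable borel" using f by auto
  define N where "N n = real n + 1" for n
  have N: "N n \<ge> 1" for n by (simp add: N_def)
  have 1: "(\<lambda>n. u 0 / N n) \<longlonglongrightarrow> 0"
    using tendsto_mult_right_zero[OF tendsto_inverse_Suc, of "u 0"] by (simp add: N_def)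
  have "(\<lambda>n. LBINT y. (norm (N n *\<^sub>R e - y) - norm y) / N n * f y) \<longlonglongrightarrow> (LBINT y. f y)"
  proof (rule integral_dominated_convergence[where w="\<lambda>y. \<bar>f y\<bar>"])
    show "AE y in lborel. (\<lambda>n. (norm (N n *\<^sub>R e - y) - norm y) / N n * f y) \<longlonglongrightarrow> f y"
    proof (intro AE_I2)
      fix y
      have inv: "(\<lambda>n. 1 / N n) \<longlonglongrightarrow> 0" using tendsto_inverse_Suc by (simp add: N_def)
      have "(\<lambda>n. norm (e - (1 / N n) *\<^sub>R y) - (1 / N n) * norm y) \<longlonglongrightarrow> norm (e - 0 *\<^sub>R y) - 0 * norm y"
        by (intro tendsto_intros inv)
      moreover have "norm (e - (1 / N n) *\<^sub>R y) - (1 / N n) * norm y = (norm (N n *\<^sub>R e - y) - norm y) / N n" for n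
      proof -
        have "e - (1 / N n) *\<^sub>R y = (1 / N n) *\<^sub>R (N n *\<^sub>R e - y)"
          using N[of n] by (simp add: algebra_simps)
        then show ?thesis using N[of n] by (simp add: diff_divide_distrib)
      qed
      ultimately have "(\<lambda>n. (norm (N n *\<^sub>R e - y) - norm y) / N n) \<longlonglongrightarrow> 1" using e by simp
      from tendsto_mult[OF this tendsto_const[of "f y"]]
      show "(\<lambda>n. (norm (N n *\<^sub>R e - y) - norm y) / N n * f y) \<longlonglongrightarrow> f y" by simp
    qed
    show "AE y in lborel. norm ((norm (N n *\<^sub>R e - y) - norm y) / N n * f y) \<le> \<bar>f y\<bar>" for n
    proof (intro AE_I2)
      fix y
      have "\<bar>(norm (N n *\<^sub>R e - y) - norm y) / N n\<bar> \<le> 1"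
        using abs_norm_diff_le[of "N n *\<^sub>R e" y] N[of n] e by (simp add: abs_divide)
      from mult_right_mono[OF this, of "\<bar>f y\<bar>"]
      show "norm ((norm (N n *\<^sub>R e - y) - norm y) / N n * f y) \<le> \<bar>f y\<bar>" by (simp add: abs_mult)
    qed
  qed (use f in auto)
  from tendsto_mult[OF tendsto_const[of c] this]
  have "(\<lambda>n. (u (N n *\<^sub>R e) - u 0) / N n) \<longlonglongrightarrow> c * (LBINT y. f y)"
    unfolding rep by simp
  from tendsto_add[OF this 1] show ?thesis by (simp add: N_def add_divide_distrib[symmetric])
qed

lemma slope_at_infinity:
  fixes u f :: "real^5 \<Rightarrow> real"
  assumes lim: "((\<lambda>x. u x / norm x) \<longlongrightarrow> \<alpha>) at_infinity"
    and f: "integrable lborel f"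
    and rep: "\<And>x. u x - u 0 = c * (LBINT y. (norm (x - y) - norm y) * f y)"
  shows "\<alpha> = c * (LBINT y. f y)"
proof -
  define e :: "real^5" where "e = axis 1 1"
  have e: "norm e = 1" by (simp add: e_def)
  have "filterlim (\<lambda>n. (real n + 1) *\<^sub>R e) at_infinity sequentially"
    using filterlim_real_add_1 e by (simp add: filterlim_at_infinity_conv_norm_at_top)
  from filterlim_compose[OF lim this] have "(\<lambda>n. u ((real n + 1) *\<^sub>R e) / (real n + 1)) \<longlonglongrightarrow> \<alpha>"
    using e by simp
  then show ?thesis using tendsto_ray_slope[OF e f rep] by (rule LIMSEQ_unique)
qed

text \<open>Turns positivity of \<alpha> into the decay of negative powers of \<open>u\<close> on
  which all later integrability rests.\<close>

lemma linear_lower_bound: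
  fixes u :: "real^5 \<Rightarrow> real"
  assumes c: "continuous_on UNIV u" and pos: "\<And>x. u x > 0" and \<alpha>: "\<alpha> > 0"
    and lim: "((\<lambda>x. u x / norm x) \<longlongrightarrow> \<alpha>) at_infinity"
  obtains \<kappa> where "\<kappa> > 0" "\<And>x. u x \<ge> \<kappa> * (1 + norm x)"
proof -
  have "\<forall>\<^sub>F x in at_infinity. u x / norm x > \<alpha> / 2" using lim \<alpha> by (intro order_tendstoD(1)) auto
  then obtain b where b: "\<And>x. norm x \<ge> b \<Longrightarrow> u x / norm x > \<alpha> / 2"
    by (auto simp: eventually_at_infinity)
  define B where "B = \<bar>b\<bar> + 1"
  have "\<exists>x0\<in>cball 0 B. \<forall>y\<in>cball 0 B. u x0 \<le> u y"
    using continuous_on_subset[OF c] by (intro continuous_attains_inf) (auto simp: B_def)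
  then obtain x0 where x0: "\<And>y. norm y \<le> B \<Longrightarrow> u x0 \<le> u y" by (metis mem_cball_0)
  define \<kappa> where "\<kappa> = min (u x0 / (1 + B)) (\<alpha> / 4)"
  have \<kappa>: "\<kappa> > 0" "\<kappa> \<le> u x0 / (1 + B)" "\<kappa> \<le> \<alpha> / 4" 
    using pos[of x0] \<alpha> unfolding \<kappa>_def by (simp_all only: min.cobounded1 min.cobounded2) (simp add: B_def)
  show ?thesis
  proof (rule that[OF \<kappa>(1)])
    fix x :: "real^5"
    show "u x \<ge> \<kappa> * (1 + norm x)"
    proof (cases "norm x \<le> B")
      case True
      have "\<kappa> * (1 + norm x) \<le> (u x0 / (1 + B)) * (1 + B)"
        using True \<kappa> pos[of x0] by (intro mult_mono) (auto simp: B_def)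
      also have "\<dots> = u x0" by (simp add: B_def)
      also have "\<dots> \<le> u x" using x0 True .
      finally show ?thesis .
    next
      case False
      then have n: "norm x \<ge> 1" "norm x \<ge> b" by (auto simp: B_def)
      have "\<kappa> * (1 + norm x) \<le> \<alpha> / 4 * (2 * norm x)"
        using \<kappa> n by (intro mult_mono) auto
      also have "\<dots> < u x" using b[OF n(2)] n(1) by (simp add: less_divide_eq split: if_splits)
      finally show ?thesis by simp
    qed
  qed
qed

section \<open>Decay of \<open>f\<close> and the integral equation\<close>

locale linear_growth =
  fixes u :: "real^5 \<Rightarrow> real" and q \<kappa> :: real
  assumes q: "q > 6" and \<kappa>: "\<kappa> > 0" and lower: "\<And>x. u x \<ge> \<kappa> * (1 + norm x)"
    and diff: "\<And>x. u differentiable (at x)"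
begin

definition f where "f y = u y powr (-q)"

lemma pos: "u x > 0"
  using lower[of x] \<kappa> by (meson add_pos_nonneg less_le_trans mult_pos_pos norm_ge_zero zero_less_one)

lemma f_pos: "f x > 0" using pos[of x] by (simp add: f_def)

lemma cont: "continuous_on UNIV u" using diff by (rule continuous_on_differentiable)

lemma cont_f: "continuous_on UNIV f"
  unfolding f_def[abs_def] using pos by (intro continuous_intros cont) (metis less_irrefl)

lemma measurable_u [measurable]: "u \<in> borel_measurable borel"
  using cont by (simp add: borel_measurable_continuous_onI)

lemma measurable_f [measurable]: "f \<in> borel_measurable borel"
  using cont_f by (simp add: borel_measurable_continuous_onI)

lemma powr_bound:
  assumes "p \<ge> 0" shows "u x powr (-p) \<le> \<kappa> powr (-p) * (1 + norm x) powr (-p)"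
proof -
  have "u x powr (-p) \<le> (\<kappa> * (1 + norm x)) powr (-p)"
    using lower[of x] \<kappa> assms by (intro powr_mono2') (auto simp: add_pos_nonneg)
  then show ?thesis using \<kappa> by (simp add: powr_mult)
qed

lemma integrable_powr:
  assumes "p > 5" shows "integrable lborel (\<lambda>x. u x powr (-p))"
proof (rule Bochner_Integration.integrable_bound)
  show "integrable lborel (\<lambda>x::real^5. \<kappa> powr (-p) * (1 + norm x) powr (-p))"
    using integrable_one_plus_norm_powr[OF assms] by simp
  show "AE x in lborel. norm (u x powr (-p)) \<le> norm (\<kappa> powr (-p) * (1 + norm x) powr (-p))"
    using powr_bound[of p] assms by simp
qed measurable

text \<open>The threshold 6 enters here: the weight 1 + |x| costs one power, and q - 1 > 5 gives
  integrability in dimension 5.\<close>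

lemma integrable_weighted:
  "integrable lborel (\<lambda>x::real^5. (1 + norm x) * (1 + norm x) powr (-q))"
proof -
  have "(1 + norm x) * (1 + norm x) powr (-q) = (1 + norm x) powr (-(q - 1))" for x :: "real^5"
    using powr_mult_base[of "1 + norm x" "-q"] by (simp add: add_nonneg_pos)
  then show ?thesis using integrable_one_plus_norm_powr[of "q - 1"] q by simp
qed

lemma integrable_f: "integrable lborel f"
  using integrable_powr[of q] q by (simp add: f_def[abs_def])

lemma integrable_norm_f: "integrable lborel (\<lambda>y. norm y * f y)"
proof (rule Bochner_Integration.integrable_bound)
  show "integrable lborel (\<lambda>x::real^5. \<kappa> powr (-q) * ((1 + norm x) * (1 + norm x) powr (-q)))"
    using integrable_weighted by (rule integrable_mult_right)
  have "norm x * f x \<le> (1 + norm x) * (\<kappa> powr (-q) * (1 + norm x) powr (-q))" for x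
    using powr_bound[of q x] q f_pos[of x] by (intro mult_mono) (auto simp: f_def)
  then show "AE x in lborel. norm (norm x * f x) \<le> norm (\<kappa> powr (-q) * ((1 + norm x) * (1 + norm x) powr (-q)))"
    using less_imp_le[OF f_pos] by (intro AE_I2) (simp add: mult.left_commute abs_mult)
qed measurable

lemma integrable_dist_f: "integrable lborel (\<lambda>y. norm (x - y) * f y)"
proof (rule Bochner_Integration.integrable_bound)
  show "integrable lborel (\<lambda>y. norm x * f y + norm y * f y)"
    using integrable_norm_f integrable_f by auto
  have "norm (x - y) * f y \<le> (norm x + norm y) * f y" for y
    using norm_triangle_ineq4[of x y] f_pos[of y] by (intro mult_right_mono) auto
  then show "AE y in lborel. norm (norm (x - y) * f y) \<le> norm (norm x * f y + norm y * f y)"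
    using less_imp_le[OF f_pos] by (intro AE_I2) (simp add: distrib_right abs_mult)
qed measurable

end

text \<open>Kept as a locale so that it can be instantiated again for translates of
  \<open>u\<close>, which solve the same equation with the same \<open>c\<close>.\<close>

locale integral_equation = linear_growth u q \<kappa> for u q \<kappa> +
  fixes c \<gamma> :: real
  assumes c: "c > 0"
    and eq: "\<And>x. u x = c * (LBINT y. norm (x - y) * u y powr (-q)) + \<gamma>"
begin

lemma eq_f: "u x = c * (LBINT y. norm (x - y) * f y) + \<gamma>"
  using eq[of x] by (simp add: f_def)

lemma diff_formula: "u x - u z = c * (LBINT y. (norm (x - y) - norm (z - y)) * f y)"
  using eq_f[of x] eq_f[of z] integrable_dist_f[of x] integrable_dist_f[of z]
  by (simp add: left_diff_distrib right_diff_distrib)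

text \<open>The linear growth rate of \<open>u\<close> along rays, by \<open>tendsto_ray\<close>; it
  is also a global Lipschitz constant.\<close>

definition slope where "slope = c * (LBINT y. f y)"

lemma slope_pos: "slope > 0"
  using c integral_pos_lborel[OF integrable_f f_pos] by (simp add: slope_def)

lemma tendsto_ray: "norm e = 1 \<Longrightarrow> (\<lambda>n. u ((real n + 1) *\<^sub>R e) / (real n + 1)) \<longlonglongrightarrow> slope"
  unfolding slope_def by (rule tendsto_ray_slope) (use integrable_f diff_formula[of _ 0] in auto)

lemma lipschitz: "\<bar>u x - u z\<bar> \<le> slope * norm (x - z)"
proof -
  have "\<bar>LBINT y. (norm (x - y) - norm (z - y)) * f y\<bar> \<le> (LBINT y. norm (x - z) * f y)"
  proof (rule integral_abs_bound[THEN order_trans], rule integral_mono)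
    have "integrable lborel (\<lambda>y. (norm (x - y) - norm (z - y)) * f y)"
      using integrable_dist_f[of x] integrable_dist_f[of z] by (simp add: left_diff_distrib)
    then show "integrable lborel (\<lambda>y. \<bar>(norm (x - y) - norm (z - y)) * f y\<bar>)" by (rule integrable_abs)
    show "integrable lborel (\<lambda>y. norm (x - z) * f y)" using integrable_f by simp
    show "\<bar>(norm (x - y) - norm (z - y)) * f y\<bar> \<le> norm (x - z) * f y" for y
      using norm_triangle_ineq3[of "x - y" "z - y"] f_pos[of y] by (simp add: abs_mult mult_right_mono)
  qed
  then show ?thesis
    using c by (simp add: diff_formula slope_def abs_mult mult_ac)
qed

end

subsection \<open>The Pohozaev identity\<close>

context integral_equation
begin

definition Du where "Du x = frechet_derivative u (at x)"

lemma has_derivative_u: "(u has_derivative Du x) (at x)"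
  using diff[of x] by (simp add: Du_def frechet_derivative_works[symmetric])

lemma filterlim_inverse_Suc_at_0: "filterlim (\<lambda>n. 1 / (real n + 1)) (at 0) sequentially"
  using tendsto_inverse_Suc by (auto simp: filterlim_at intro!: always_eventually)

lemma radial_derivative_u: "((\<lambda>h. u ((1 + h) *\<^sub>R x)) has_real_derivative Du x x) (at 0)"
proof -
  have "((\<lambda>h. (1 + h) *\<^sub>R x) has_derivative (\<lambda>h. h *\<^sub>R x)) (at 0)"
    by (auto intro!: derivative_eq_intros)
  moreover have "(u has_derivative Du x) (at ((1 + 0) *\<^sub>R x))"
    using has_derivative_u[of x] by simp
  ultimately have "((\<lambda>h. u ((1 + h) *\<^sub>R x)) has_derivative (\<lambda>h. Du x (h *\<^sub>R x))) (at 0)"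
    by (rule has_derivative_compose)
  then show ?thesis
    by (rule has_derivative_imp_has_field_derivative)
       (simp add: linear_scale[OF has_derivative_linear[OF has_derivative_u[of x]]])
qed

text \<open>Differentiation under the integral: the gradient of |x - y| in x is sgn (x - y), and the
  difference quotients are dominated by |x| f(y). The exceptional point y = x is a null set.\<close>

lemma radial_derivative_eq: "Du x x = c * (LBINT y. (x \<bullet> sgn (x - y)) * f y)"
proof -
  define h where "h n = 1 / (real n + 1)" for n
  have h: "h n > 0" for n by (simp add: h_def)
  have "((\<lambda>t. (u ((1 + t) *\<^sub>R x) - u x) / t) \<longlongrightarrow> Du x x) (at 0)"
    using radial_derivative_u[of x] by (simp add: has_field_derivative_iff)
  from filterlim_compose[OF this filterlim_inverse_Suc_at_0]
  have 1: "(\<lambda>n. (u ((1 + h n) *\<^sub>R x) - u x) / h n) \<longlonglongrightarrow> Du x x" by (simp add: h_def)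
  have "(\<lambda>n. LBINT y. (norm ((1 + h n) *\<^sub>R x - y) - norm (x - y)) / h n * f y) \<longlonglongrightarrow> (LBINT y. (x \<bullet> sgn (x - y)) * f y)"
  proof (rule integral_dominated_convergence[where w="\<lambda>y. norm x * f y"])
    show "integrable lborel (\<lambda>y. norm x * f y)" using integrable_f by simp
    show "AE y in lborel. norm ((norm ((1 + h n) *\<^sub>R x - y) - norm (x - y)) / h n * f y) \<le> norm x * f y" for n
    proof (intro AE_I2)
      fix y
      have "\<bar>norm ((1 + h n) *\<^sub>R x - y) - norm (x - y)\<bar> \<le> norm (h n *\<^sub>R x)"
        using norm_triangle_ineq3[of "(1 + h n) *\<^sub>R x - y" "x - y"] by (simp add: algebra_simps)
      then have "\<bar>(norm ((1 + h n) *\<^sub>R x - y) - norm (x - y)) / h n\<bar> \<le> norm x"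
        using h[of n] by (simp add: abs_divide pos_divide_le_eq mult.commute)
      from mult_right_mono[OF this, of "f y"] f_pos[of y]
      show "norm ((norm ((1 + h n) *\<^sub>R x - y) - norm (x - y)) / h n * f y) \<le> norm x * f y"
        by (simp add: abs_mult)
    qed
    have "AE y in lborel. y \<noteq> x" by (rule AE_lborel_singleton)
    then show "AE y in lborel. (\<lambda>n. (norm ((1 + h n) *\<^sub>R x - y) - norm (x - y)) / h n * f y) \<longlonglongrightarrow> (x \<bullet> sgn (x - y)) * f y"
    proof eventually_elim
      case (elim y)
      have n0: "(norm has_derivative (\<lambda>v. v \<bullet> sgn (x - y))) (at ((1 + 0) *\<^sub>R x - y))"
        using elim has_derivative_norm[of "x - y"] by simp
      have "((\<lambda>t. (1 + t) *\<^sub>R x - y) has_derivative (\<lambda>t. t *\<^sub>R x)) (at 0)"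
        by (auto intro!: derivative_eq_intros)
      from has_derivative_compose[OF this n0]
      have "((\<lambda>t. norm ((1 + t) *\<^sub>R x - y)) has_real_derivative (x \<bullet> sgn (x - y))) (at 0)"
        by (rule has_derivative_imp_has_field_derivative) simp
      then have "((\<lambda>t. (norm ((1 + t) *\<^sub>R x - y) - norm (x - y)) / t) \<longlongrightarrow> x \<bullet> sgn (x - y)) (at 0)"
        by (simp add: has_field_derivative_iff)
      from filterlim_compose[OF this filterlim_inverse_Suc_at_0]
      show ?case unfolding h_def by (intro tendsto_mult tendsto_const)
    qed
    show "(\<lambda>y. (x \<bullet> sgn (x - y)) * f y) \<in> borel_measurable lborel"
      by (simp add: sgn_div_norm[abs_def])
  qed measurable
  from tendsto_mult[OF tendsto_const[of c] this]
  have "(\<lambda>n. (u ((1 + h n) *\<^sub>R x) - u x) / h n) \<longlonglongrightarrow> c * (LBINT y. (x \<bullet> sgn (x - y)) * f y)"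
    unfolding diff_formula by simp
  with 1 show ?thesis by (rule LIMSEQ_unique)
qed

lemma powr_diff_bound:
  assumes "m > 0" "a \<ge> m" "b \<ge> m"
  shows "\<bar>a powr (1 - q) - b powr (1 - q)\<bar> \<le> (q - 1) * m powr (-q) * \<bar>a - b\<bar>"
proof -
  have "norm (a powr (1 - q) - b powr (1 - q)) \<le> ((q - 1) * m powr (-q)) * norm (a - b)"
  proof (rule field_differentiable_bound[where S="{m..}" and f'="\<lambda>z. (1 - q) * z powr (-q)"])
    show "((\<lambda>z. z powr (1 - q)) has_real_derivative (1 - q) * z powr (-q)) (at z within {m..})" if "z \<in> {m..}" for z
      using that assms(1) has_real_derivative_powr[of z "1 - q"] by (auto intro: has_field_derivative_at_within)
    show "norm ((1 - q) * z powr (-q)) \<le> (q - 1) * m powr (-q)" if "z \<in> {m..}" for z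
      using that assms(1) q powr_mono2'[of "-q" m z] by (simp add: abs_mult mult_left_mono)
  qed (use assms in auto)
  then show ?thesis by simp
qed

text \<open>A dilation by 1 + h multiplies the integral of \<open>u powr (1 - q)\<close> by (1 +
  h)^(-5). Differentiating this at h = 0, on one side under the integral, produces the factor
  5.\<close>

lemma dilation_identity:
  "integrable lborel (\<lambda>x. f x * Du x x)"
  "(q - 1) * (LBINT x. f x * Du x x) = 5 * (LBINT x. u x powr (1 - q))"
proof -
  define h where "h n = 1 / (real n + 1)" for n
  have h: "h n > 0" for n by (simp add: h_def)
  define W where "W x = u x powr (1 - q)" for x
  have [measurable]: "W \<in> borel_measurable borel" unfolding W_def[abs_def] by measurable
  have iW: "integrable lborel W" using integrable_powr[of "q - 1"] q by (simp add: W_def[abs_def])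
  have iWh: "integrable lborel (\<lambda>x. W ((1 + h n) *\<^sub>R x))" for n
    using integrable_lborel_affine[of "1 + h n" W 0] iW h[of n] by simp
  have e1: "(LBINT x. W ((1 + h n) *\<^sub>R x)) = inverse ((1 + h n)^5) * (LBINT x. W x)" for n
    using integral_lborel_affine[of "1 + h n" W 0] h[of n] by (simp add: abs_of_pos del: distrib_left)
  have e2: "(LBINT x. (W ((1 + h n) *\<^sub>R x) - W x) / h n) = (inverse ((1 + h n)^5) - 1) / h n * (LBINT x. W x)" for n
    using iWh[of n] iW by (simp add: e1 left_diff_distrib)
  have l1: "(\<lambda>n. (inverse ((1 + h n)^5) - 1) / h n * (LBINT x. W x)) \<longlonglongrightarrow> (-5) * (LBINT x. W x)"
  proof (intro tendsto_mult tendsto_const)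
    have "((\<lambda>t::real. inverse ((1 + t)^5)) has_real_derivative -5) (at 0)"
      by (auto intro!: derivative_eq_intros)
    then have "((\<lambda>t::real. (inverse ((1 + t)^5) - 1) / t) \<longlongrightarrow> -5) (at 0)"
      by (simp add: has_field_derivative_iff)
    from filterlim_compose[OF this filterlim_inverse_Suc_at_0]
    show "(\<lambda>n. (inverse ((1 + h n)^5) - 1) / h n) \<longlonglongrightarrow> -5" by (simp add: h_def)
  qed
  have pl: "(\<lambda>n. (W ((1 + h n) *\<^sub>R x) - W x) / h n) \<longlonglongrightarrow> (1 - q) * (f x * Du x x)" for x
  proof -
    have "((\<lambda>t. u ((1 + t) *\<^sub>R x) powr (1 - q)) has_real_derivative (1 - q) * u x powr (1 - q - 1) * Du x x) (at 0)"
    proof (rule DERIV_chain'[OF radial_derivative_u])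
      show "((\<lambda>z. z powr (1 - q)) has_real_derivative (1 - q) * u x powr (1 - q - 1)) (at (u ((1 + 0) *\<^sub>R x)))"
        using has_real_derivative_powr[OF pos[of x], of "1 - q"] by simp
    qed
    then have "((\<lambda>t. (W ((1 + t) *\<^sub>R x) - W x) / t) \<longlongrightarrow> (1 - q) * (f x * Du x x)) (at 0)"
      by (simp add: has_field_derivative_iff W_def f_def mult_ac)
    from filterlim_compose[OF this filterlim_inverse_Suc_at_0] show ?thesis by (simp add: h_def)
  qed
  \<comment> \<open>Since h > 0, the lower bound \<kappa> (1 + |x|) is valid at both x and (1 + h)
    x; together with the Lipschitz estimate it dominates the quotient by a multiple of the weight in
    \<open>integrable_weighted\<close>.\<close>
  have bd: "\<bar>(W ((1 + h n) *\<^sub>R x) - W x) / h n\<bar> \<le> (q - 1) * \<kappa> powr (-q) * slope * ((1 + norm x) * (1 + norm x) powr (-q))" for n x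
  proof -
    let ?m = "\<kappa> * (1 + norm x)"
    have m: "?m > 0" using \<kappa> by (simp add: add_pos_nonneg)
    have "norm x \<le> norm ((1 + h n) *\<^sub>R x)"
      using h[of n] mult_right_mono[of 1 "1 + h n" "norm x"] by simp
    then have "?m \<le> \<kappa> * (1 + norm ((1 + h n) *\<^sub>R x))" using \<kappa> by (intro mult_left_mono) auto
    also have "\<dots> \<le> u ((1 + h n) *\<^sub>R x)" by (rule lower)
    finally have "\<bar>W ((1 + h n) *\<^sub>R x) - W x\<bar> \<le> (q - 1) * ?m powr (-q) * \<bar>u ((1 + h n) *\<^sub>R x) - u x\<bar>"
      unfolding W_def using m lower[of x] by (intro powr_diff_bound)
    also have "\<dots> \<le> (q - 1) * ?m powr (-q) * (slope * (h n * norm x))"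
      using lipschitz[of "(1 + h n) *\<^sub>R x" x] q h[of n]
      by (intro mult_left_mono mult_nonneg_nonneg) (auto simp: algebra_simps)
    also have "\<dots> \<le> (q - 1) * ?m powr (-q) * (slope * (h n * (1 + norm x)))"
      using q h[of n] slope_pos by (intro mult_left_mono) auto
    finally have "\<bar>W ((1 + h n) *\<^sub>R x) - W x\<bar> \<le> (q - 1) * ?m powr (-q) * (slope * (h n * (1 + norm x)))" .
    then show ?thesis using h[of n] \<kappa> by (simp add: abs_divide pos_divide_le_eq powr_mult mult_ac)
  qed
  \<comment> \<open>\<open>Du\<close> is known only as a pointwise derivative, so measurability is
    read off from the limit of the difference quotients.\<close>
  have mD [measurable]: "(\<lambda>x. f x * Du x x) \<in> borel_measurable lborel"
  proof -
    have "(\<lambda>x. (1 - q) * (f x * Du x x)) \<in> borel_measurable lborel"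
      by (rule borel_measurable_LIMSEQ_real[OF pl]) measurable
    from borel_measurable_times[OF borel_measurable_const[of "1 / (1 - q)"] this] show ?thesis
      using q by simp
  qed
  have iw: "integrable lborel (\<lambda>x::real^5. (q - 1) * \<kappa> powr (-q) * slope * ((1 + norm x) * (1 + norm x) powr (-q)))"
    using integrable_weighted by (rule integrable_mult_right)
  have ms: "(\<lambda>x. (1 - q) * (f x * Du x x)) \<in> borel_measurable lborel"
    "(\<lambda>x. (W ((1 + h n) *\<^sub>R x) - W x) / h n) \<in> borel_measurable lborel" for n by measurable
  note dc = integral_dominated_convergence[OF ms iw AE_I2[OF pl]]
    integrable_dominated_convergence[OF ms iw AE_I2[OF pl]]
  have l2: "(\<lambda>n. LBINT x. (W ((1 + h n) *\<^sub>R x) - W x) / h n) \<longlonglongrightarrow> (LBINT x. (1 - q) * (f x * Du x x))"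
    by (rule dc) (use bd in simp)
  have i: "integrable lborel (\<lambda>x. (1 - q) * (f x * Du x x))"
    by (rule dc) (use bd in simp)
  then show "integrable lborel (\<lambda>x. f x * Du x x)"
    using q by simp
  have "(LBINT x. (1 - q) * (f x * Du x x)) = (-5) * (LBINT x. W x)"
    by (rule LIMSEQ_unique[OF l2[unfolded e2] l1])
  then show "(q - 1) * (LBINT x. f x * Du x x) = 5 * (LBINT x. u x powr (1 - q))"
    unfolding integral_mult_right_zero by (simp add: W_def left_diff_distrib)
qed

text \<open>Exchanging x and y turns the factor x in front of sgn (x - y) into -y, so the two
  versions add up to the inner product of x - y with its own direction, which is |x - y|.\<close>

lemma symmetrization:
  "2 * (LBINT x. f x * (LBINT y. (x \<bullet> sgn (x - y)) * f y)) = (LBINT x. f x * (LBINT y. norm (x - y) * f y))"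
proof -
  define \<Phi> where "\<Phi> x y = f x * ((x \<bullet> sgn (x - y)) * f y)" for x y
  have m [measurable]: "(\<lambda>(x, y). \<Phi> x y) \<in> borel_measurable (lborel \<Otimes>\<^sub>M lborel)"
    unfolding \<Phi>_def sgn_div_norm by measurable
  \<comment> \<open>Fubini needs absolute integrability on the product space; the majorant |x| f(x)
    f(y) has it because |x| f and f are integrable.\<close>
  have "integrable (lborel \<Otimes>\<^sub>M lborel) (\<lambda>(x, y). norm x * f x * f y)"
  proof (rule lborel_pair.Fubini_integrable)
    show "integrable lborel (\<lambda>x. LBINT y. norm (case (x, y) of (x, y) \<Rightarrow> norm x * f x * f y))"
      using integrable_norm_f less_imp_le[OF f_pos] by (simp add: abs_mult)
    show "AE x in lborel. integrable lborel (\<lambda>y. case (x, y) of (x, y) \<Rightarrow> norm x * f x * f y)"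
      using integrable_f by simp
  qed measurable
  then have iP: "integrable (lborel \<Otimes>\<^sub>M lborel) (\<lambda>(x, y). \<Phi> x y)"
  proof (rule Bochner_Integration.integrable_bound)
    show "AE z in lborel \<Otimes>\<^sub>M lborel. norm (case z of (x, y) \<Rightarrow> \<Phi> x y) \<le> norm (case z of (x, y) \<Rightarrow> norm x * f x * f y)"
    proof (intro AE_I2, clarify)
      fix x y :: "real^5"
      have "\<bar>x \<bullet> sgn (x - y)\<bar> \<le> norm x * norm (sgn (x - y))" by (rule Cauchy_Schwarz_ineq2)
      also have "\<dots> \<le> norm x" by (simp add: norm_sgn)
      finally have "f x * f y * \<bar>x \<bullet> sgn (x - y)\<bar> \<le> f x * f y * norm x"
        using f_pos[of x] f_pos[of y] by (intro mult_left_mono) auto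
      then show "norm (\<Phi> x y) \<le> norm (norm x * f x * f y)"
        using f_pos[of x] f_pos[of y] by (simp add: \<Phi>_def abs_mult mult_ac)
    qed
  qed measurable
  have swap: "(LBINT x. (LBINT y. \<Phi> y x)) = (LBINT x. (LBINT y. \<Phi> x y))"
    by (rule lborel_pair.Fubini_integral[OF iP])
  have i1: "integrable lborel (\<lambda>x. LBINT y. \<Phi> x y)"
    using lborel_pair.integrable_fst[OF iP] by simp
  have i2: "integrable lborel (\<lambda>x. LBINT y. \<Phi> y x)"
    using lborel_pair.integrable_snd[OF iP] by simp
  have in1: "integrable lborel (\<lambda>y. \<Phi> x y)" for x
  proof (rule Bochner_Integration.integrable_bound[of _ "\<lambda>y. f x * norm x * f y"])
    show "integrable lborel (\<lambda>y. f x * norm x * f y)" using integrable_f by simp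
    have "\<bar>x \<bullet> sgn (x - y)\<bar> \<le> norm x * norm (sgn (x - y))" for y by (rule Cauchy_Schwarz_ineq2)
    then have "\<bar>x \<bullet> sgn (x - y)\<bar> \<le> norm x" for y by (rule order_trans) (simp add: norm_sgn)
    then show "AE y in lborel. norm (\<Phi> x y) \<le> norm (f x * norm x * f y)"
      using less_imp_le[OF f_pos] by (intro AE_I2) (simp add: \<Phi>_def abs_mult mult.assoc mult_left_mono mult_right_mono)
    show "(\<lambda>y. \<Phi> x y) \<in> borel_measurable lborel" unfolding \<Phi>_def sgn_div_norm by measurable
  qed
  have sum: "\<Phi> x y + \<Phi> y x = f x * (norm (x - y) * f y)" for x y
  proof -
    have "sgn (y - x) = - sgn (x - y)" using sgn_minus[of "x - y"] by simp
    then have "\<Phi> x y + \<Phi> y x = f x * f y * ((x - y) \<bullet> sgn (x - y))"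
      by (simp add: \<Phi>_def inner_diff_left algebra_simps)
    also have "(x - y) \<bullet> sgn (x - y) = norm (x - y)"
      by (cases "x = y") (auto simp: sgn_div_norm power2_norm_eq_inner[symmetric] power2_eq_square)
    finally show ?thesis by simp
  qed
  have in2: "integrable lborel (\<lambda>y. \<Phi> y x)" for x
  proof -
    have "integrable lborel (\<lambda>y. f x * (norm (x - y) * f y) - \<Phi> x y)"
      using in1[of x] integrable_dist_f[of x] by simp
    then show ?thesis by (simp add: sum[symmetric])
  qed
  have "2 * (LBINT x. f x * (LBINT y. (x \<bullet> sgn (x - y)) * f y)) = 2 * (LBINT x. (LBINT y. \<Phi> x y))"
    by (simp add: \<Phi>_def)
  also have "\<dots> = (LBINT x. (LBINT y. \<Phi> x y) + (LBINT y. \<Phi> y x))"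
    using i1 i2 swap by simp
  also have "\<dots> = (LBINT x. (LBINT y. f x * (norm (x - y) * f y)))"
    using in1 in2 by (simp add: sum[symmetric])
  finally show ?thesis by simp
qed

text \<open>Multiplying the symmetrised identity by q - 1 and inserting
  \<open>dilation_identity\<close> sets q - 1 against 2 * 5 in front of the integral of
  \<open>u powr (1 - q)\<close>; this is the source of q - 11.\<close>

lemma Pohozaev: "(q - 1) * \<gamma> * (LBINT x. f x) = (q - 11) * (LBINT x. u x powr (1 - q))"
proof -
  have "2 * (LBINT x. f x * Du x x) = c * (LBINT x. f x * (LBINT y. norm (x - y) * f y))"
    unfolding symmetrization[symmetric] radial_derivative_eq by (simp add: mult.left_commute[of _ c])
  also have "\<dots> = (LBINT x. u x powr (1 - q) - \<gamma> * f x)"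
  proof -
    have "c * (f x * (LBINT y. norm (x - y) * f y)) = u x powr (1 - q) - \<gamma> * f x" for x
    proof -
      have "f x * (u x - \<gamma>) = u x powr (1 - q) - \<gamma> * f x"
        using powr_mult_base[of "u x" "-q"] pos[of x] by (simp add: f_def algebra_simps)
      then show ?thesis using eq_f[of x] by (simp add: mult_ac)
    qed
    then show ?thesis by (simp flip: integral_mult_right_zero)
  qed
  also have "\<dots> = (LBINT x. u x powr (1 - q)) - \<gamma> * (LBINT x. f x)"
    using integrable_powr[of "q - 1"] q integrable_f by simp
  finally have "2 * (LBINT x. f x * Du x x) = (LBINT x. u x powr (1 - q)) - \<gamma> * (LBINT x. f x)" .
  then have A: "(LBINT x. u x powr (1 - q)) - \<gamma> * (LBINT x. f x) = 2 * (LBINT x. f x * Du x x)" ..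
  have "(q - 1) * ((LBINT x. u x powr (1 - q)) - \<gamma> * (LBINT x. f x)) = 10 * (LBINT x. u x powr (1 - q))"
    unfolding A mult.left_commute[of "q - 1" 2] dilation_identity(2) by simp
  then show ?thesis by (simp add: algebra_simps)
qed

lemma sign_\<gamma>: "sgn \<gamma> = sgn (q - 11)"
proof -
  have "(LBINT x. u x powr (1 - q)) > 0"
  proof (rule integral_pos_lborel)
    show "u x powr (1 - q) > 0" for x using pos[of x] by simp
  qed (use integrable_powr[of "q - 1"] q in simp)
  then have "sgn ((q - 1) * \<gamma> * (LBINT x. f x)) = sgn (q - 11)"
    unfolding Pohozaev sgn_mult by simp
  then show ?thesis using q integral_pos_lborel[OF integrable_f f_pos] by (simp add: sgn_mult)
qed

end

subsection \<open>Inversions\<close>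

text \<open>Division by zero makes the origin a fixed point, so \<open>norm_inversion\<close> holds
  there as well.\<close>

definition inversion :: "real \<Rightarrow> 'a::euclidean_space \<Rightarrow> 'a" where
  "inversion l x = (l\<^sup>2 / (norm x)\<^sup>2) *\<^sub>R x"

lemma measurable_inversion [measurable]: "inversion l \<in> borel_measurable borel"
  unfolding inversion_def[abs_def] by measurable

lemma norm_inversion: "l > 0 \<Longrightarrow> norm (inversion l x) = l\<^sup>2 / norm x"
  by (cases "x = 0") (auto simp: inversion_def power2_eq_square)

lemma inversion_nonzero: "l > 0 \<Longrightarrow> x \<noteq> 0 \<Longrightarrow> inversion l x \<noteq> 0"
  by (simp add: inversion_def)

lemma inversion_inversion: "l > 0 \<Longrightarrow> x \<noteq> 0 \<Longrightarrow> inversion l (inversion l x) = x"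
  using norm_inversion[of l x] by (simp add: inversion_def[of l "inversion l x"])
     (simp add: inversion_def power_divide field_simps power2_eq_square)

text \<open>The point is the symmetry of the right-hand side in x and z; the commutation laws and
  the kernel estimate below are read off from it.\<close>

lemma inversion_distance:
  assumes "l > 0" "z \<noteq> 0"
  shows "(norm z / l * norm (x - inversion l z))\<^sup>2 = (norm x)\<^sup>2 * (norm z)\<^sup>2 / l\<^sup>2 - 2 * (x \<bullet> z) + l\<^sup>2"
proof -
  have "(norm (x - inversion l z))\<^sup>2 = (norm x)\<^sup>2 - 2 * (l\<^sup>2 / (norm z)\<^sup>2) * (x \<bullet> z) + (norm (inversion l z))\<^sup>2"
    unfolding power2_norm_eq_inner
    by (simp add: inner_diff_left inner_diff_right inner_commute) (simp add: inversion_def inner_commute power2_norm_eq_inner)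
  also have "norm (inversion l z) = l\<^sup>2 / norm z" using assms by (intro norm_inversion)
  finally show ?thesis
    using assms by (simp add: power_mult_distrib power_divide field_simps power2_eq_square)
qed

text \<open>Both identities are obtained by comparing squares. The second is the distortion law |x'
  - z'| = l^2 |x - z| / (|x| |z|) for the reflected points.\<close>

lemma
  assumes "l > 0" "z \<noteq> 0" "x \<noteq> 0"
  shows inversion_distance_commute: "norm x / l * norm (inversion l x - z) = norm z / l * norm (x - inversion l z)"
    and inversion_distance_both: "norm x / l * (norm z / l * norm (inversion l x - inversion l z)) = norm (x - z)"
proof -
  have "(norm x / l * norm (inversion l x - z))\<^sup>2 = (norm z / l * norm (x - inversion l z))\<^sup>2"
    using inversion_distance[OF assms(1,2), of x] inversion_distance[OF assms(1,3), of z]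
    by (simp add: norm_minus_commute inner_commute mult.commute)
  then show *: "norm x / l * norm (inversion l x - z) = norm z / l * norm (x - inversion l z)"
    by (rule power2_eq_imp_eq) (use assms in auto)
  have "(norm z / l * norm (inversion l x - inversion l z))\<^sup>2 = (l / norm x * norm (x - z))\<^sup>2"
    unfolding inversion_distance[OF assms(1,2)] norm_inversion[OF assms(1)]
    using assms by (simp add: inversion_def power_mult_distrib power_divide power2_norm_eq_inner[of "x - z"] inner_diff_left inner_diff_right inner_commute)
      (simp add: power2_norm_eq_inner[symmetric] field_simps eval_nat_numeral)
  then have "norm z / l * norm (inversion l x - inversion l z) = l / norm x * norm (x - z)"
    by (rule power2_eq_imp_eq) (use assms in auto)
  then show "norm x / l * (norm z / l * norm (inversion l x - inversion l z)) = norm (x - z)"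
    using assms by simp
qed

text \<open>The difference of the squared distances is exactly (|x|^2 - l^2) (|z|^2 - l^2) / l^2;
  dividing by their sum, at most 4 |x| |z| / l, separates the variables. The product form makes the
  later gap estimate uniform in x.\<close>

lemma inversion_kernel_lower_bound:
  assumes l: "l > 0" and x: "norm x \<ge> l" and z: "norm z \<ge> l"
  shows "norm z / l * norm (x - inversion l z) - norm (x - z)
    \<ge> ((norm x)\<^sup>2 - l\<^sup>2) / norm x * (((norm z)\<^sup>2 - l\<^sup>2) / (4 * l * norm z))"
proof -
  define B where "B = norm z / l * norm (x - inversion l z)"
  define D where "D = norm (x - z)"
  define r where "r = norm x"
  define s where "s = norm z"
  have rs: "r \<ge> l" "s \<ge> l" "r > 0" "s > 0" using l x z by (auto simp: r_def s_def)
  have z0: "z \<noteq> 0" using l z by auto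
  have B0: "B \<ge> 0" "D \<ge> 0" using l by (auto simp: B_def D_def)
  have B2: "B\<^sup>2 = r\<^sup>2 * s\<^sup>2 / l\<^sup>2 - 2 * (x \<bullet> z) + l\<^sup>2"
    unfolding B_def r_def s_def by (rule inversion_distance[OF l z0])
  have D2: "D\<^sup>2 = r\<^sup>2 - 2 * (x \<bullet> z) + s\<^sup>2"
    unfolding D_def r_def s_def power2_norm_eq_inner by (simp add: inner_diff_left inner_diff_right inner_commute)
  have X: "B\<^sup>2 - D\<^sup>2 = (r\<^sup>2 - l\<^sup>2) * (s\<^sup>2 - l\<^sup>2) / l\<^sup>2"
    unfolding B2 D2 using l by (simp add: field_simps)
  have sq: "r\<^sup>2 - l\<^sup>2 \<ge> 0" "s\<^sup>2 - l\<^sup>2 \<ge> 0" using rs l power_mono[of l r 2] power_mono[of l s 2] by auto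
  then have "D\<^sup>2 \<le> B\<^sup>2" using X l by (smt (verit) divide_nonneg_nonneg mult_nonneg_nonneg zero_le_power2)
  then have DB: "D \<le> B" using B0 power2_le_imp_le by blast
  have "B \<le> 2 * (r * s / l)"
  proof -
    have "norm (x - inversion l z) \<le> r + l\<^sup>2 / s"
      using norm_triangle_ineq4[of x "inversion l z"] norm_inversion[OF l, of z] by (simp add: r_def s_def)
    then have "B \<le> s / l * (r + l\<^sup>2 / s)" unfolding B_def s_def using l by (intro mult_left_mono) auto
    also have "\<dots> = r * s / l + l" using l rs by (simp add: field_simps power2_eq_square)
    finally have "B \<le> r * s / l + l" .
    moreover have "l \<le> r * s / l" using l rs mult_mono[of l r l s] by (simp add: field_simps)
    ultimately show ?thesis by linarith
  qed
  then have "(B - D) * (B + D) \<le> (B - D) * (4 * (r * s / l))"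
    using DB by (intro mult_left_mono) auto
  then have "(r\<^sup>2 - l\<^sup>2) * (s\<^sup>2 - l\<^sup>2) / l\<^sup>2 \<le> (B - D) * (4 * (r * s / l))"
    using X by (simp add: square_diff_square_factored power2_eq_square mult.commute)
  then have "(r\<^sup>2 - l\<^sup>2) * (s\<^sup>2 - l\<^sup>2) / l\<^sup>2 / (4 * (r * s / l)) \<le> B - D"
    using l rs by (subst pos_divide_le_eq) auto
  also have "(r\<^sup>2 - l\<^sup>2) * (s\<^sup>2 - l\<^sup>2) / l\<^sup>2 / (4 * (r * s / l)) = (r\<^sup>2 - l\<^sup>2) / r * ((s\<^sup>2 - l\<^sup>2) / (4 * l * s))"
    using l rs by (simp add: power2_eq_square[of l])
  finally have "(r\<^sup>2 - l\<^sup>2) / r * ((s\<^sup>2 - l\<^sup>2) / (4 * l * s)) \<le> B - D" .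
  then show ?thesis by (simp add: B_def D_def r_def s_def)
qed

lemma has_derivative_inversion:
  assumes "x \<noteq> 0"
  shows "(inversion l has_derivative (\<lambda>v. (l\<^sup>2 / (norm x)\<^sup>2) *\<^sub>R (v - (2 * (x \<bullet> v) / (norm x)\<^sup>2) *\<^sub>R x))) (at x)"
proof -
  have "((\<lambda>x. (l\<^sup>2 / (x \<bullet> x)) *\<^sub>R x) has_derivative
      (\<lambda>v. (l\<^sup>2 / (norm x)\<^sup>2) *\<^sub>R (v - (2 * (x \<bullet> v) / (norm x)\<^sup>2) *\<^sub>R x))) (at x)"
    using assms
    by (auto intro!: derivative_eq_intros simp: fun_eq_iff power2_norm_eq_inner inner_commute scaleR_diff_right field_simps)
  then show ?thesis by (simp add: inversion_def[abs_def] power2_norm_eq_inner)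
qed

text \<open>The derivative is the scalar l^2 / |x|^2 times the reflection in the hyperplane
  orthogonal to x, which is an orthogonal map; the exponent 5 is the dimension.\<close>

lemma abs_det_inversion:
  fixes x :: "real^5"
  assumes "x \<noteq> 0"
  shows "\<bar>det (matrix (\<lambda>v. (l\<^sup>2 / (norm x)\<^sup>2) *\<^sub>R (v - (2 * (x \<bullet> v) / (norm x)\<^sup>2) *\<^sub>R x)))\<bar> = (l\<^sup>2 / (norm x)\<^sup>2) ^ 5"
proof -
  define H where "H v = v - (2 * (x \<bullet> v) / (norm x)\<^sup>2) *\<^sub>R x" for v
  have lin: "linear H"
    unfolding H_def by (rule linearI) (auto simp: inner_add_right algebra_simps add_divide_distrib)
  have xx: "x \<bullet> x \<noteq> 0" using assms by simp
  have "orthogonal_transformation H"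
    unfolding orthogonal_transformation_def
  proof (intro conjI lin allI)
    fix v w show "H v \<bullet> H w = v \<bullet> w"
      using xx by (simp add: H_def power2_norm_eq_inner inner_diff_left inner_diff_right inner_commute field_simps)
  qed
  then have "\<bar>det (matrix H)\<bar> = 1" by simp
  moreover have "matrix (\<lambda>v. (l\<^sup>2 / (norm x)\<^sup>2) *\<^sub>R H v) = matrix ((*\<^sub>R) (l\<^sup>2 / (norm x)\<^sup>2)) ** matrix H"
    using matrix_compose[OF lin linear_scale_self, of "l\<^sup>2 / (norm x)\<^sup>2"] by (simp add: o_def)
  ultimately show ?thesis by (simp add: H_def[symmetric] det_mul abs_mult)
qed

lemma inversion_image:
  assumes "l > 0"
  shows "inversion l ` {z. norm z > l} = ball 0 l - {0}"
proof -
  have flip: "norm (inversion l z) < l \<longleftrightarrow> norm z > l" if "z \<noteq> 0" for z :: 'a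
    using assms that by (simp add: norm_inversion field_simps power2_eq_square)
  show ?thesis
  proof (intro set_eqI iffI)
    fix y :: 'a assume "y \<in> inversion l ` {z. norm z > l}"
    then obtain z where z: "norm z > l" "y = inversion l z" by auto
    then have "z \<noteq> 0" using assms by auto
    then show "y \<in> ball 0 l - {0}" using flip[of z] z inversion_nonzero[OF assms] by auto
  next
    fix y :: 'a assume y: "y \<in> ball 0 l - {0}"
    then have "norm (inversion l y) > l"
      using flip[of "inversion l y"] inversion_inversion[OF assms, of y] inversion_nonzero[OF assms, of y] by auto
    then show "y \<in> inversion l ` {z. norm z > l}"
      using inversion_inversion[OF assms, of y] y by (metis DiffE image_eqI mem_Collect_eq singletonI)
  qed
qed

lemma integral_inversion:
  fixes h :: "real^5 \<Rightarrow> real"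
  assumes l: "l > 0" and h: "integrable lborel h"
  defines "k \<equiv> (\<lambda>z. indicator {z. norm z > l} z * ((l / norm z)^10 * h (inversion l z)))"
  shows "integrable lborel k" "(LBINT z. k z) = (LBINT y. indicator (ball 0 l) y * h y)"
proof -
  let ?S = "{z::real^5. norm z > l}"
  let ?D = "\<lambda>x v. (l\<^sup>2 / (norm x)\<^sup>2) *\<^sub>R (v - (2 * (x \<bullet> v) / (norm x)\<^sup>2) *\<^sub>R (x::real^5))"
  have [measurable]: "h \<in> borel_measurable borel" using h by auto
  have oS: "open ?S" by (intro open_Collect_less continuous_intros)
  have S [measurable]: "?S \<in> sets borel" using oS by simp
  have SL: "?S \<in> sets lebesgue" using S by simp
  have S0: "x \<noteq> 0" if "x \<in> ?S" for x using that l by auto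
  have [measurable]: "k \<in> borel_measurable borel" unfolding k_def by measurable
  have inj: "inj_on (inversion l) ?S"
    using S0 inversion_inversion[OF l] by (metis (no_types, lifting) inj_onI)
  let ?B = "ball 0 l - {0::real^5}"
  have B [measurable]: "?B \<in> sets borel" by simp
  have iB: "integrable lborel (\<lambda>y. indicator ?B y * h y)"
    using integrable_mult_indicator[of ?B lborel h] h B by simp
  then have ab: "h absolutely_integrable_on ?B"
    unfolding set_integrable_def by (subst integrable_completion) simp_all
  have ib: "integral ?B h = (LBINT y. indicator ?B y * h y)"
    using set_lebesgue_integral_eq_integral(2)[OF ab]
    by (simp add: set_lebesgue_integral_def integral_completion)
  \<comment> \<open>The change of variables theorem speaks about vector valued functions and
    Lebesgue measure, so \<open>h\<close> passes through \<open>real^1\<close>; Borel measurability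
    leads back to \<open>lborel\<close>.\<close>
  have "(\<lambda>x. \<bar>det (matrix (?D x))\<bar> *\<^sub>R vec (h (inversion l x)) :: real^1) absolutely_integrable_on ?S \<and>
      integral ?S (\<lambda>x. \<bar>det (matrix (?D x))\<bar> *\<^sub>R vec (h (inversion l x)) :: real^1) = vec (integral ?B h)"
    using has_absolute_integral_change_of_variables[OF SL _ inj, of ?D "\<lambda>x. vec (h x) :: real^1" "vec (integral ?B h)"]
      has_derivative_at_withinI[OF has_derivative_inversion[OF S0]] ab
    by (simp add: inversion_image[OF l] absolutely_integrable_on_1_iff integral_on_1_eq)
  then have cov: "(\<lambda>x. \<bar>det (matrix (?D x))\<bar> * h (inversion l x)) absolutely_integrable_on ?S"
      "integral ?S (\<lambda>x. \<bar>det (matrix (?D x))\<bar> * h (inversion l x)) = integral ?B h"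
    by (simp_all add: absolutely_integrable_on_1_iff integral_on_1_eq vec_eq_iff)
  have ke: "indicator ?S x *\<^sub>R (\<bar>det (matrix (?D x))\<bar> * h (inversion l x)) = k x" for x
  proof (cases "x \<in> ?S")
    case True
    have "(l\<^sup>2 / (norm x)\<^sup>2) ^ 5 = (l / norm x) ^ 10" by (simp add: power_divide flip: power_mult)
    then show ?thesis using abs_det_inversion[OF S0[OF True], of l] by (simp add: k_def)
  qed (simp add: k_def)
  show "integrable lborel k"
    using cov(1) unfolding set_integrable_def ke by (subst (asm) integrable_completion) simp_all
  have "(LBINT z. k z) = integral ?B h"
    using set_lebesgue_integral_eq_integral(2)[OF cov(1)] cov(2)
    unfolding set_lebesgue_integral_def ke by (simp add: integral_completion)
  also have "\<dots> = (LBINT y. indicator (ball 0 l) y * h y)"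
    unfolding ib
  proof (rule integral_cong_AE)
    have "AE y in lborel. y \<noteq> (0::real^5)" by (rule AE_lborel_singleton)
    then show "AE y in lborel. indicator ?B y * h y = indicator (ball 0 l) y * h y"
      by eventually_elim (simp add: indicator_def)
  qed (auto intro!: borel_measurable_times borel_measurable_indicator)
  finally show "(LBINT z. k z) = (LBINT y. indicator (ball 0 l) y * h y)" .
qed

subsection \<open>The method of moving spheres\<close>

lemma AE_norm_neq: "AE y in lborel. norm (y::'a::euclidean_space) \<noteq> l"
proof -
  have "sphere (0::'a) l \<in> null_sets lborel"
    using negligible_sphere[of "0::'a" l] by (simp add: negligible_iff_null_sets null_sets_completion_iff)
  from AE_not_in[OF this] show ?thesis by eventually_elim auto
qed

lemma AE_lborel_open_ex:
  fixes U :: "'a::euclidean_space set"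
  assumes "AE x in lborel. P x" "open U" "x \<in> U"
  shows "\<exists>y\<in>U. P y"
proof (rule ccontr)
  assume "\<not> ?thesis"
  then have *: "P y \<Longrightarrow> y \<notin> U" for y by blast
  obtain e where e: "e > 0" "ball x e \<subseteq> U" using assms(2,3) openE by blast
  have "AE y in lborel. y \<notin> ball x e" using assms(1) by eventually_elim (use * e in blast)
  then have "emeasure lborel (ball x e) = 0"
    using AE_iff_null_sets[of "ball x e" lborel] by (simp add: null_sets_def)
  then show False using e(1) unit_ball_vol_pos[of "real DIM('a)"] by (simp add: emeasure_ball)
qed

text \<open>The gradient \<open>g\<close> is a parameter so that translates can supply theirs; its
  continuity gives uniform control of radial derivatives near a sphere.\<close>

locale conformal_equation = integral_equation u 11 \<kappa> c 0 for u \<kappa> c +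
  fixes g :: "real^5 \<Rightarrow> real^5"
  assumes grad: "\<And>x. (u has_derivative (\<lambda>v. g x \<bullet> v)) (at x)" and cont_g: "continuous_on UNIV g"
begin

text \<open>The Kelvin transform of \<open>u\<close> in the sphere of radius \<open>l\<close> around the origin (with junk value 0 at the origin).\<close>

definition ul where "ul l x = norm x / l * u (inversion l x)"

definition fl where "fl l z = ul l z powr (-11)"

text \<open>The kernel |x - z| with z reflected into the ball and given the Kelvin weight |z| /
  l.\<close>

definition reflected_kernel where "reflected_kernel l x z = norm z / l * norm (x - inversion l z)"

text \<open>The exponent count behind q = 11: the Jacobian contributes the power -10 of |z| / l,
  expressing \<open>f\<close> at the reflected point through \<open>fl\<close> contributes 11, and
  the remaining factor is the weight of \<open>reflected_kernel\<close>.\<close>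

lemma f_inversion:
  assumes "l > 0" "z \<noteq> 0"
  shows "(l / norm z)^10 * f (inversion l z) = norm z / l * fl l z"
proof -
  define t where "t = norm z / l"
  have t: "t > 0" using assms by (simp add: t_def)
  have "fl l z = inverse (t^11) * f (inversion l z)"
    using t pos[of "inversion l z"] unfolding fl_def ul_def f_def t_def[symmetric]
    by (simp add: powr_mult powr_minus)
  moreover have "l / norm z = inverse t" by (simp add: t_def)
  ultimately show ?thesis unfolding t_def[symmetric] using t assms(1)
    by (simp add: power_inverse field_simps eval_nat_numeral)
qed

lemma measurable_ul [measurable]: "ul l \<in> borel_measurable borel"
  unfolding ul_def[abs_def] by measurable

lemma measurable_fl [measurable]: "fl l \<in> borel_measurable borel"
  unfolding fl_def[abs_def] by measurable

abbreviation outside :: "real \<Rightarrow> real^5 \<Rightarrow> real" where "outside l \<equiv> indicator {z. norm z > l}"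

text \<open>The part of the potential over the ball is folded outside by inversion, and the sphere
  itself is a null set.\<close>

lemma split_potential:
  assumes l: "l > 0"
  shows "integrable lborel (\<lambda>z. outside l z * (norm (x - z) * f z))"
    and "integrable lborel (\<lambda>z. outside l z * (reflected_kernel l x z * fl l z))"
    and "u x = c * ((LBINT z. outside l z * (norm (x - z) * f z)) + (LBINT z. outside l z * (reflected_kernel l x z * fl l z)))"
proof -
  let ?h = "\<lambda>y. norm (x - y) * f y"
  have ih: "integrable lborel ?h" by (rule integrable_dist_f)
  have S [measurable]: "{z::real^5. norm z > l} \<in> sets borel" by simp
  show i1: "integrable lborel (\<lambda>z. outside l z * ?h z)"
    using integrable_mult_indicator[of "{z. norm z > l}" lborel ?h] ih by simp
  have iB: "integrable lborel (\<lambda>z. indicator (ball 0 l) z * ?h z)"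
    using integrable_mult_indicator[of "ball 0 l" lborel ?h] ih by simp
  have k: "outside l z * ((l / norm z)^10 * ?h (inversion l z)) = outside l z * (reflected_kernel l x z * fl l z)" for z
  proof (cases "norm z > l")
    case True
    then have "z \<noteq> 0" using l by auto
    from f_inversion[OF l this] show ?thesis by (simp add: reflected_kernel_def mult.left_commute)
  qed simp
  note inv = integral_inversion[OF l ih, unfolded k]
  show "integrable lborel (\<lambda>z. outside l z * (reflected_kernel l x z * fl l z))" by (rule inv)
  have "(LBINT z. ?h z) = (LBINT z. outside l z * ?h z + indicator (ball 0 l) z * ?h z)"
  proof (rule integral_cong_AE)
    have "AE z in lborel. norm (z::real^5) \<noteq> l" by (rule AE_norm_neq)
    then show "AE z in lborel. ?h z = outside l z * ?h z + indicator (ball 0 l) z * ?h z"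
      by eventually_elim (auto simp: indicator_def)
  qed (auto intro!: borel_measurable_add borel_measurable_times borel_measurable_indicator)
  also have "\<dots> = (LBINT z. outside l z * ?h z) + (LBINT z. outside l z * (reflected_kernel l x z * fl l z))"
    using i1 iB inv by simp
  finally show "u x = c * ((LBINT z. outside l z * ?h z) + (LBINT z. outside l z * (reflected_kernel l x z * fl l z)))"
    using eq_f[of x] by simp
qed

text \<open>Passing from x to its reflection exchanges the two kernels of
  \<open>split_potential\<close> up to the factor |x| / l. The four exterior integrals then combine
  into a single one with a factored integrand.\<close>

lemma ul_minus_u:
  assumes l: "l > 0" and x: "x \<noteq> 0"
  shows "integrable lborel (\<lambda>z. outside l z * ((reflected_kernel l x z - norm (x - z)) * (f z - fl l z)))"
    and "ul l x - u x = c * (LBINT z. outside l z * ((reflected_kernel l x z - norm (x - z)) * (f z - fl l z)))"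
proof -
  let ?y = "inversion l x"
  have e1: "norm x / l * (outside l z * (norm (?y - z) * f z)) = outside l z * (reflected_kernel l x z * f z)" for z
  proof (cases "norm z > l")
    case True
    then have "z \<noteq> 0" using l by auto
    from inversion_distance_commute[OF l this x] True l show ?thesis
      by (auto simp: reflected_kernel_def)
  qed simp
  have e2: "norm x / l * (outside l z * (reflected_kernel l ?y z * fl l z)) = outside l z * (norm (x - z) * fl l z)" for z
  proof (cases "norm z > l")
    case True
    then have "z \<noteq> 0" using l by auto
    have "norm x / l * (reflected_kernel l ?y z * fl l z) = norm x / l * (norm z / l * norm (?y - inversion l z)) * fl l z"
      by (simp add: reflected_kernel_def)
    also have "\<dots> = norm (x - z) * fl l z" unfolding inversion_distance_both[OF l \<open>z \<noteq> 0\<close> x] ..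
    finally show ?thesis using True by simp
  qed simp
  note sx = split_potential[OF l, of x]
  note sy = split_potential[OF l, of ?y]
  have j1: "integrable lborel (\<lambda>z. outside l z * (reflected_kernel l x z * f z))"
    using integrable_mult_right[OF sy(1), of "norm x / l"] unfolding e1 .
  have j2: "integrable lborel (\<lambda>z. outside l z * (norm (x - z) * fl l z))"
    using integrable_mult_right[OF sy(2), of "norm x / l"] unfolding e2 .
  have ulx: "ul l x = c * ((LBINT z. outside l z * (reflected_kernel l x z * f z)) + (LBINT z. outside l z * (norm (x - z) * fl l z)))"
    unfolding ul_def sy(3) e1[symmetric] e2[symmetric] integral_mult_right_zero by (simp add: algebra_simps)
  have K: "outside l z * ((reflected_kernel l x z - norm (x - z)) * (f z - fl l z)) =
     (outside l z * (reflected_kernel l x z * f z) + outside l z * (norm (x - z) * fl l z))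
     - (outside l z * (norm (x - z) * f z) + outside l z * (reflected_kernel l x z * fl l z))" for z
    by (simp add: algebra_simps)
  show "integrable lborel (\<lambda>z. outside l z * ((reflected_kernel l x z - norm (x - z)) * (f z - fl l z)))"
    unfolding K by (intro Bochner_Integration.integrable_diff Bochner_Integration.integrable_add j1 j2 sx)
  show "ul l x - u x = c * (LBINT z. outside l z * ((reflected_kernel l x z - norm (x - z)) * (f z - fl l z)))"
    unfolding ulx sx(3) K using j1 j2 sx(1,2) by (simp add: right_diff_distrib)
qed

text \<open>The moving sphere condition. Since negative powers are decreasing, it makes
  \<open>f - fl\<close> nonnegative outside the ball, so \<open>ul_minus_u\<close> can improve
  it.\<close>

definition dominates where "dominates l \<longleftrightarrow> (\<forall>x. norm x \<ge> l \<longrightarrow> u x \<le> ul l x)"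

lemma ul_on_sphere: "l > 0 \<Longrightarrow> norm x = l \<Longrightarrow> ul l x = u x"
  by (simp add: ul_def inversion_def)

lemma continuous_on_ul: "l > 0 \<Longrightarrow> continuous_on {z. norm z > l} (ul l)"
  unfolding ul_def[abs_def] inversion_def
  by (intro continuous_intros continuous_on_compose2[OF cont]) auto

text \<open>Strong maximum principle and Hopf lemma in one: the lower bound vanishes only to first
  order on the sphere and grows linearly at infinity. The weight \<open>w\<close> is
  \<open>f - fl\<close> times the z-factor of \<open>inversion_kernel_lower_bound\<close>.\<close>

lemma dominates_gap:
  assumes l: "l > 0" and dom: "dominates l" and z0: "norm z0 > l" "ul l z0 \<noteq> u z0"
  obtains m where "m > 0" "\<And>x. norm x \<ge> l \<Longrightarrow> ul l x - u x \<ge> m * (norm x - l\<^sup>2 / norm x)"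
proof -
  define w where "w z = outside l z * ((((norm z)\<^sup>2 - l\<^sup>2) / (4 * l * norm z)) * (f z - fl l z))" for z
  define K where "K x z = outside l z * ((reflected_kernel l x z - norm (x - z)) * (f z - fl l z))" for x z
  have ffl: "f z - fl l z \<ge> 0" if "norm z > l" for z
    using dom that pos[of z] unfolding dominates_def f_def fl_def by (auto intro!: powr_mono2')
  have sqp: "(norm x)\<^sup>2 - l\<^sup>2 \<ge> 0" if "norm x \<ge> l" for x :: "real^5" using power_mono[OF that, of 2] l by simp
  have w0: "w z \<ge> 0" for z
    using ffl[of z] sqp[of z] l by (cases "norm z > l") (auto simp: w_def)
  have Kw: "(norm x)\<^sup>2 - l\<^sup>2 \<ge> 0" "((norm x)\<^sup>2 - l\<^sup>2) / norm x * w z \<le> K x z" if "norm x \<ge> l" for x z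
  proof -
    show "(norm x)\<^sup>2 - l\<^sup>2 \<ge> 0" using sqp[OF that] .
    show "((norm x)\<^sup>2 - l\<^sup>2) / norm x * w z \<le> K x z"
    proof (cases "norm z > l")
      case True
      from mult_right_mono[OF inversion_kernel_lower_bound[OF l that less_imp_le[OF True]] ffl[OF True]] True
      show ?thesis by (simp add: K_def w_def reflected_kernel_def mult.assoc)
    qed (simp add: K_def w_def)
  qed
  have z00: "z0 \<noteq> 0" using z0 l by auto
  define a where "a = ((norm z0)\<^sup>2 - l\<^sup>2) / norm z0"
  have a: "a > 0" using z0 l power_strict_mono[of l "norm z0" 2] by (auto simp: a_def intro!: divide_pos_pos)
  have wm [measurable]: "w \<in> borel_measurable borel" unfolding w_def[abs_def] by measurable
  \<comment> \<open>Integrability comes from the point z0 itself: there the product bound reads a *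
    w z <= K z0 z with a > 0, and \<open>K z0\<close> is integrable.\<close>
  have iw: "integrable lborel w"
  proof (rule Bochner_Integration.integrable_bound)
    show "integrable lborel (\<lambda>z. 1 / a * K z0 z)"
      unfolding K_def by (intro integrable_mult_right ul_minus_u(1) l z00)
    have "w z \<le> 1 / a * K z0 z" for z
      using Kw(2)[of z0 z] z0 a by (simp add: a_def[symmetric] field_simps)
    then show "AE z in lborel. norm (w z) \<le> norm (1 / a * K z0 z)"
      using w0 unfolding real_norm_def by (intro AE_I2) (metis abs_ge_self abs_of_nonneg order_trans)
  qed measurable
  have "(LBINT z. w z) \<noteq> 0"
  proof
    assume "(LBINT z. w z) = 0"
    then have ae: "AE z in lborel. w z = 0"
      using integral_nonneg_eq_0_iff_AE[OF iw] w0 by simp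
    \<comment> \<open>A vanishing integral would force w = 0 almost everywhere, but w is positive on
      this open set, which contains z0.\<close>
    let ?U = "{z. norm z > l} \<inter> (\<lambda>z. ul l z - u z) -` {0<..}"
    have oS: "open {z::real^5. norm z > l}" by (intro open_Collect_less continuous_intros)
    have "open ?U"
      by (rule continuous_open_preimage[OF _ oS])
         (auto intro!: continuous_intros continuous_on_ul l continuous_on_subset[OF cont])
    moreover have "z0 \<in> ?U" using z0 dom by (auto simp: dominates_def less_le)
    ultimately obtain y where y: "y \<in> ?U" "w y = 0" using AE_lborel_open_ex[OF ae] by blast
    then have "fl l y < f y"
      unfolding f_def fl_def using pos[of y] by (auto intro!: powr_less_mono2_neg)
    moreover have "(norm y)\<^sup>2 - l\<^sup>2 > 0" using y(1) l power_strict_mono[of l "norm y" 2] by simp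
    moreover have "4 * l * norm y > 0" using y(1) l by (intro mult_pos_pos) auto
    ultimately have "w y > 0" using y(1) by (simp add: w_def)
    then show False using y(2) by simp
  qed
  moreover have "(LBINT z. w z) \<ge> 0" using w0 by simp
  ultimately have W: "(LBINT z. w z) > 0" by simp
  show ?thesis
  proof (rule that[of "c * (LBINT z. w z)"])
    show "c * (LBINT z. w z) > 0" using W c by simp
    fix x :: "real^5" assume x: "norm x \<ge> l"
    then have x0: "x \<noteq> 0" using l by auto
    have "(LBINT z. ((norm x)\<^sup>2 - l\<^sup>2) / norm x * w z) \<le> (LBINT z. K x z)"
    proof (rule integral_mono)
      show "integrable lborel (K x)" unfolding K_def by (rule ul_minus_u(1)[OF l x0])
    qed (use iw Kw x in auto)
    then have "c * (((norm x)\<^sup>2 - l\<^sup>2) / norm x * (LBINT z. w z)) \<le> ul l x - u x"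
      unfolding ul_minus_u(2)[OF l x0] K_def integral_mult_right_zero using c by (intro mult_left_mono) auto
    moreover have "((norm x)\<^sup>2 - l\<^sup>2) / norm x = norm x - l\<^sup>2 / norm x"
      using x0 by (simp add: diff_divide_distrib power2_eq_square)
    ultimately show "c * (LBINT z. w z) * (norm x - l\<^sup>2 / norm x) \<le> ul l x - u x"
      by (simp add: mult_ac)
  qed
qed

text \<open>A Lipschitz argument: the bound on l keeps \<open>u\<close> at the reflected point above
  2 slope l, which pays for moving back to x.\<close>

lemma dominates_small:
  assumes l: "l > 0" "l \<le> u 0 / (3 * slope)"
  shows "dominates l"
  unfolding dominates_def
proof (intro allI impI)
  fix x :: "real^5" assume x: "norm x \<ge> l"
  define r where "r = norm x"
  have r: "r \<ge> l" "r > 0" using x l by (auto simp: r_def)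
  let ?y = "inversion l x"
  have ny: "norm ?y = l\<^sup>2 / r" using norm_inversion[OF l(1), of x] by (simp add: r_def)
  have s: "l\<^sup>2 / r \<le> l" using r l by (simp add: field_simps power2_eq_square)
  have "u 0 - u ?y \<le> slope * (l\<^sup>2 / r)" using lipschitz[of 0 ?y] ny by simp
  also have "\<dots> \<le> slope * l" using s slope_pos by (intro mult_left_mono) auto
  finally have "u ?y \<ge> 2 * (slope * l)" using l(2) slope_pos by (simp add: field_simps)
  moreover have "slope * (l + l\<^sup>2 / r) \<le> 2 * (slope * l)" using mult_left_mono[OF s, of slope] slope_pos by (simp add: algebra_simps)
  ultimately have uy: "slope * (l + l\<^sup>2 / r) \<le> u ?y" by linarith
  have "x - ?y = (1 - l\<^sup>2 / r\<^sup>2) *\<^sub>R x" by (simp add: inversion_def r_def algebra_simps)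
  moreover have "l\<^sup>2 / r\<^sup>2 \<le> 1" using r l power_mono[of l r 2] by simp
  ultimately have "norm (x - ?y) = (1 - l\<^sup>2 / r\<^sup>2) * r" by (simp add: r_def)
  \<comment> \<open>Factoring r - l^2 / r in this way makes the Lipschitz loss proportional to the
    gain r / l - 1 of the Kelvin weight.\<close>
  also have "\<dots> = (r / l - 1) * (l + l\<^sup>2 / r)" using r l by (simp add: field_simps power2_eq_square)
  finally have nd: "norm (x - ?y) = (r / l - 1) * (l + l\<^sup>2 / r)" .
  have "u x - u ?y \<le> slope * norm (x - ?y)" using lipschitz[of x ?y] by simp
  also have "\<dots> = (r / l - 1) * (slope * (l + l\<^sup>2 / r))" by (simp add: nd)
  also have "\<dots> \<le> (r / l - 1) * u ?y" using uy r l by (intro mult_left_mono) auto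
  finally have "u x \<le> r / l * u ?y" by (simp add: algebra_simps)
  then show "u x \<le> ul l x" by (simp add: ul_def r_def)
qed

end

context conformal_equation
begin

section \<open>Comparison at infinity and the critical radius\<close>

lemma tendsto_ul_ray:
  assumes l: "l > 0" and e: "norm e = 1"
  shows "(\<lambda>n. ul l ((real n + 1) *\<^sub>R e) / (real n + 1)) \<longlonglongrightarrow> u 0 / l"
proof -
  have "(\<lambda>n. (l\<^sup>2 * (1 / (real n + 1))) *\<^sub>R e) \<longlonglongrightarrow> (l\<^sup>2 * 0) *\<^sub>R e"
    by (intro tendsto_intros tendsto_inverse_Suc)
  then have "(\<lambda>n. u ((l\<^sup>2 * (1 / (real n + 1))) *\<^sub>R e) / l) \<longlonglongrightarrow> u 0 / l"
    using cont l by (intro tendsto_divide tendsto_const) (auto simp: continuous_on_eq_continuous_at intro: isCont_tendsto_compose)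
  moreover have "ul l ((real n + 1) *\<^sub>R e) / (real n + 1) = u ((l\<^sup>2 * (1 / (real n + 1))) *\<^sub>R e) / l" for n
  proof -
    define N where "N = real n + 1"
    have N: "N > 0" by (simp add: N_def)
    have "inversion l (N *\<^sub>R e) = (l\<^sup>2 * (1 / N)) *\<^sub>R e"
      using N e by (simp add: inversion_def power2_eq_square)
    then have "ul l (N *\<^sub>R e) / N = u ((l\<^sup>2 * (1 / N)) *\<^sub>R e) / l"
      using N e by (simp add: ul_def)
    then show ?thesis by (simp add: N_def)
  qed
  ultimately show ?thesis by simp
qed

lemma eventually_ray_outside:
  assumes "norm e = 1"
  shows "\<forall>\<^sub>F n in sequentially. norm ((real n + 1) *\<^sub>R e :: real^5) \<ge> l"
proof -
  have "\<forall>\<^sub>F n in sequentially. real n + 1 \<ge> l"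
    using filterlim_real_add_1 unfolding filterlim_at_top by blast
  then show ?thesis by eventually_elim (use assms in simp)
qed

text \<open>Along a ray the Kelvin transform grows at rate u 0 / l, so comparing growth rates bounds
  the admissible radii from above.\<close>

lemma dominates_bound:
  assumes l: "l > 0" and dom: "dominates l"
  shows "slope \<le> u 0 / l"
proof (rule tendsto_le[OF sequentially_bot tendsto_ul_ray[OF l] tendsto_ray])
  show e: "norm (axis 1 1 :: real^5) = 1" by simp
  then show "norm (axis 1 1 :: real^5) = 1" .
  show "\<forall>\<^sub>F n in sequentially. u ((real n + 1) *\<^sub>R axis 1 1) / (real n + 1) \<le> ul l ((real n + 1) *\<^sub>R axis 1 1) / (real n + 1)"
    using eventually_ray_outside[OF e, of l]
    by eventually_elim (use dom in \<open>auto simp: dominates_def intro!: divide_right_mono\<close>)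
qed

lemma ul_eq_radius:
  assumes l: "l > 0" and eq: "\<And>x. norm x \<ge> l \<Longrightarrow> ul l x = u x"
  shows "slope = u 0 / l"
proof (rule LIMSEQ_unique[OF tendsto_ray Lim_transform_eventually[OF tendsto_ul_ray[OF l]]])
  show e: "norm (axis 1 1 :: real^5) = 1" by simp
  then show "norm (axis 1 1 :: real^5) = 1" .
  show "\<forall>\<^sub>F n in sequentially. ul l ((real n + 1) *\<^sub>R axis 1 1) / (real n + 1) = u ((real n + 1) *\<^sub>R axis 1 1) / (real n + 1)"
    using eventually_ray_outside[OF e, of l] by eventually_elim (simp add: eq)
qed

text \<open>The cost of changing the radius grows at most linearly in |x|, as the gap of
  \<open>dominates_gap\<close> does; hence a small increase can be absorbed far out.\<close>

lemma ul_radius_lipschitz: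
  assumes L: "L > 0"
  obtains C where "C > 0" "\<And>l x. L \<le> l \<Longrightarrow> l \<le> L + 1 \<Longrightarrow> norm x \<ge> l \<Longrightarrow> ul L x - ul l x \<le> norm x * (C * (l - L))"
proof -
  define M where "M = u 0 + slope * (L + 1)"
  have M: "M > 0" using pos[of 0] slope_pos L by (simp add: M_def add_pos_pos)
  define C where "C = M / L\<^sup>2 + slope * (2 * L + 1) / L\<^sup>2"
  have C: "C > 0" using M L slope_pos by (simp add: C_def add_pos_pos)
  show ?thesis
  proof (rule that[OF C])
    fix l and x :: "real^5" assume l: "L \<le> l" "l \<le> L + 1" and x: "norm x \<ge> l"
    define r where "r = norm x"
    have r: "r > 0" "r \<ge> l" "r \<ge> L" using x l L by (auto simp: r_def)
    have l0: "l > 0" using l L by simp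
    let ?y = "inversion l x" and ?Y = "inversion L x"
    have "norm ?y = l\<^sup>2 / r" using norm_inversion[OF l0, of x] by (simp add: r_def)
    also have "\<dots> \<le> l" using r l0 by (simp add: field_simps power2_eq_square)
    also have "\<dots> \<le> L + 1" by fact
    finally have ny: "norm ?y \<le> L + 1" .
    have "u ?y - u 0 \<le> slope * norm ?y" using lipschitz[of ?y 0] by simp
    also have "\<dots> \<le> slope * (L + 1)" using ny slope_pos by (intro mult_left_mono) auto
    finally have uy: "u ?y \<le> M" by (simp add: M_def)
    have "?Y - ?y = ((L\<^sup>2 - l\<^sup>2) / r\<^sup>2) *\<^sub>R x" by (simp add: inversion_def r_def scaleR_diff_left[symmetric] diff_divide_distrib)
    then have "norm (?Y - ?y) = \<bar>L\<^sup>2 - l\<^sup>2\<bar> / r\<^sup>2 * r" by (simp add: r_def)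
    also have "\<dots> = (l - L) * (l + L) / r"
      using l L r power_mono[of L l 2] by (simp add: power2_eq_square[of r]) (simp add: power2_eq_square algebra_simps)
    also have "\<dots> \<le> (l - L) * (2 * L + 1) / L"
      using l L r by (intro frac_le mult_left_mono mult_nonneg_nonneg) auto
    finally have nY: "norm (?Y - ?y) \<le> (l - L) * (2 * L + 1) / L" .
    have "u ?Y - u ?y \<le> slope * norm (?Y - ?y)" using lipschitz[of ?Y ?y] by simp
    also have "\<dots> \<le> slope * ((l - L) * (2 * L + 1) / L)" using nY slope_pos by (intro mult_left_mono) auto
    finally have d1: "(u ?Y - u ?y) / L \<le> slope * ((l - L) * (2 * L + 1) / L) / L"
      using L by (intro divide_right_mono) auto
    have "1 / L - 1 / l = (l - L) / (L * l)" using L l0 by (simp add: field_simps)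
    also have "\<dots> \<le> (l - L) / (L * L)" using L l by (intro divide_left_mono mult_left_mono mult_pos_pos) auto
    finally have "1 / L - 1 / l \<le> (l - L) / L\<^sup>2" by (simp add: power2_eq_square)
    moreover have "1 / L - 1 / l \<ge> 0" using L l l0 by (simp add: field_simps)
    ultimately have d2: "u ?y * (1 / L - 1 / l) \<le> M * ((l - L) / L\<^sup>2)"
      using uy pos[of ?y] M by (intro mult_mono) auto
    have "ul L x - ul l x = r * ((u ?Y - u ?y) / L + u ?y * (1 / L - 1 / l))"
      using L l0 by (simp add: ul_def r_def field_simps)
    also have "\<dots> \<le> r * (slope * ((l - L) * (2 * L + 1) / L) / L + M * ((l - L) / L\<^sup>2))"
      using d1 d2 r by (intro mult_left_mono add_mono) auto
    also have "slope * ((l - L) * (2 * L + 1) / L) / L + M * ((l - L) / L\<^sup>2) = C * (l - L)"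
      using L by (simp add: C_def field_simps power2_eq_square)
    finally show "ul L x - ul l x \<le> norm x * (C * (l - L))" by (simp add: r_def)
  qed
qed

text \<open>The t-derivative of \<open>ul l - u\<close> along the ray t e for a unit vector e,
  written through \<open>u\<close> and \<open>g\<close> so that it is visibly continuous in (l, t,
  e).\<close>

definition radial_gap_deriv where
  "radial_gap_deriv l t e = u ((l\<^sup>2 / t) *\<^sub>R e) / l - l / t * (g ((l\<^sup>2 / t) *\<^sub>R e) \<bullet> e) - g (t *\<^sub>R e) \<bullet> e"

lemma has_derivative_along:
  assumes "(p has_real_derivative p') (at t)"
  shows "((\<lambda>t. u (p t *\<^sub>R e)) has_real_derivative p' * (g (p t *\<^sub>R e) \<bullet> e)) (at t)"
proof -
  have "((\<lambda>t. p t *\<^sub>R e) has_derivative (\<lambda>h. (p' * h) *\<^sub>R e)) (at t)"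
    using assms unfolding has_field_derivative_def by (auto intro!: derivative_eq_intros)
  from has_derivative_compose[OF this grad] show ?thesis
    by (rule has_derivative_imp_has_field_derivative) simp
qed

lemma radial_gap_has_derivative:
  assumes "l > 0" "t > 0"
  shows "((\<lambda>t. t / l * u ((l\<^sup>2 / t) *\<^sub>R e) - u (t *\<^sub>R e)) has_real_derivative radial_gap_deriv l t e) (at t)"
proof -
  have p: "((\<lambda>t. l\<^sup>2 / t) has_real_derivative - (l\<^sup>2 / t\<^sup>2)) (at t)"
    using assms by (auto intro!: derivative_eq_intros simp: power2_eq_square)
  have 1: "((\<lambda>t. u (t *\<^sub>R e)) has_real_derivative 1 * (g (t *\<^sub>R e) \<bullet> e)) (at t)"
    by (rule has_derivative_along) (auto intro!: derivative_eq_intros)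
  have 2: "((\<lambda>t. t / l) has_real_derivative 1 / l) (at t)"
    using assms by (auto intro!: derivative_eq_intros)
  show ?thesis
    by (rule DERIV_cong[OF DERIV_diff[OF DERIV_mult[OF 2 has_derivative_along[OF p, of e]] 1]])
       (use assms in \<open>simp add: radial_gap_deriv_def field_simps power2_eq_square\<close>)
qed

lemma ul_ray: "l > 0 \<Longrightarrow> t > 0 \<Longrightarrow> norm e = 1 \<Longrightarrow> ul l (t *\<^sub>R e) = t / l * u ((l\<^sup>2 / t) *\<^sub>R e)"
  by (simp add: ul_def inversion_def power2_eq_square)

text \<open>At t = L both the gap and t - L^2 / t vanish, and the latter has derivative 2; a
  derivative of the gap below 2 m would violate the gap bound just outside the sphere.\<close>

lemma radial_gap_deriv_lower_bound:
  assumes L: "L > 0" and e: "norm e = 1"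
    and gap: "\<And>x. norm x \<ge> L \<Longrightarrow> ul L x - u x \<ge> m * (norm x - L\<^sup>2 / norm x)"
  shows "radial_gap_deriv L L e \<ge> 2 * m"
proof (rule ccontr)
  assume neg: "\<not> ?thesis"
  define \<psi> where "\<psi> t = (t / L * u ((L\<^sup>2 / t) *\<^sub>R e) - u (t *\<^sub>R e)) - m * (t - L\<^sup>2 / t)" for t
  have "((\<lambda>t. m * (t - L\<^sup>2 / t)) has_real_derivative 2 * m) (at L)"
    using L by (auto intro!: derivative_eq_intros simp: power2_eq_square)
  from DERIV_diff[OF radial_gap_has_derivative[OF L L, of e] this]
  have "(\<psi> has_real_derivative radial_gap_deriv L L e - 2 * m) (at L)" unfolding \<psi>_def[abs_def] .
  from DERIV_neg_dec_right[OF this] neg obtain d where d: "d > 0" "\<And>h. h > 0 \<Longrightarrow> h < d \<Longrightarrow> \<psi> (L + h) < \<psi> L"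
    by auto
  have "\<psi> L = 0" using L by (simp add: \<psi>_def power2_eq_square)
  moreover have "\<psi> (L + d / 2) \<ge> 0"
    using gap[of "(L + d / 2) *\<^sub>R e"] ul_ray[OF L, of "L + d / 2" e] e d(1) L by (simp add: \<psi>_def)
  ultimately show False using d(2)[of "d / 2"] d(1) by simp
qed

text \<open>Uniform continuity on a compact set of triples (l, t, e) makes d independent of the
  direction.\<close>

lemma radial_gap_deriv_uniform:
  assumes L: "L > 0" and m: "m > 0"
  obtains d where "d > 0" "d \<le> 1" "\<And>l t e. L \<le> l \<Longrightarrow> l \<le> L + d \<Longrightarrow> L \<le> t \<Longrightarrow> t \<le> L + d \<Longrightarrow> norm e = 1 \<Longrightarrow>
    \<bar>radial_gap_deriv l t e - radial_gap_deriv L L e\<bar> < m"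
proof -
  let ?K = "{L..L+1} \<times> {L..L+1} \<times> sphere (0::real^5) 1"
  let ?F = "\<lambda>p. radial_gap_deriv (fst p) (fst (snd p)) (snd (snd p))"
  have nz: "fst (snd p) \<noteq> 0" "fst p \<noteq> 0" if "p \<in> ?K" for p using that L by auto
  have "continuous_on ?K ?F"
    unfolding radial_gap_deriv_def
    by (intro continuous_intros continuous_on_compose2[OF cont] continuous_on_compose2[OF cont_g] ballI nz) (auto simp: nz)
  moreover have "compact ?K" by (intro compact_Times) auto
  ultimately have "uniformly_continuous_on ?K ?F" by (rule compact_uniformly_continuous)
  then obtain d where d: "d > 0" "\<And>p p'. p \<in> ?K \<Longrightarrow> p' \<in> ?K \<Longrightarrow> dist p' p < d \<Longrightarrow> dist (?F p') (?F p) < m"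
    using m unfolding uniformly_continuous_on_def by meson
  define d' where "d' = min 1 (d / 4)"
  have d': "d' > 0" "d' \<le> 1" "d' \<le> d / 4" using d(1) by (auto simp: d'_def)
  show ?thesis
  proof (rule that[OF d'(1,2)])
    fix l t and e :: "real^5" assume a: "L \<le> l" "l \<le> L + d'" "L \<le> t" "t \<le> L + d'" "norm e = 1"
    have "dist (l, t, e) (L, L, e) \<le> \<bar>l - L\<bar> + \<bar>t - L\<bar>"
      unfolding dist_Pair_Pair using sqrt_sum_squares_le_sum_abs[of "l - L" "t - L"] by (simp add: dist_real_def)
    also have "\<dots> < d" using a d' d(1) by simp
    finally show "\<bar>radial_gap_deriv l t e - radial_gap_deriv L L e\<bar> < m"
      using d(2)[of "(L, L, e)" "(l, t, e)"] a d' by (simp add: dist_real_def)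
  qed
qed

text \<open>Near the sphere the gap itself is too small to absorb a change of radius, so there the
  radial derivative is controlled instead; beyond L + d the linear gap beats the loss in
  \<open>ul_radius_lipschitz\<close>.\<close>

lemma dominates_extend:
  assumes L: "L > 0" and dom: "dominates L" and z0: "norm z0 > L" "ul L z0 \<noteq> u z0"
  obtains \<epsilon> where "\<epsilon> > 0" "\<And>l. L \<le> l \<Longrightarrow> l \<le> L + \<epsilon> \<Longrightarrow> dominates l"
proof -
  obtain m where m: "m > 0" and gap: "\<And>x. norm x \<ge> L \<Longrightarrow> ul L x - u x \<ge> m * (norm x - L\<^sup>2 / norm x)"
    using dominates_gap[OF L dom z0] by blast
  obtain C where C: "C > 0" "\<And>l x. L \<le> l \<Longrightarrow> l \<le> L + 1 \<Longrightarrow> norm x \<ge> l \<Longrightarrow> ul L x - ul l x \<le> norm x * (C * (l - L))"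
    using ul_radius_lipschitz[OF L] by blast
  obtain d where d: "d > 0" "d \<le> 1" "\<And>l t e. L \<le> l \<Longrightarrow> l \<le> L + d \<Longrightarrow> L \<le> t \<Longrightarrow> t \<le> L + d \<Longrightarrow> norm e = 1 \<Longrightarrow>
    \<bar>radial_gap_deriv l t e - radial_gap_deriv L L e\<bar> < m"
    using radial_gap_deriv_uniform[OF L m] by blast
  \<comment> \<open>For |x| >= L + d the gap is at least m \<eta> |x|; the choice of \<epsilon>
    keeps C (l - L) at most m \<eta>.\<close>
  define \<eta> where "\<eta> = 1 - L\<^sup>2 / (L + d)\<^sup>2"
  have \<eta>: "\<eta> > 0" using L d(1) power_strict_mono[of L "L + d" 2] by (simp add: \<eta>_def)
  define \<epsilon> where "\<epsilon> = min d (m * \<eta> / C)"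
  have \<epsilon>: "\<epsilon> > 0" "\<epsilon> \<le> d" "\<epsilon> \<le> m * \<eta> / C" using d m \<eta> C by (auto simp: \<epsilon>_def)
  show ?thesis
  proof (rule that[OF \<epsilon>(1)])
    fix l assume l: "L \<le> l" "l \<le> L + \<epsilon>"
    have l0: "l > 0" using l L by simp
    show "dominates l"
      unfolding dominates_def
    proof (intro allI impI)
      fix x :: "real^5" assume x: "norm x \<ge> l"
      define r where "r = norm x"
      have r: "r \<ge> l" "r > 0" "r \<ge> L" using x l L by (auto simp: r_def)
      show "u x \<le> ul l x"
      proof (cases "r \<ge> L + d")
        case True
        have "L\<^sup>2 / r\<^sup>2 \<le> L\<^sup>2 / (L + d)\<^sup>2"
          using True L d(1) by (intro divide_left_mono power_mono mult_pos_pos) auto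
        then have "\<eta> \<le> 1 - L\<^sup>2 / r\<^sup>2" by (simp add: \<eta>_def)
        then have "r * (m * \<eta>) \<le> r * (m * (1 - L\<^sup>2 / r\<^sup>2))" using r m by (intro mult_left_mono) auto
        also have "\<dots> = m * (r - L\<^sup>2 / r)" using r by (simp add: field_simps power2_eq_square)
        also have "\<dots> \<le> ul L x - u x" using gap[of x] r by (simp add: r_def)
        finally have 1: "r * (m * \<eta>) \<le> ul L x - u x" .
        have "C * (l - L) \<le> C * (m * \<eta> / C)" using l \<epsilon> C by (intro mult_left_mono) auto
        also have "\<dots> = m * \<eta>" using C by simp
        finally have "r * (C * (l - L)) \<le> r * (m * \<eta>)" using r by (intro mult_left_mono) auto
        moreover have "ul L x - ul l x \<le> r * (C * (l - L))"
          unfolding r_def using l \<epsilon> d x by (intro C(2)) auto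
        ultimately show ?thesis using 1 by linarith
      next
        case False
        define e where "e = (1 / r) *\<^sub>R x"
        have e: "norm e = 1" "x = r *\<^sub>R e" using r by (auto simp: e_def r_def)
        let ?\<phi> = "\<lambda>t. t / l * u ((l\<^sup>2 / t) *\<^sub>R e) - u (t *\<^sub>R e)"
        \<comment> \<open>The gap for radius l vanishes on its own sphere and is nondecreasing along
          the ray, since its derivative stays above 2 m - m.\<close>
        have "?\<phi> l \<le> ?\<phi> r"
        proof (rule DERIV_nonneg_imp_nondecreasing[OF r(1)])
          fix t assume t: "l \<le> t" "t \<le> r"
          have "\<bar>radial_gap_deriv l t e - radial_gap_deriv L L e\<bar> < m"
            using t l \<epsilon> False e by (intro d(3)) auto
          moreover have "radial_gap_deriv L L e \<ge> 2 * m" by (rule radial_gap_deriv_lower_bound[OF L e(1) gap])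
          ultimately have "radial_gap_deriv l t e \<ge> 0" using m by linarith
          then show "\<exists>y. (?\<phi> has_real_derivative y) (at t) \<and> 0 \<le> y"
            using radial_gap_has_derivative[OF l0, of t e] t l0 by auto
        qed
        moreover have "?\<phi> l = 0" using l0 by (simp add: power2_eq_square)
        ultimately show ?thesis using ul_ray[OF l0 r(2) e(1)] e(2) by simp
      qed
    qed
  qed
qed

lemma dominates_closed:
  assumes L: "L > 0" and dom: "\<And>l. 0 < l \<Longrightarrow> l < L \<Longrightarrow> dominates l"
  shows "dominates L"
  unfolding dominates_def
proof (intro allI impI)
  fix x :: "real^5" assume x: "norm x \<ge> L"
  have "((\<lambda>l. ul l x) \<longlongrightarrow> ul L x) (at_left L)"
    unfolding ul_def inversion_def using L x cont
    by (intro tendsto_intros isCont_tendsto_compose[of _ u]) (auto simp: continuous_on_eq_continuous_at)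
  moreover have "\<forall>\<^sub>F l in at_left L. u x \<le> ul l x"
    using eventually_at_left_real[OF L]
  proof eventually_elim
    case (elim l)
    then show ?case using dom[of l] x by (auto simp: dominates_def)
  qed
  ultimately show "u x \<le> ul L x" by (intro tendsto_lowerbound[of _ _ "at_left L"]) auto
qed

text \<open>At the supremum L of the radii up to which domination holds, a strict gap at one point
  would let \<open>dominates_extend\<close> go further. So equality holds outside, and comparing
  growth rates identifies L.\<close>

lemma reflection_symmetry:
  assumes x: "x \<noteq> 0"
  shows "ul (u 0 / slope) x = u x"
proof -
  define A where "A = {b. b > 0 \<and> (\<forall>l. 0 < l \<longrightarrow> l \<le> b \<longrightarrow> dominates l)}"
  have "u 0 / (3 * slope) \<in> A" using dominates_small pos[of 0] slope_pos by (auto simp: A_def)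
  then have ne: "A \<noteq> {}" by auto
  have ub: "b \<le> u 0 / slope" if "b \<in> A" for b
    using dominates_bound[of b] that slope_pos by (auto simp: A_def field_simps)
  have bdd: "bdd_above A" using ub by (rule bdd_aboveI)
  define L where "L = Sup A"
  have L0: "L > 0" using ne bdd cSup_upper[OF _ bdd] unfolding L_def A_def by (metis (no_types, lifting) ex_in_conv less_le_trans mem_Collect_eq)
  have below: "dominates l" if "0 < l" "l < L" for l
  proof -
    obtain b where "b \<in> A" "l < b" using \<open>l < L\<close> less_cSup_iff[OF ne bdd] unfolding L_def by blast
    then show ?thesis using that(1) by (auto simp: A_def)
  qed
  have domL: "dominates L" by (rule dominates_closed[OF L0 below])
  have eqL: "ul L z = u z" if z: "norm z \<ge> L" for z
  proof (rule ccontr)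
    assume neq: "ul L z \<noteq> u z"
    then have "norm z \<noteq> L" using ul_on_sphere[OF L0, of z] by auto
    with z have "norm z > L" by simp
    from dominates_extend[OF L0 domL this neq] obtain \<epsilon> where \<epsilon>: "\<epsilon> > 0" "\<And>l. L \<le> l \<Longrightarrow> l \<le> L + \<epsilon> \<Longrightarrow> dominates l"
      by blast
    have "L + \<epsilon> \<in> A" using L0 \<epsilon> below unfolding A_def by (auto simp: not_le) (meson le_cases not_le)
    then have "L + \<epsilon> \<le> L" unfolding L_def using bdd by (intro cSup_upper)
    then show False using \<epsilon>(1) by simp
  qed
  have L: "L = u 0 / slope" using ul_eq_radius[OF L0 eqL] L0 slope_pos by (simp add: field_simps)
  \<comment> \<open>Points inside the sphere are reached by inverting once more.\<close>
  have "ul L x = u x"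
  proof (cases "norm x \<ge> L")
    case False
    have nx: "norm (inversion L x) = L\<^sup>2 / norm x" using norm_inversion[OF L0] .
    have "norm (inversion L x) \<ge> L" unfolding nx using False L0 x by (simp add: field_simps power2_eq_square)
    from eqL[OF this] have "L\<^sup>2 / norm x / L * u x = u (inversion L x)"
      unfolding ul_def inversion_inversion[OF L0 x] nx .
    then have "u (inversion L x) = L / norm x * u x" using L0 by (simp add: power2_eq_square)
    then show ?thesis using L0 x by (simp add: ul_def)
  qed (rule eqL)
  then show ?thesis by (simp add: L)
qed

end

subsection \<open>Classification\<close>

context conformal_equation
begin

text \<open>The lower bound constant shrinks by the factor 1 + |a| because 1 + |x| <= (1 + |a + x|)
  (1 + |a|).\<close>

lemma translate: "conformal_equation (\<lambda>x. u (a + x)) (\<kappa> / (1 + norm a)) c (\<lambda>x. g (a + x))"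
proof
  show "(11::real) > 6" "c > 0" "\<kappa> / (1 + norm a) > 0" using c \<kappa> by (auto simp: add_pos_nonneg)
  show "u (a + x) \<ge> \<kappa> / (1 + norm a) * (1 + norm x)" for x
  proof -
    have "norm x \<le> norm (a + x) + norm a" using norm_triangle_ineq4[of "a + x" a] by simp
    moreover have "(1 + norm (a + x)) * (1 + norm a) = 1 + norm (a + x) + norm a + norm (a + x) * norm a"
      by (simp add: algebra_simps)
    ultimately have "1 + norm x \<le> (1 + norm (a + x)) * (1 + norm a)"
      using mult_nonneg_nonneg[OF norm_ge_zero[of "a + x"] norm_ge_zero[of a]] by linarith
    then have "(1 + norm x) / (1 + norm a) \<le> 1 + norm (a + x)"
      by (subst pos_divide_le_eq) (auto simp: add_pos_nonneg)
    from mult_left_mono[OF this, of \<kappa>] \<kappa> have "\<kappa> / (1 + norm a) * (1 + norm x) \<le> \<kappa> * (1 + norm (a + x))" by simp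
    also have "\<dots> \<le> u (a + x)" by (rule lower)
    finally show ?thesis .
  qed
  have sh: "((\<lambda>x. a + x) has_derivative (\<lambda>v. v)) (at x)" for x :: "real^5"
    by (auto intro!: derivative_eq_intros)
  show D: "((\<lambda>x. u (a + x)) has_derivative (\<lambda>v. g (a + x) \<bullet> v)) (at x)" for x
    by (rule has_derivative_compose[OF sh grad])
  show "(\<lambda>x. u (a + x)) differentiable at x" for x using D differentiable_def by blast
  show "continuous_on UNIV (\<lambda>x. g (a + x))"
    by (rule continuous_on_compose2[OF cont_g]) (auto intro!: continuous_intros)
  show "u (a + x) = c * (LBINT y. norm (x - y) * u (a + y) powr - 11) + 0" for x
    using eq[of "a + x"] integral_lborel_translate[of "\<lambda>y. norm (a + x - y) * u y powr - 11" a] by simp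
qed

lemma reflection_symmetry_at:
  assumes x: "x \<noteq> 0"
  shows "u (a + x) = norm x / (u a / slope) * u (a + inversion (u a / slope) x)"
proof -
  interpret T: conformal_equation "\<lambda>x. u (a + x)" "\<kappa> / (1 + norm a)" c "\<lambda>x. g (a + x)" by (rule translate)
  \<comment> \<open>The growth rate is translation invariant, so the critical radius at every centre
    a is u a divided by one and the same number.\<close>
  have "T.slope = slope"
    unfolding T.slope_def slope_def T.f_def f_def
    using integral_lborel_translate[of "\<lambda>y. u y powr - 11" a] by simp
  then show ?thesis using T.reflection_symmetry[OF x] by (simp add: T.ul_def)
qed

lemma tendsto_norm_ray:
  fixes e x :: "real^5"
  assumes e: "norm e = 1"
  shows "(\<lambda>n. norm ((real n + 1) *\<^sub>R e - x) / (real n + 1)) \<longlonglongrightarrow> 1"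
    and "(\<lambda>n. norm ((real n + 1) *\<^sub>R e - x) - (real n + 1)) \<longlonglongrightarrow> - (e \<bullet> x)"
    and "(\<lambda>n. sgn ((real n + 1) *\<^sub>R e - x)) \<longlonglongrightarrow> e"
proof -
  define N where "N n = real n + 1" for n
  have N: "N n \<ge> 1" for n by (simp add: N_def)
  have inv: "(\<lambda>n. 1 / N n) \<longlonglongrightarrow> 0" using tendsto_inverse_Suc by (simp add: N_def)
  have sc: "N n *\<^sub>R e - x = N n *\<^sub>R (e - (1 / N n) *\<^sub>R x)" for n
    using N[of n] by (simp add: algebra_simps)
  have lim: "(\<lambda>n. e - (1 / N n) *\<^sub>R x) \<longlonglongrightarrow> e - 0 *\<^sub>R x" by (intro tendsto_intros inv)
  have nq: "norm (N n *\<^sub>R e - x) / N n = norm (e - (1 / N n) *\<^sub>R x)" for n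
    unfolding sc using N[of n] by simp
  have 1: "(\<lambda>n. norm (N n *\<^sub>R e - x) / N n) \<longlonglongrightarrow> 1"
    unfolding nq using tendsto_norm[OF lim] e by simp
  then show "(\<lambda>n. norm ((real n + 1) *\<^sub>R e - x) / (real n + 1)) \<longlonglongrightarrow> 1" by (simp add: N_def)
  have "e \<noteq> 0" using e by auto
  then have "(\<lambda>n. sgn (e - (1 / N n) *\<^sub>R x)) \<longlonglongrightarrow> sgn (e - 0 *\<^sub>R x)" using lim by (intro tendsto_sgn) auto
  moreover have "sgn (N n *\<^sub>R e - x) = sgn (e - (1 / N n) *\<^sub>R x)" for n
    unfolding sc using N[of n] by (simp add: sgn_scaleR)
  moreover have "sgn e = e" using e by (simp add: sgn_div_norm)
  ultimately show "(\<lambda>n. sgn ((real n + 1) *\<^sub>R e - x)) \<longlonglongrightarrow> e" by (simp add: N_def)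
  \<comment> \<open>Rationalising the difference: |N e - x|^2 - N^2 has leading term linear in N,
    and dividing by |N e - x| + N exhibits the limit.\<close>
  have "norm (N n *\<^sub>R e - x) - N n = (- 2 * (e \<bullet> x) + (norm x)\<^sup>2 * (1 / N n)) / (norm (N n *\<^sub>R e - x) / N n + 1)" for n
  proof -
    define d where "d = norm (N n *\<^sub>R e - x)"
    have d0: "d \<ge> 0" by (simp add: d_def)
    have ee: "e \<bullet> e = 1" using e by (simp add: norm_eq_1)
    have "d\<^sup>2 = (N n)\<^sup>2 - 2 * N n * (e \<bullet> x) + (norm x)\<^sup>2"
      unfolding d_def power2_norm_eq_inner
      by (simp add: inner_diff_left inner_diff_right inner_commute ee power2_eq_square)
    then have "(d - N n) * (d + N n) = N n * (- 2 * (e \<bullet> x) + (norm x)\<^sup>2 * (1 / N n))"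
      using N[of n] by (simp add: power2_eq_square algebra_simps)
    moreover have "d + N n = N n * (d / N n + 1)" using N[of n] by (simp add: algebra_simps)
    ultimately have "N n * ((d - N n) * (d / N n + 1)) = N n * (- 2 * (e \<bullet> x) + (norm x)\<^sup>2 * (1 / N n))"
      by (simp add: mult.left_commute)
    then have "(d - N n) * (d / N n + 1) = - 2 * (e \<bullet> x) + (norm x)\<^sup>2 * (1 / N n)"
      using N[of n] by simp
    moreover have "d / N n + 1 > 0" using d0 N[of n] by (intro add_nonneg_pos) auto
    ultimately show ?thesis unfolding d_def[symmetric] by (simp add: eq_divide_eq)
  qed
  moreover have "(\<lambda>n. (- 2 * (e \<bullet> x) + (norm x)\<^sup>2 * (1 / N n)) / (norm (N n *\<^sub>R e - x) / N n + 1))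
      \<longlonglongrightarrow> (- 2 * (e \<bullet> x) + (norm x)\<^sup>2 * 0) / (1 + 1)"
    by (intro tendsto_intros inv 1) simp
  ultimately show "(\<lambda>n. norm ((real n + 1) *\<^sub>R e - x) - (real n + 1)) \<longlonglongrightarrow> - (e \<bullet> x)"
    by (simp add: N_def)
qed

text \<open>Reflection in the sphere about x sends the far point N e to x + h with h tending to 0,
  so the constant term of \<open>u\<close> at infinity along e is governed by the first order
  expansion of \<open>u\<close> at x. The sequence itself does not involve x, which is what the next
  lemma exploits.\<close>

lemma expansion_at_infinity:
  assumes e: "norm e = 1"
  shows "(\<lambda>n. u ((real n + 1) *\<^sub>R e) - slope * (real n + 1)) \<longlonglongrightarrow> u x / slope * (g x \<bullet> e) - slope * (e \<bullet> x)"
proof -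
  define l where "l = u x / slope"
  have l: "l > 0" using pos[of x] slope_pos by (simp add: l_def)
  define d where "d n = (real n + 1) *\<^sub>R e - x" for n
  define h where "h n = inversion l (d n)" for n
  have ev: "\<forall>\<^sub>F n in sequentially. d n \<noteq> 0"
  proof -
    have "\<forall>\<^sub>F n in sequentially. real n + 1 \<ge> norm x + 1"
      using filterlim_real_add_1 unfolding filterlim_at_top by blast
    then show ?thesis
    proof eventually_elim
      case (elim n)
      have "norm ((real n + 1) *\<^sub>R e) \<noteq> norm x" using elim e by simp
      then show ?case by (auto simp: d_def)
    qed
  qed
  have dinf: "filterlim (\<lambda>n. norm (d n)) at_top sequentially"
    using filterlim_tendsto_add_at_top[OF tendsto_norm_ray(2)[OF e, of x] filterlim_real_add_1] by (simp add: d_def)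
  have nh: "norm (h n) = l\<^sup>2 / norm (d n)" for n using norm_inversion[OF l] by (simp add: h_def)
  have "(\<lambda>n. norm (h n)) \<longlonglongrightarrow> 0"
    unfolding nh by (rule real_tendsto_divide_at_top[OF tendsto_const dinf])
  then have h0: "h \<longlonglongrightarrow> 0" by (rule tendsto_norm_zero_cancel)
  have "\<forall>\<^sub>F n in sequentially. h n \<noteq> 0"
    using ev by eventually_elim (simp add: h_def inversion_nonzero[OF l])
  then have hat: "filterlim h (at 0) sequentially" using h0 by (simp add: filterlim_at eventually_conj_iff)
  have "((\<lambda>k. norm (u (x + k) - u x - g x \<bullet> k) / norm k) \<longlongrightarrow> 0) (at 0)"
    using grad[of x] by (simp add: has_derivative_at)
  from filterlim_compose[OF this hat]
  have "(\<lambda>n. norm ((u (x + h n) - u x - g x \<bullet> h n) / norm (h n))) \<longlonglongrightarrow> 0" by simp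
  then have r: "(\<lambda>n. (u (x + h n) - u x - g x \<bullet> h n) / norm (h n)) \<longlonglongrightarrow> 0" by (rule tendsto_norm_zero_cancel)
  have "(\<lambda>n. slope * (norm (d n) - (real n + 1)) + l * ((u (x + h n) - u x - g x \<bullet> h n) / norm (h n) + g x \<bullet> sgn (d n)))
      \<longlonglongrightarrow> slope * (- (e \<bullet> x)) + l * (0 + g x \<bullet> e)"
    unfolding d_def by (intro tendsto_intros tendsto_norm_ray[OF e] r[unfolded d_def])
  moreover have "\<forall>\<^sub>F n in sequentially. slope * (norm (d n) - (real n + 1)) + l * ((u (x + h n) - u x - g x \<bullet> h n) / norm (h n) + g x \<bullet> sgn (d n))
      = u ((real n + 1) *\<^sub>R e) - slope * (real n + 1)"
    using ev
  proof eventually_elim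
    case (elim n)
    have "u ((real n + 1) *\<^sub>R e) = norm (d n) / l * u (x + h n)"
      using reflection_symmetry_at[OF elim, of x] by (simp add: l_def h_def d_def)
    moreover have "g x \<bullet> h n / norm (h n) = g x \<bullet> sgn (d n)"
      unfolding nh using elim l by (simp add: h_def inversion_def sgn_div_norm field_simps power2_eq_square)
    moreover have "l / norm (h n) = norm (d n) / l" unfolding nh using l by (simp add: power2_eq_square)
    moreover have "slope * norm (d n) = norm (d n) / l * u x" using slope_pos pos[of x] by (simp add: l_def)
    moreover have "l * ((u (x + h n) - u x - g x \<bullet> h n) / norm (h n) + g x \<bullet> sgn (d n)) =
      l / norm (h n) * (u (x + h n) - u x) - l * (g x \<bullet> h n / norm (h n)) + l * (g x \<bullet> sgn (d n))"
      by (simp add: algebra_simps diff_divide_distrib add_divide_distrib)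
    ultimately show ?case by (simp add: right_diff_distrib)
  qed
  ultimately have "(\<lambda>n. u ((real n + 1) *\<^sub>R e) - slope * (real n + 1)) \<longlonglongrightarrow> slope * (- (e \<bullet> x)) + l * (0 + g x \<bullet> e)"
    by (rule Lim_transform_eventually)
  then show ?thesis by (simp add: l_def algebra_simps)
qed

text \<open>The limits in \<open>expansion_at_infinity\<close> for the centres x and 0 belong to the
  same sequence; equating them for every unit vector e gives the vector identity.\<close>

lemma gradient_equation: "u x *\<^sub>R g x = slope\<^sup>2 *\<^sub>R x + u 0 *\<^sub>R g 0"
proof -
  define V where "V = u x *\<^sub>R g x - slope\<^sup>2 *\<^sub>R x - u 0 *\<^sub>R g 0"
  have "V \<bullet> e = 0" if "norm e = 1" for e
  proof -
    have "u x / slope * (g x \<bullet> e) - slope * (e \<bullet> x) = u 0 / slope * (g 0 \<bullet> e) - slope * (e \<bullet> 0)"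
      by (rule LIMSEQ_unique[OF expansion_at_infinity[OF that] expansion_at_infinity[OF that]])
    then have "slope * (u x / slope * (g x \<bullet> e) - slope * (e \<bullet> x)) = slope * (u 0 / slope * (g 0 \<bullet> e) - slope * (e \<bullet> 0))"
      by simp
    then have "u x * (g x \<bullet> e) - slope\<^sup>2 * (x \<bullet> e) = u 0 * (g 0 \<bullet> e)"
      using slope_pos by (simp add: right_diff_distrib power2_eq_square inner_commute)
    moreover have "V \<bullet> e = u x * (g x \<bullet> e) - slope\<^sup>2 * (x \<bullet> e) - u 0 * (g 0 \<bullet> e)"
      by (simp add: V_def inner_diff_left)
    ultimately show ?thesis by simp
  qed
  \<comment> \<open>Testing with the direction of V itself yields |V| = 0; \<open>sgn 0 = 0\<close>
    covers the degenerate case.\<close>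
  then have "V \<bullet> sgn V = 0" by (cases "V = 0") (auto simp: norm_sgn)
  moreover have "V \<bullet> sgn V = norm V"
    by (cases "V = 0") (auto simp: sgn_div_norm power2_norm_eq_inner[symmetric] power2_eq_square)
  ultimately show ?thesis by (simp add: V_def algebra_simps)
qed

text \<open>By the gradient equation the square of \<open>u\<close> and this quadratic polynomial
  have the same derivative, and they agree at 0.\<close>

lemma square_formula: "(u x)\<^sup>2 = slope\<^sup>2 * (norm x)\<^sup>2 + 2 * u 0 * (g 0 \<bullet> x) + (u 0)\<^sup>2"
proof -
  define F where "F x = u x * u x - slope\<^sup>2 * (x \<bullet> x) - 2 * u 0 * (g 0 \<bullet> x)" for x
  have "(F has_derivative (\<lambda>h. 0)) (at x within UNIV)" for x
  proof -
    have "(F has_derivative (\<lambda>h. (u x * (g x \<bullet> h) + (g x \<bullet> h) * u x) - slope\<^sup>2 * (x \<bullet> h + h \<bullet> x) - 2 * u 0 * (g 0 \<bullet> h))) (at x)"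
      unfolding F_def[abs_def] by (auto intro!: derivative_eq_intros grad)
    moreover have "(u x * (g x \<bullet> h) + (g x \<bullet> h) * u x) - slope\<^sup>2 * (x \<bullet> h + h \<bullet> x) - 2 * u 0 * (g 0 \<bullet> h) = 0" for h
    proof -
      have "(u x *\<^sub>R g x) \<bullet> h = (slope\<^sup>2 *\<^sub>R x + u 0 *\<^sub>R g 0) \<bullet> h" by (rule arg_cong[OF gradient_equation])
      then show ?thesis by (simp add: inner_add_left inner_commute algebra_simps)
    qed
    ultimately show ?thesis by simp
  qed
  then have "\<exists>k. \<forall>x\<in>UNIV. F x = k" by (intro has_derivative_zero_constant) auto
  then have "F x = F 0" by auto
  then show ?thesis by (simp add: F_def power2_eq_square[of "u _"] power2_norm_eq_inner)
qed

text \<open>Completing the square about -b; k is positive because it is the value of the square of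
  \<open>u\<close> at that point.\<close>

lemma classification:
  "\<exists>C s x0. C > 0 \<and> s > 0 \<and> (\<forall>x. u x = C * sqrt (1 + (s * norm (x - x0))\<^sup>2))"
proof -
  define b where "b = (u 0 / slope\<^sup>2) *\<^sub>R g 0"
  define k where "k = (u 0)\<^sup>2 - slope\<^sup>2 * (norm b)\<^sup>2"
  have sq: "(u x)\<^sup>2 = slope\<^sup>2 * (norm (x - (- b)))\<^sup>2 + k" for x
  proof -
    have "(norm (x + b))\<^sup>2 = (norm x)\<^sup>2 + 2 * (b \<bullet> x) + (norm b)\<^sup>2"
      unfolding power2_norm_eq_inner by (simp add: inner_add_left inner_add_right inner_commute)
    moreover have "slope\<^sup>2 * (b \<bullet> x) = u 0 * (g 0 \<bullet> x)" using slope_pos by (simp add: b_def)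
    ultimately show ?thesis unfolding square_formula[of x] k_def by (simp add: algebra_simps)
  qed
  have k: "k > 0" using sq[of "- b"] pos[of "- b"] by (metis add_0 diff_self norm_zero mult_zero_right power_zero_numeral zero_less_power)
  have "u x = sqrt k * sqrt (1 + (slope / sqrt k * norm (x - (- b)))\<^sup>2)" for x
  proof -
    have "k * (1 + (slope / sqrt k * norm (x - (- b)))\<^sup>2) = (u x)\<^sup>2"
      unfolding sq[of x] using k by (simp add: power_mult_distrib power_divide algebra_simps)
    then have "sqrt (k * (1 + (slope / sqrt k * norm (x - (- b)))\<^sup>2)) = u x"
      using pos[of x] by simp
    then show ?thesis by (simp add: real_sqrt_mult)
  qed
  moreover have "sqrt k > 0" "slope / sqrt k > 0" using k slope_pos by auto
  ultimately show ?thesis by blast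
qed

end

section \<open>Assembling the theorem\<close>

lemma Ck_gradient:
  fixes u :: "real^'n::finite \<Rightarrow> real"
  assumes "Ck (Suc (Suc k)) u"
  defines "g \<equiv> \<lambda>x. \<chi> i. partial i u x"
  shows "(u has_derivative (\<lambda>v. g x \<bullet> v)) (at x)" and "continuous_on UNIV g"
proof -
  have D: "(u has_derivative frechet_derivative u (at x)) (at x)"
    using assms(1) by (simp add: frechet_derivative_works[symmetric])
  have "frechet_derivative u (at x) v = g x \<bullet> v" for v
  proof -
    have "frechet_derivative u (at x) (\<Sum>i\<in>UNIV. (v $ i) *\<^sub>R axis i 1) = (\<Sum>i\<in>UNIV. v $ i * partial i u x)"
      by (simp add: linear_sum[OF has_derivative_linear[OF D]] linear_scale[OF has_derivative_linear[OF D]] partial_def)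
    moreover have "(\<Sum>i\<in>UNIV. (v $ i) *\<^sub>R axis i (1::real)) = v"
      using basis_expansion[of v] by (simp add: scalar_mult_eq_scaleR)
    ultimately show ?thesis by (simp add: g_def inner_vec_def mult.commute)
  qed
  then have "frechet_derivative u (at x) = (\<lambda>v. g x \<bullet> v)" by auto
  with D show "(u has_derivative (\<lambda>v. g x \<bullet> v)) (at x)" by simp
  show "continuous_on UNIV g" unfolding g_def using assms(1) by (intro continuous_on_vec_lambda) simp
qed

theorem mainTheorem11:
  fixes u :: "real^5 \<Rightarrow> real" and q \<alpha> :: real
  assumes "q > 6"
    and "Ck 6 u"
    and "\<forall>x. u x > 0"
    and "\<forall>x. (laplacian ^^ 3) u x = u x powr (-q)"
    and "\<alpha> \<ge> 0"
    and "((\<lambda>x. u x / norm x) \<longlongrightarrow> \<alpha>) at_infinity"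
  shows "\<exists>\<gamma>::real.
      (\<forall>x. (\<lambda>y. norm (x - y) * u y powr (-q)) integrable_on UNIV
         \<and> u x = 1 / (64 * pi\<^sup>2) * integral UNIV (\<lambda>y. norm (x - y) * u y powr (-q)) + \<gamma>)
      \<and> (q < 11 \<longrightarrow> \<gamma> < 0) \<and> (q = 11 \<longrightarrow> \<gamma> = 0) \<and> (q > 11 \<longrightarrow> \<gamma> > 0)
      \<and> (q = 11 \<longrightarrow> (\<exists>c s :: real. \<exists>x0 :: real^5. c > 0 \<and> s > 0 \<and>
      (\<forall>x. u x = c * sqrt (1 + (s * norm (x - x0))\<^sup>2))))"
proof -
  define f where "f x = u x powr (-q)" for x
  define c where "c = 1 / (64 * pi\<^sup>2)"
  have c: "c > 0" by (simp add: c_def)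
  have u: "Ck 6 u" and pos: "\<And>x. u x > 0" and lim: "((\<lambda>x. u x / norm x) \<longlongrightarrow> \<alpha>) at_infinity"
    using assms by auto
  have lap: "(laplacian ^^ 3) u = f" using assms(4) by (auto simp: f_def)
  have f_pos: "f x > 0" for x using pos[of x] by (simp add: f_def)
  have cont: "continuous_on UNIV u" using u by (rule Ck_continuous)
  have cf: "continuous_on UNIV f"
    unfolding f_def[abs_def] using pos by (intro continuous_intros cont) (metis less_irrefl)
  have intf: "integrable lborel f"
    using integrable_triharmonic[OF u lim] f_pos cf by (simp add: lap less_imp_le)
  have rep: "u x - u 0 = c * (LBINT y. (norm (x - y) - norm y) * f y)" for x
    using triharmonic_difference_formula[OF u lim, of x] intf by (simp add: lap c_def field_simps)
  \<comment> \<open>The hypothesis gives only \<alpha> >= 0; strict positivity comes from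
    identifying \<alpha> with c times the mass of the positive function \<open>f\<close>.\<close>
  have \<alpha>: "\<alpha> > 0"
    using slope_at_infinity[OF lim intf rep] integral_pos_lborel[OF intf f_pos] c by simp
  obtain \<kappa> where \<kappa>: "\<kappa> > 0" "\<And>x. u x \<ge> \<kappa> * (1 + norm x)"
    using linear_lower_bound[OF cont pos \<alpha> lim] by blast
  have u6: "Ck (Suc (Suc 4)) u" using u by (simp add: eval_nat_numeral)
  note grad = Ck_gradient[OF u6]
  \<comment> \<open>Splitting the difference formula into two integrals needs |y| f integrable,
    which becomes available through the lower bound for \<open>u\<close>; \<gamma> collects the
    terms at 0.\<close>
  define \<gamma> where "\<gamma> = u 0 - c * (LBINT y. norm y * f y)"
  have diff: "u differentiable at x" for x using grad(1) differentiable_def by blast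
  interpret G: linear_growth u q \<kappa> by unfold_locales (use assms(1) \<kappa> diff in auto)
  have inorm: "integrable lborel (\<lambda>y. norm (x - y) * f y)" for x
    using G.integrable_dist_f[of x] by (simp add: G.f_def f_def)
  have eq: "u x = c * (LBINT y. norm (x - y) * f y) + \<gamma>" for x
    using rep[of x] inorm[of x] inorm[of 0] by (simp add: \<gamma>_def left_diff_distrib right_diff_distrib)
  interpret E: integral_equation u q \<kappa> c \<gamma>
  proof
    show "u x = c * (LBINT y. norm (x - y) * u y powr (-q)) + \<gamma>" for x using eq[of x] by (simp add: f_def)
  qed (rule c)
  have class11: "\<exists>c s :: real. \<exists>x0 :: real^5. c > 0 \<and> s > 0 \<and> (\<forall>x. u x = c * sqrt (1 + (s * norm (x - x0))\<^sup>2))"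
    if q: "q = 11"
  proof -
    have "\<gamma> = 0" using E.sign_\<gamma> q by (simp add: sgn_0_0)
    then interpret C: conformal_equation u \<kappa> c "\<lambda>x. \<chi> i. partial i u x"
      using E.integral_equation_axioms grad q
      by (intro conformal_equation.intro conformal_equation_axioms.intro) auto
    show ?thesis by (rule C.classification)
  qed
  \<comment> \<open>The claim is about the gauge integral over \<open>UNIV\<close>, which agrees
    with the Lebesgue integral for Lebesgue integrable functions.\<close>
  have HK: "(\<lambda>y. norm (x - y) * u y powr (-q)) integrable_on UNIV
      \<and> u x = 1 / (64 * pi\<^sup>2) * integral UNIV (\<lambda>y. norm (x - y) * u y powr (-q)) + \<gamma>" for x
    using integrable_on_lborel[OF inorm[of x]] integral_lborel[OF inorm[of x]] eq[of x]
    by (simp add: f_def c_def)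
  have "q < 11 \<longrightarrow> \<gamma> < 0" "q = 11 \<longrightarrow> \<gamma> = 0" "q > 11 \<longrightarrow> \<gamma> > 0"
    using E.sign_\<gamma> by (auto simp: sgn_if split: if_splits)
  with HK class11 show ?thesis by blast
qed

end
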